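(* Let $X$ be a homogeneous tree of degree $q+1$ with $2\leq q<\infty$, with graph distance $\mathrm d$ and a distinguished vertex $x_0\in X$. Let $\dot\varphi:\mathbb N_0\to\mathbb C$ be given, let $\varphi(x)=\dot\varphi(\mathrm d(x,x_0))$ $(x\in X)$ and $\tilde\varphi(x,y)=\dot\varphi(\mathrm d(x,y))$ $(x,y\in X)$. Let $H=(h_{i,j})_{i,j\in\mathbb N_0}$ be the Hankel matrix $h_{i,j}=\dot\varphi(i+j)-\dot\varphi(i+j+2)$. Then the following are equivalent: (i) $\tilde\varphi$ is a Schur multiplier on $X\times X$; (ii) $H$ is of trace class on $\ell^2(\mathbb N_0)$. If these equivalent conditions hold, then there exist unique constants $c_\pm\in\mathbb C$ and a unique $\dot\psi:\mathbb N_0\to\mathbb C$ with $\dot\varphi(n)=c_++c_-(-1)^n+\dot\psi(n)$ for all $n\in\mathbb N_0$ and $\lim_{n\to\infty}\dot\psi(n)=0$, and $$\|\tilde\varphi\|_S=|c_+|+|c_-|+\big(1-\tfrac1q\big)\Big\|\big(I-\tfrac{\tau}{q}\big)^{-1}H\Big\|_1 .$$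
   Context: A homogeneous tree of degree $q+1$ is a connected graph without cycles in which every vertex has exactly $q+1$ neighbours; $\mathrm d$ is the graph distance. For a set $Y$, a function $\psi:Y\times Y\to\mathbb C$ is a Schur multiplier if for every bounded operator $A=(a_{x,y})$ on $\ell^2(Y)$ the matrix $(\psi(x,y)a_{x,y})_{x,y\in Y}$ again defines a bounded operator $M_\psi A$; then $M_\psi$ is bounded on $\mathbf B(\ell^2(Y))$ and $\|\psi\|_S:=\|M_\psi\|$ is the Schur norm. $\|\cdot\|_1$ is the trace class norm. $S$ is the forward shift $Se_n=e_{n+1}$ on $\ell^2(\mathbb N_0)$, $\tau(A)=SAS^*$ for trace class $A$, and $\big(I-\tfrac{\tau}{q}\big)^{-1}A=\sum_{n=0}^\infty q^{-n}\tau^n(A)$ (a bounded operator on the trace class operators). *)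

theory Defs
  imports "HOL-Analysis.Analysis"
begin

definition is_walk :: "('v \<Rightarrow> 'v \<Rightarrow> bool) \<Rightarrow> 'v list \<Rightarrow> 'v \<Rightarrow> 'v \<Rightarrow> bool" where
  "is_walk E xs x y \<longleftrightarrow> xs \<noteq> [] \<and> hd xs = x \<and> last xs = y \<and>
     (\<forall>i < length xs - 1. E (xs ! i) (xs ! Suc i))"

definition is_cycle :: "('v \<Rightarrow> 'v \<Rightarrow> bool) \<Rightarrow> 'v list \<Rightarrow> bool" where
  "is_cycle E xs \<longleftrightarrow> length xs \<ge> 3 \<and> distinct xs \<and>
     (\<forall>i < length xs - 1. E (xs ! i) (xs ! Suc i)) \<and> E (last xs) (hd xs)"

definition homogeneous_tree :: "('v \<Rightarrow> 'v \<Rightarrow> bool) \<Rightarrow> nat \<Rightarrow> bool" where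
  "homogeneous_tree E q \<longleftrightarrow>
     (\<forall>x y. E x y \<longleftrightarrow> E y x) \<and> (\<forall>x. \<not> E x x) \<and>
     (\<forall>x y. \<exists>xs. is_walk E xs x y) \<and>
     (\<nexists>xs. is_cycle E xs) \<and>
     (\<forall>x. finite {y. E x y} \<and> card {y. E x y} = q + 1)"

definition gdist :: "('v \<Rightarrow> 'v \<Rightarrow> bool) \<Rightarrow> 'v \<Rightarrow> 'v \<Rightarrow> nat" where
  "gdist E x y = (LEAST n. \<exists>xs. is_walk E xs x y \<and> length xs = Suc n)"

text \<open>A matrix A = (a x y) over the index set Y (a type) is tested against finitely
  supported vectors; it defines a bounded operator on l2(Y) iff these matrix
  coefficients are uniformly bounded over unit vectors, and the operator norm
  is the supremum.\<close>

definition op_norm_set :: "('i \<Rightarrow> 'i \<Rightarrow> complex) \<Rightarrow> real set" where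
  "op_norm_set A = {cmod (\<Sum>x\<in>F. \<Sum>y\<in>F. cnj (u x) * A x y * v y) | F u v.
      finite F \<and> (\<Sum>x\<in>F. (cmod (u x))\<^sup>2) \<le> 1 \<and> (\<Sum>y\<in>F. (cmod (v y))\<^sup>2) \<le> 1}"

definition bounded_matrix :: "('i \<Rightarrow> 'i \<Rightarrow> complex) \<Rightarrow> bool" where
  "bounded_matrix A \<longleftrightarrow> bdd_above (op_norm_set A)"

definition op_norm :: "('i \<Rightarrow> 'i \<Rightarrow> complex) \<Rightarrow> real" where
  "op_norm A = Sup (op_norm_set A)"

definition schur_multiplier :: "('i \<Rightarrow> 'i \<Rightarrow> complex) \<Rightarrow> bool" where
  "schur_multiplier \<psi> \<longleftrightarrow>
     (\<forall>A. bounded_matrix A \<longrightarrow> bounded_matrix (\<lambda>x y. \<psi> x y * A x y))"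

definition schur_norm :: "('i \<Rightarrow> 'i \<Rightarrow> complex) \<Rightarrow> real" where
  "schur_norm \<psi> = Sup {op_norm (\<lambda>x y. \<psi> x y * A x y) | A.
      bounded_matrix A \<and> op_norm A \<le> 1}"

text \<open>Trace norm: supremum of sum_i |<A e_i, f_i>| over finite orthonormal systems
  (e_i), (f_i) of finitely supported vectors. A is trace class iff this is finite.\<close>

definition orthonormal_on :: "'i set \<Rightarrow> nat \<Rightarrow> (nat \<Rightarrow> 'i \<Rightarrow> complex) \<Rightarrow> bool" where
  "orthonormal_on F n e \<longleftrightarrow>
     (\<forall>i<n. \<forall>j<n. (\<Sum>x\<in>F. cnj (e i x) * e j x) = (if i = j then 1 else 0))"

definition trace_norm_set :: "('i \<Rightarrow> 'i \<Rightarrow> complex) \<Rightarrow> real set" where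
  "trace_norm_set A = {(\<Sum>i<n. cmod (\<Sum>x\<in>F. \<Sum>y\<in>F. cnj (f i x) * A x y * e i y)) | n F e f.
      finite F \<and> orthonormal_on F n e \<and> orthonormal_on F n f}"

definition trace_class :: "('i \<Rightarrow> 'i \<Rightarrow> complex) \<Rightarrow> bool" where
  "trace_class A \<longleftrightarrow> bdd_above (trace_norm_set A)"

definition trace_norm :: "('i \<Rightarrow> 'i \<Rightarrow> complex) \<Rightarrow> real" where
  "trace_norm A = Sup (trace_norm_set A)"

text \<open>tau(A) = S A S^* has entries (i,j) |-> A (i-1) (j-1) for i,j >= 1 and 0 otherwise,
  the resolvent is the series sum_n q^{-n} tau^n(A), taken entrywise (trace-norm
  convergence implies entrywise convergence; here only finitely many terms are nonzero).\<close>

definition tau :: "(nat \<Rightarrow> nat \<Rightarrow> complex) \<Rightarrow> nat \<Rightarrow> nat \<Rightarrow> complex" where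
  "tau A i j = (if 1 \<le> i \<and> 1 \<le> j then A (i - 1) (j - 1) else 0)"

definition tau_resolvent :: "nat \<Rightarrow> (nat \<Rightarrow> nat \<Rightarrow> complex) \<Rightarrow> nat \<Rightarrow> nat \<Rightarrow> complex" where
  "tau_resolvent q A i j = (\<Sum>n. (1 / of_nat q) ^ n * (tau ^^ n) A i j)"


definition hankel :: "(nat \<Rightarrow> complex) \<Rightarrow> nat \<Rightarrow> nat \<Rightarrow> complex" where
  "hankel \<phi> i j = \<phi> (i + j) - \<phi> (i + j + 2)"

definition pm_decomp :: "(nat \<Rightarrow> complex) \<Rightarrow> complex \<Rightarrow> complex \<Rightarrow> (nat \<Rightarrow> complex) \<Rightarrow> bool" where
  "pm_decomp \<phi> cp cm \<psi> \<longleftrightarrow> (\<forall>n. \<phi> n = cp + cm * (-1) ^ n + \<psi> n) \<and> \<psi> \<longlonglongrightarrow> 0"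

end

theory Submission
  imports Defs
begin

text \<open>
  Orient the tree towards a boundary point, let \<open>c\<close> be the parent map and let
  \<open>V \<eta> x = \<eta> (c x) / sqrt q\<close> be the corresponding isometry of
  \<open>\<ell>\<^sup>2(X)\<close>. The kernel \<open>G v w = [v = w] - [c v = c w] / q\<close> is the Gram matrix of the vectors
  \<open>(I - V V\<^sup>*) \<delta>\<^sub>v\<close>. With \<open>h' = (I - \<tau>/q)\<^sup>-\<^sup>1 H\<close>, the sum of
  \<open>h' k l * G (c\<^sup>k x) (c\<^sup>l y)\<close> over all \<open>k, l\<close> telescopes to \<open>\<psi> (d x y)\<close>; since the
  matrix \<open>G (c\<^sup>k x) (c\<^sup>k' x)\<close> is \<open>1 - 1/q\<close> times the identity for every \<open>x\<close>, pairing \<open>h'\<close>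
  with a contraction gives the upper bound, the two constants contributing \<open>|c\<^sub>+| + |c\<^sub>-|\<close>
  because \<open>(-1) ^ d x y\<close> has rank one.

  For the lower bound, the Wold decomposition of \<open>V\<close> turns every contraction \<open>B\<close> on
  \<open>\<ell>\<^sup>2(\<nat>)\<close> into the contraction \<open>\<Sum> B i j * V\<^sup>i (I - V V\<^sup>*) V\<^sup>*\<^sup>j\<close> on
  \<open>\<ell>\<^sup>2(X)\<close>. Testing the multiplier on it with an average of normalised indicators of generations
  returns \<open>(1 - 1/q) * (\<Sum> B i j * h' i j)\<close>, and a summand supported on the range of \<open>V\<^sup>N\<close> with
  large \<open>N\<close> recovers \<open>c\<^sub>+\<close> and \<open>c\<^sub>-\<close> independently.
\<close>

section \<open>Sesquilinear forms of matrices\<close>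

text \<open>Rooting the tree at a vertex would make the root exceptional, with q + 1 children, and
  the paths towards it finite. A boundary point gives every vertex exactly q children and an
  infinite ray of ancestors, so V is an isometry without corrections and every entry of the
  resolvent occurs in the kernel sum. The factor 1 - 1/q is the squared norm of a point mass
  projected onto the orthogonal complement of the range of V. The exact norm needs one contraction
  that reaches |c+|, |c-| and the trace term at once, although the constants do not decay. The test
  contraction is a direct sum: on the first N Wold components it sees only the resolvent, and on the
  range of V^N it sees, in the limit, only the even and odd limits of the symbol. The phases of the
  three contributions are therefore free. Statement (i) says only that every image is bounded, so a
  uniform bound has to be derived before any estimate applies. Operators enter through forms on
  finite sets, and trace duality is obtained from a finite dimensional dilation.\<close>

definition form :: "'i set \<Rightarrow> ('i \<Rightarrow> 'i \<Rightarrow> complex) \<Rightarrow> ('i \<Rightarrow> complex) \<Rightarrow> ('i \<Rightarrow> complex) \<Rightarrow> complex" where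
  "form F A u v = (\<Sum>x\<in>F. \<Sum>y\<in>F. cnj (u x) * A x y * v y)"

definition sqnorm_on :: "'i set \<Rightarrow> ('i \<Rightarrow> complex) \<Rightarrow> real" where
  "sqnorm_on F u = (\<Sum>x\<in>F. (cmod (u x))\<^sup>2)"

text \<open>The arithmetic mean instead of the geometric mean of the two norms makes no difference
  for the operator norm, and it is additive under orthogonal decompositions.\<close>

definition form_bounded :: "'i set \<Rightarrow> ('i \<Rightarrow> 'i \<Rightarrow> complex) \<Rightarrow> real \<Rightarrow> bool" where
  "form_bounded F A M \<longleftrightarrow> (\<forall>u v. cmod (form F A u v) \<le> M * (sqnorm_on F u + sqnorm_on F v) / 2)"

lemma sqnorm_on_nonneg [simp]: "0 \<le> sqnorm_on F u"
  by (simp add: sqnorm_on_def sum_nonneg)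

lemma sqnorm_on_scale: "sqnorm_on F (\<lambda>x. c * u x) = (cmod c)\<^sup>2 * sqnorm_on F u"
  by (simp add: sqnorm_on_def norm_mult power_mult_distrib sum_distrib_left)

lemma form_scale: "form F A (\<lambda>x. a * u x) (\<lambda>y. b * v y) = cnj a * b * form F A u v"
  by (simp add: form_def sum_distrib_left mult_ac)

lemma sqnorm_on_eq_0: "finite F \<Longrightarrow> sqnorm_on F u = 0 \<longleftrightarrow> (\<forall>x\<in>F. u x = 0)"
  by (simp add: sqnorm_on_def sum_nonneg_eq_0_iff)

lemma cmod_mult_le_mean: "cmod (cnj a * b) \<le> ((cmod a)\<^sup>2 + (cmod b)\<^sup>2) / 2"
  using sum_squares_bound[of "cmod a" "cmod b"] by (simp add: norm_mult)

lemma Re_cnj_mult_self: "Re (cnj z * z) = (cmod z)\<^sup>2"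
  unfolding cmod_power2 by (simp add: power2_eq_square)

text \<open>Normalising both vectors gives the bound \<open>M * (?a * ?b)\<close>, which the
  inequality of arithmetic and geometric means weakens to the stated one. A vector that vanishes on
  \<open>F\<close> makes the form vanish, and there \<open>0 \<le> M\<close> is enough.\<close>

lemma form_bounded_if_unit:
  assumes F: "finite F" and M: "0 \<le> M"
    and unit: "\<And>u v. sqnorm_on F u \<le> 1 \<Longrightarrow> sqnorm_on F v \<le> 1 \<Longrightarrow> cmod (form F A u v) \<le> M"
  shows "form_bounded F A M"
  unfolding form_bounded_def
proof (intro allI)
  fix u v
  let ?a = "sqrt (sqnorm_on F u)" and ?b = "sqrt (sqnorm_on F v)"
  show "cmod (form F A u v) \<le> M * (sqnorm_on F u + sqnorm_on F v) / 2"
  proof (cases "sqnorm_on F u = 0 \<or> sqnorm_on F v = 0")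
    case True
    then have "form F A u v = 0"
      using F by (auto simp: form_def sqnorm_on_eq_0)
    then show ?thesis using M by simp
  next
    case False
    then have pos: "?a > 0" "?b > 0"
      using sqnorm_on_nonneg[of F u] sqnorm_on_nonneg[of F v] by (auto simp: less_le)
    have sq: "?a\<^sup>2 = sqnorm_on F u" "?b\<^sup>2 = sqnorm_on F v" by simp_all
    have n: "sqnorm_on F (\<lambda>x. complex_of_real (1/?a) * u x) \<le> 1"
        "sqnorm_on F (\<lambda>x. complex_of_real (1/?b) * v x) \<le> 1"
      unfolding sqnorm_on_scale using pos sq by (simp_all add: power_divide norm_divide)
    have "cmod (form F A (\<lambda>x. complex_of_real (1/?a) * u x) (\<lambda>x. complex_of_real (1/?b) * v x)) \<le> M"
      by (rule unit[OF n])
    then have "cmod (form F A u v) / (?a * ?b) \<le> M"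
      unfolding form_scale using pos by (simp add: norm_mult norm_divide)
    then have "cmod (form F A u v) \<le> M * (?a * ?b)"
      using pos by (simp add: field_simps)
    also have "\<dots> \<le> M * ((?a\<^sup>2 + ?b\<^sup>2) / 2)"
      using sum_squares_bound[of ?a ?b] by (intro mult_left_mono M) simp
    finally show ?thesis by (simp add: sq)
  qed
qed

lemma op_norm_set_altdef:
  "op_norm_set A = {cmod (form F A u v) | F u v. finite F \<and> sqnorm_on F u \<le> 1 \<and> sqnorm_on F v \<le> 1}"
  by (simp add: op_norm_set_def form_def sqnorm_on_def)

text \<open>On unit vectors the arithmetic mean is at most 1, so no constant is lost between
  \<open>form_bounded\<close> and the operator norm.\<close>

lemma op_norm_le:
  fixes A :: "'a \<Rightarrow> 'a \<Rightarrow> complex"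
  assumes "0 \<le> M" "\<And>F. finite F \<Longrightarrow> form_bounded F A M"
  shows "bounded_matrix A" "op_norm A \<le> M"
proof -
  have ub: "x \<le> M" if mem: "x \<in> op_norm_set A" for x
  proof -
    obtain F u v where x: "x = cmod (form F A u v)" "finite F" "sqnorm_on F u \<le> 1" "sqnorm_on F v \<le> 1"
      using mem unfolding op_norm_set_altdef by blast
    have "x \<le> M * (sqnorm_on F u + sqnorm_on F v) / 2"
      using assms(2)[OF x(2)] x(1) by (simp add: form_bounded_def)
    also have "\<dots> \<le> M * 2 / 2"
      using x assms(1) by (intro divide_right_mono mult_left_mono) auto
    finally show ?thesis by simp
  qed
  then show "bounded_matrix A" by (auto simp: bounded_matrix_def bdd_above_def)
  have "cmod (form {} A u u) \<in> op_norm_set A" for u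
    by (auto simp: op_norm_set_altdef sqnorm_on_def form_def intro!: exI[of _ "{}"])
  then have "op_norm_set A \<noteq> {}" by blast
  then show "op_norm A \<le> M" unfolding op_norm_def using ub by (rule cSup_least)
qed

lemma op_norm_nonneg: "bounded_matrix A \<Longrightarrow> 0 \<le> op_norm A"
  unfolding op_norm_def bounded_matrix_def
  by (rule cSup_upper) (auto simp: op_norm_set_altdef sqnorm_on_def form_def intro!: exI[of _ "{}"])

lemma form_bounded_op_norm:
  assumes "bounded_matrix A" "finite F"
  shows "form_bounded F A (op_norm A)"
proof (rule form_bounded_if_unit[OF assms(2) op_norm_nonneg[OF assms(1)]])
  fix u v assume "sqnorm_on F u \<le> 1" "sqnorm_on F v \<le> 1"
  then show "cmod (form F A u v) \<le> op_norm A"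
    unfolding op_norm_def using assms
    by (intro cSup_upper) (auto simp: op_norm_set_altdef bounded_matrix_def)
qed

lemma form_bounded_mono:
  assumes "form_bounded F A M" "M \<le> M'"
  shows "form_bounded F A M'"
  unfolding form_bounded_def
proof (intro allI)
  fix u v
  have "cmod (form F A u v) \<le> M * (sqnorm_on F u + sqnorm_on F v) / 2"
    using assms(1) by (simp add: form_bounded_def)
  also have "\<dots> \<le> M' * (sqnorm_on F u + sqnorm_on F v) / 2"
    using assms(2) by (intro divide_right_mono mult_right_mono) auto
  finally show "cmod (form F A u v) \<le> M' * (sqnorm_on F u + sqnorm_on F v) / 2" .
qed

section \<open>Trace norm duality\<close>

text \<open>Elimination of the last index: the Schur complement \<open>G'\<close> inherits the lower
  bound \<epsilon>, and the induction hypothesis factors it. A strictly positive \<epsilon>, rather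
  than mere semidefiniteness, keeps every pivot positive.\<close>

lemma cholesky:
  fixes G :: "nat \<Rightarrow> nat \<Rightarrow> complex"
  assumes "0 < \<epsilon>" "\<And>i j. G i j = cnj (G j i)"
    "\<And>u. \<epsilon> * sqnorm_on {..<n} u \<le> Re (form {..<n} G u u)"
  shows "\<exists>d. \<forall>i<n. \<forall>j<n. G i j = (\<Sum>k<n. d i k * cnj (d j k))"
  using assms(2,3)
proof (induction n arbitrary: G)
  case 0
  show ?case by simp
next
  case (Suc n)
  let ?g = "G n n"
  have expand: "form {..<Suc n} G u u = form {..<n} G u u + (\<Sum>i<n. cnj (u i) * G i n) * u n
      + cnj (u n) * (\<Sum>j<n. G n j * u j) + cnj (u n) * ?g * u n" for u
    unfolding form_def sum.lessThan_Suc sum.distrib sum_distrib_left sum_distrib_right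
    by (simp add: mult_ac add_ac)
  have herm: "(\<Sum>i<n. cnj (u i) * G i n) = cnj (\<Sum>j<n. G n j * u j)" for u
    unfolding cnj_sum
  proof (rule sum.cong[OF refl])
    fix i
    have "G i n = cnj (G n i)" by (rule Suc.prems)
    then show "cnj (u i) * G i n = cnj (G n i * u i)" by (simp add: mult.commute)
  qed
  have "\<epsilon> * sqnorm_on {..<Suc n} (\<lambda>i. if i = n then 1 else 0)
      \<le> Re (form {..<Suc n} G (\<lambda>i. if i = n then 1 else 0) (\<lambda>i. if i = n then 1 else 0))"
    by (rule Suc.prems)
  then have "\<epsilon> \<le> Re ?g"
    unfolding expand by (simp add: form_def sqnorm_on_def)
  then have g_pos: "0 < Re ?g" using \<open>0 < \<epsilon>\<close> by simp
  have "Im ?g = Im (cnj ?g)" by (rule arg_cong[OF Suc.prems(1)])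
  then have g: "?g = of_real (Re ?g)" by (simp add: complex_eq_iff)
  define s where "s = sqrt (Re ?g)"
  have s: "s > 0" "?g = of_real (s * s)"
    using g_pos by (simp add: s_def) (subst g, use g_pos in \<open>simp add: s_def\<close>)
  define G' where "G' i j = G i j - G i n * G n j / ?g" for i j
  have "\<exists>d. \<forall>i<n. \<forall>j<n. G' i j = (\<Sum>k<n. d i k * cnj (d j k))"
  proof (rule Suc.IH)
    show "G' i j = cnj (G' j i)" for i j
    proof -
      have "cnj (G' j i) = cnj (G j i) - cnj (G j n) * cnj (G n i) / cnj ?g"
        by (simp add: G'_def)
      also have "\<dots> = G i j - G n j * G i n / ?g"
        unfolding Suc.prems(1)[symmetric] ..
      finally show ?thesis by (simp add: G'_def mult.commute)
    qed
    fix u :: "nat \<Rightarrow> complex"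
    define t where "t = (\<Sum>j<n. G n j * u j)"
    \<comment> \<open>The last coordinate \<open>- t / ?g\<close> minimises the form over all
      extensions of \<open>u\<close>; the minimum is the form of the Schur complement at
      \<open>u\<close>.\<close>
    let ?w = "\<lambda>i. if i = n then - t / ?g else u i"
    have "\<epsilon> * sqnorm_on {..<n} u \<le> \<epsilon> * sqnorm_on {..<Suc n} ?w"
      using \<open>0 < \<epsilon>\<close> by (intro mult_left_mono) (auto simp: sqnorm_on_def)
    also have "\<dots> \<le> Re (form {..<Suc n} G ?w ?w)" by (rule Suc.prems)
    also have "form {..<Suc n} G ?w ?w = form {..<n} G u u - cnj t * t / ?g"
    proof -
      have "form {..<Suc n} G ?w ?w = form {..<n} G ?w ?w + (\<Sum>i<n. cnj (?w i) * G i n) * ?w n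
        + cnj (?w n) * (\<Sum>j<n. G n j * ?w j) + cnj (?w n) * ?g * ?w n" by (rule expand)
      also have "(\<Sum>i<n. cnj (?w i) * G i n) = (\<Sum>i<n. cnj (u i) * G i n)" by simp
      also have "\<dots> = cnj t" unfolding t_def by (rule herm)
      also have "(\<Sum>j<n. G n j * ?w j) = t" by (simp add: t_def)
      also have "form {..<n} G ?w ?w = form {..<n} G u u" by (simp add: form_def)
      also have "form {..<n} G u u + cnj t * ?w n + cnj (?w n) * t + cnj (?w n) * ?g * ?w n
          = form {..<n} G u u - cnj t * t / ?g"
        using \<open>s > 0\<close> unfolding s(2) by simp
      finally show ?thesis .
    qed
    also have "cnj t * t / ?g = (\<Sum>i<n. \<Sum>j<n. cnj (u i) * (G i n * G n j / ?g) * u j)"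
      unfolding t_def herm[symmetric] sum_product sum_divide_distrib by (simp add: mult_ac)
    also have "form {..<n} G u u - \<dots> = form {..<n} G' u u"
      by (simp add: form_def G'_def sum_subtractf algebra_simps)
    finally show "\<epsilon> * sqnorm_on {..<n} u \<le> Re (form {..<n} G' u u)" .
  qed
  then obtain d where d: "\<And>i j. i < n \<Longrightarrow> j < n \<Longrightarrow> G' i j = (\<Sum>k<n. d i k * cnj (d j k))"
    by blast
  \<comment> \<open>A new last column, the column of \<open>G\<close> divided by the root of the
    pivot, is appended to the factor of \<open>G'\<close>; the new row is zero before its diagonal
    entry.\<close>
  define e where "e i k = (if k = n then G i n / of_real s else if i = n then 0 else d i k)" for i k
  have "G i j = (\<Sum>k<Suc n. e i k * cnj (e j k))" if "i < Suc n" "j < Suc n" for i j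
  proof -
    have last: "e i n * cnj (e j n) = G i n * G n j / ?g"
    proof -
      have "e i n * cnj (e j n) = G i n * cnj (G j n) / of_real (s * s)" by (simp add: e_def)
      then show ?thesis using Suc.prems(1)[of n j] s(2) by simp
    qed
    have "(\<Sum>k<n. e i k * cnj (e j k)) = G i j - G i n * G n j / ?g"
    proof (cases "i = n \<or> j = n")
      case True
      then have "(\<Sum>k<n. e i k * cnj (e j k)) = 0" by (auto simp: e_def intro!: sum.neutral)
      then show ?thesis using True g_pos s by auto
    next
      case False
      then show ?thesis using that d[of i j] by (simp add: e_def G'_def)
    qed
    then show ?thesis by (simp add: last)
  qed
  then show ?case by blast
qed

text \<open>The difference of the two sides is the squared norm of the residual
  \<open>u - ?w\<close>, where \<open>?w\<close> is the projection of \<open>u\<close> onto the span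
  of the system.\<close>

lemma bessel_inequality:
  assumes "finite F" "orthonormal_on F n e"
  shows "(\<Sum>k<n. (cmod (\<Sum>x\<in>F. cnj (e k x) * u x))\<^sup>2) \<le> sqnorm_on F u"
proof -
  define c where "c k = (\<Sum>x\<in>F. cnj (e k x) * u x)" for k
  let ?w = "\<lambda>x. \<Sum>k<n. c k * e k x"
  let ?S = "\<Sum>k<n. cnj (c k) * c k"
  have "(\<Sum>x\<in>F. cnj (?w x) * u x) = (\<Sum>x\<in>F. \<Sum>k<n. cnj (c k) * (cnj (e k x) * u x))"
    by (simp add: sum_distrib_right mult.assoc)
  also have "\<dots> = ?S"
    by (subst sum.swap) (simp only: sum_distrib_left[symmetric] c_def)
  finally have 1: "(\<Sum>x\<in>F. cnj (?w x) * u x) = ?S" .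
  have "(\<Sum>x\<in>F. cnj (?w x) * ?w x)
      = (\<Sum>x\<in>F. \<Sum>k<n. \<Sum>l<n. cnj (c k) * c l * (cnj (e k x) * e l x))"
    unfolding cnj_sum sum_product by (intro sum.cong refl) (simp add: mult_ac)
  also have "\<dots> = (\<Sum>k<n. \<Sum>l<n. \<Sum>x\<in>F. cnj (c k) * c l * (cnj (e k x) * e l x))"
    by (subst sum.swap, intro sum.cong refl, rule sum.swap)
  also have "\<dots> = (\<Sum>k<n. \<Sum>l<n. cnj (c k) * c l * (if k = l then 1 else 0))"
    using assms(2) unfolding sum_distrib_left[symmetric] orthonormal_on_def
    by (intro sum.cong refl) simp
  also have "\<dots> = ?S" by (simp add: if_distrib[of "(*) _"] cong: if_cong)
  finally have 2: "(\<Sum>x\<in>F. cnj (?w x) * ?w x) = ?S" .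
  have "0 \<le> (\<Sum>x\<in>F. (cmod (u x - ?w x))\<^sup>2)" by (simp add: sum_nonneg)
  also have "\<dots> = Re (\<Sum>x\<in>F. cnj (u x - ?w x) * (u x - ?w x))"
    unfolding Re_sum Re_cnj_mult_self ..
  also have "(\<Sum>x\<in>F. cnj (u x - ?w x) * (u x - ?w x))
      = (\<Sum>x\<in>F. cnj (u x) * u x) - cnj (\<Sum>x\<in>F. cnj (?w x) * u x) - (\<Sum>x\<in>F. cnj (?w x) * u x)
        + (\<Sum>x\<in>F. cnj (?w x) * ?w x)"
    by (simp add: algebra_simps sum.distrib sum_subtractf)
  also have "Re \<dots> = Re (\<Sum>x\<in>F. cnj (u x) * u x) - Re ?S"
    unfolding 1 2 by simp
  also have "Re (\<Sum>x\<in>F. cnj (u x) * u x) = sqnorm_on F u"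
    unfolding sqnorm_on_def Re_sum Re_cnj_mult_self ..
  also have "Re ?S = (\<Sum>k<n. (cmod (c k))\<^sup>2)"
    unfolding Re_sum Re_cnj_mult_self ..
  finally show ?thesis by (simp add: c_def)
qed

text \<open>The vector \<open>?v\<close> is the adjoint of \<open>C\<close> applied to
  \<open>u\<close>, so the form at \<open>u\<close> and \<open>?v\<close> is the squared norm of
  \<open>?v\<close>. The bound by the arithmetic mean then gives the inequality directly, without
  square roots.\<close>

lemma contraction_gram_le:
  assumes F: "finite F" and C: "form_bounded F C 1"
  shows "(\<Sum>y\<in>F. (cmod (\<Sum>x\<in>F. cnj (u x) * C x y))\<^sup>2) \<le> sqnorm_on F u"
proof -
  let ?v = "\<lambda>y. cnj (\<Sum>x\<in>F. cnj (u x) * C x y)"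
  have "form F C u ?v = (\<Sum>y\<in>F. (\<Sum>x\<in>F. cnj (u x) * C x y) * ?v y)"
    unfolding form_def by (subst sum.swap) (simp add: sum_distrib_right)
  also have "\<dots> = of_real (sqnorm_on F ?v)"
    unfolding sqnorm_on_def of_real_sum by (intro sum.cong refl) (metis complex_norm_square complex_mod_cnj mult.commute complex_cnj_cnj)
  finally have "cmod (form F C u ?v) = sqnorm_on F ?v" by simp
  moreover have "cmod (form F C u ?v) \<le> 1 * (sqnorm_on F u + sqnorm_on F ?v) / 2"
    using C by (simp only: form_bounded_def)
  ultimately have "sqnorm_on F ?v \<le> sqnorm_on F u" by simp
  then show ?thesis unfolding sqnorm_on_def complex_mod_cnj .
qed

text \<open>A strict contraction \<open>C\<close> is the mean of the corners of the two co-isometries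
  \<open>(C, \<plusminus>D)\<close>, where \<open>D D\<^sup>* = I - C C\<^sup>*\<close>.\<close>

lemma strict_contraction_pairing_le:
  fixes A :: "nat \<Rightarrow> nat \<Rightarrow> complex"
  assumes A: "\<And>t. t \<in> trace_norm_set A \<Longrightarrow> t \<le> M"
    and C: "form_bounded {..<K} C 1" and r: "0 \<le> r" "r < 1"
  shows "cmod (\<Sum>i<K. \<Sum>j<K. A i j * (of_real r * C i j)) \<le> M"
proof -
  let ?rC = "\<lambda>i j. of_real r * C i j"
  \<comment> \<open>The factor \<open>r\<close> makes the form of \<open>G\<close> at least
    \<open>1 - r^2\<close> times the squared norm, which is the strict positivity that
    \<open>cholesky\<close> asks for.\<close>
  define G where "G i j = (if i = j then 1 else 0) - (\<Sum>k<K. ?rC i k * cnj (?rC j k))" for i j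
  have herm: "G i j = cnj (G j i)" for i j
    unfolding G_def by (simp add: mult_ac)
  have low: "(1 - r\<^sup>2) * sqnorm_on {..<K} u \<le> Re (form {..<K} G u u)" for u
  proof -
    let ?w = "\<lambda>k. \<Sum>i<K. cnj (u i) * C i k"
    let ?t = "\<lambda>i j k. cnj (u i) * u j * (?rC i k * cnj (?rC j k))"
    have "form {..<K} G u u
        = (\<Sum>i<K. \<Sum>j<K. (if i = j then cnj (u i) * u j else 0) - (\<Sum>k<K. ?t i j k))"
      unfolding form_def G_def sum_distrib_left[of "cnj _ * _", symmetric]
      by (intro sum.cong refl) (simp add: algebra_simps)
    also have "\<dots> = (\<Sum>i<K. cnj (u i) * u i) - (\<Sum>i<K. \<Sum>j<K. \<Sum>k<K. ?t i j k)"
      by (simp add: sum_subtractf)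
    also have "(\<Sum>i<K. \<Sum>j<K. \<Sum>k<K. ?t i j k) = (\<Sum>i<K. \<Sum>k<K. \<Sum>j<K. ?t i j k)"
      by (intro sum.cong refl sum.swap)
    also have "\<dots> = (\<Sum>k<K. \<Sum>i<K. \<Sum>j<K. ?t i j k)" by (rule sum.swap)
    also have "\<dots> = (\<Sum>k<K. of_real (r\<^sup>2) * (cnj (?w k) * ?w k))"
    proof (rule sum.cong[OF refl])
      fix k
      have "cnj (?w k) * ?w k = ?w k * cnj (?w k)" by (rule mult.commute)
      also have "?w k * cnj (?w k) = (\<Sum>i<K. \<Sum>j<K. (cnj (u i) * C i k) * (u j * cnj (C j k)))"
        by (simp add: sum_product)
      finally show "(\<Sum>i<K. \<Sum>j<K. ?t i j k) = of_real (r\<^sup>2) * (cnj (?w k) * ?w k)"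
        by (simp add: sum_distrib_left power2_eq_square mult_ac)
    qed
    finally have "Re (form {..<K} G u u)
        = (\<Sum>i<K. Re (cnj (u i) * u i)) - (\<Sum>k<K. r\<^sup>2 * Re (cnj (?w k) * ?w k))"
      by (simp only: minus_complex.simps Re_sum Re_complex_of_real times_complex.simps(1) Im_complex_of_real) simp
    also have "\<dots> = sqnorm_on {..<K} u - r\<^sup>2 * (\<Sum>k<K. (cmod (?w k))\<^sup>2)"
      unfolding Re_cnj_mult_self sqnorm_on_def by (simp only: sum_distrib_left[of "r\<^sup>2"])
    finally show ?thesis
      using mult_left_mono[OF contraction_gram_le[OF _ C, of u], of "r\<^sup>2"]
      by (simp add: algebra_simps)
  qed
  have "0 < 1 - r\<^sup>2" using r by (simp add: abs_square_less_1)
  from cholesky[OF this herm low] obtain d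
    where d: "\<And>i j. i < K \<Longrightarrow> j < K \<Longrightarrow> G i j = (\<Sum>k<K. d i k * cnj (d j k))" by blast
  \<comment> \<open>Columns below \<open>K\<close> carry the contraction, columns from
    \<open>K\<close> to \<open>2*K - 1\<close> carry \<open>s\<close> times the Cholesky factor. The
    entries of \<open>A\<close> in the additional columns enter \<open>Z s\<close> linearly in
    \<open>s\<close> and cancel between \<open>Z 1\<close> and \<open>Z (-1)\<close>.\<close>
  define e where "e s i j = (if j < K then ?rC i j else s * d i (j - K))" for s :: complex and i j
  define f :: "nat \<Rightarrow> nat \<Rightarrow> complex" where "f i j = (if i = j then 1 else 0)" for i j
  have split: "(\<Sum>j<2*K. g j) = (\<Sum>j<K. g j) + (\<Sum>j<K. g (j + K))" for g :: "nat \<Rightarrow> complex"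
    using sum.atLeastLessThan_concat[of 0 K "2 * K" g] sum.shift_bounds_nat_ivl[of g 0 K K]
    by (simp add: lessThan_atLeast0 mult_2)
  have orth_e: "orthonormal_on {..<2*K} K (e s)" if "cmod s = 1" for s
    unfolding orthonormal_on_def
  proof (intro allI impI)
    fix i j assume ij: "i < K" "j < K"
    have ss: "s * cnj s = 1" using that by (metis complex_norm_square of_real_1 power_one)
    have "(\<Sum>k<2*K. cnj (e s i k) * e s j k)
        = (\<Sum>k<K. ?rC j k * cnj (?rC i k)) + (\<Sum>k<K. (s * cnj s) * (d j k * cnj (d i k)))"
      unfolding split by (simp add: e_def mult_ac)
    also have "(\<Sum>k<K. (s * cnj s) * (d j k * cnj (d i k))) = G j i" using d[OF ij(2,1)] ss by simp
    finally show "(\<Sum>k\<in>{..<2*K}. cnj (e s i k) * e s j k) = (if i = j then 1 else 0)"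
      by (simp add: G_def)
  qed
  have orth_f: "orthonormal_on {..<2*K} K f"
    by (auto simp: orthonormal_on_def f_def if_distrib[of cnj] if_distrib[of "\<lambda>z. z * _"] cong: if_cong)
  define Z where "Z s = (\<Sum>i<K. \<Sum>j<2*K. A i j * e s i j)" for s
  have Z: "cmod (Z s) \<le> M" if "cmod s = 1" for s
  proof -
    have "(\<Sum>i<K. cmod (\<Sum>x<2*K. \<Sum>y<2*K. cnj (f i x) * A x y * e s i y)) \<in> trace_norm_set A"
      unfolding trace_norm_set_def mem_Collect_eq
      by (rule exI[of _ K], rule exI[of _ "{..<2*K}"], rule exI[of _ "e s"], rule exI[of _ f])
        (simp add: orth_e[OF that] orth_f)
    then have "(\<Sum>i<K. cmod (\<Sum>x<2*K. \<Sum>y<2*K. cnj (f i x) * A x y * e s i y)) \<le> M" by (rule A)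
    moreover have "(\<Sum>x<2*K. \<Sum>y<2*K. cnj (f i x) * A x y * e s i y) = (\<Sum>j<2*K. A i j * e s i j)"
      if "i < K" for i
    proof -
      have "(\<Sum>x<2*K. \<Sum>y<2*K. cnj (f i x) * A x y * e s i y)
          = (\<Sum>x<2*K. if x = i then (\<Sum>y<2*K. A i y * e s i y) else 0)"
        by (intro sum.cong refl) (auto simp: f_def)
      then show ?thesis using that by simp
    qed
    ultimately have "(\<Sum>i<K. cmod (\<Sum>j<2*K. A i j * e s i j)) \<le> M" by simp
    then show ?thesis unfolding Z_def by (rule order_trans[OF norm_sum])
  qed
  have "(\<Sum>i<K. \<Sum>j<K. A i j * ?rC i j) = (Z 1 + Z (-1)) / 2"
    unfolding Z_def split by (simp add: e_def sum.distrib sum_negf sum_subtractf)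
  then have "cmod (\<Sum>i<K. \<Sum>j<K. A i j * ?rC i j) \<le> (cmod (Z 1) + cmod (Z (-1))) / 2"
    by (simp only: norm_divide norm_numeral) (intro divide_right_mono norm_triangle_ineq, simp)
  then show ?thesis using Z[of 1] Z[of "-1"] by simp
qed

text \<open>The pairing is linear in the contraction, so the bound for \<open>r * C\<close> with
  \<open>r < 1\<close> passes to the limit \<open>r = 1\<close>. The pairing is the trace of
  \<open>A\<close> times the transpose of \<open>C\<close>; transposition does not affect
  contractivity.\<close>

lemma trace_norm_pairing_le:
  fixes A :: "nat \<Rightarrow> nat \<Rightarrow> complex"
  assumes A: "\<And>t. t \<in> trace_norm_set A \<Longrightarrow> t \<le> M"
    and C: "form_bounded {..<K} C 1"
  shows "cmod (\<Sum>i<K. \<Sum>j<K. A i j * C i j) \<le> M"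
proof -
  let ?c = "cmod (\<Sum>i<K. \<Sum>j<K. A i j * C i j)"
  have le: "r * ?c \<le> M" if "0 \<le> r" "r < 1" for r
  proof -
    have "(\<Sum>i<K. \<Sum>j<K. A i j * (of_real r * C i j)) = of_real r * (\<Sum>i<K. \<Sum>j<K. A i j * C i j)"
      by (simp add: sum_distrib_left mult_ac)
    then show ?thesis
      using strict_contraction_pairing_le[of A M K C r] A C that by (simp add: norm_mult)
  qed
  have "((\<lambda>r. r * ?c) \<longlongrightarrow> 1 * ?c) (at_left 1)"
    by (intro tendsto_intros)
  moreover have "\<forall>\<^sub>F r in at_left (1::real). r * ?c \<le> M"
    using eventually_at_left_real[of 0 "1::real"] by (auto elim!: eventually_mono intro: le)
  ultimately have "1 * ?c \<le> M"
    by (intro tendsto_upperbound) auto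
  then show ?thesis by simp
qed

text \<open>Converse half of the duality. For given orthonormal systems the sum of the rank one
  matrices \<open>w k * cnj (f k i) * e k j\<close> is a contraction by Bessel's inequality, applied
  to both systems. With the phases \<open>w k\<close> its pairing with \<open>A\<close> is the trace
  sum itself.\<close>

lemma trace_norm_set_le_of_pairing:
  fixes A :: "nat \<Rightarrow> nat \<Rightarrow> complex"
  assumes "\<And>K C. form_bounded {..<K} C 1 \<Longrightarrow> cmod (\<Sum>i<K. \<Sum>j<K. A i j * C i j) \<le> M"
    and "t \<in> trace_norm_set A"
  shows "t \<le> M"
proof -
  obtain n F e f where t: "t = (\<Sum>k<n. cmod (\<Sum>x\<in>F. \<Sum>y\<in>F. cnj (f k x) * A x y * e k y))"
    and F: "finite F" and e: "orthonormal_on F n e" and f: "orthonormal_on F n f"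
    using assms(2) by (auto simp: trace_norm_set_def)
  obtain K where K: "F \<subseteq> {..<K}" using finite_nat_bounded F by blast
  let ?z = "\<lambda>k. \<Sum>x\<in>F. \<Sum>y\<in>F. cnj (f k x) * A x y * e k y"
  define w where "w k = cnj (sgn (?z k))" for k
  have w: "cmod (w k) \<le> 1" "w k * ?z k = of_real (cmod (?z k))" for k
  proof -
    have "cmod (cnj (sgn z)) \<le> 1" "cnj (sgn z) * z = of_real (cmod z)" for z
      using complex_norm_square[of z]
      by (cases "z = 0"; auto simp: norm_divide sgn_eq power2_eq_square field_simps)+
    then show "cmod (w k) \<le> 1" "w k * ?z k = of_real (cmod (?z k))" unfolding w_def by blast+
  qed
  define C where "C i j = (if i \<in> F \<and> j \<in> F then \<Sum>k<n. w k * cnj (f k i) * e k j else 0)" for i j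
  have "form_bounded {..<K} C 1"
    unfolding form_bounded_def
  proof (intro allI)
    fix u v
    have "form {..<K} C u v = (\<Sum>x\<in>F. \<Sum>y\<in>F. cnj (u x) * (\<Sum>k<n. w k * cnj (f k x) * e k y) * v y)"
      unfolding form_def using K
      by (intro sum.mono_neutral_cong_right ballI) (auto simp: C_def intro!: sum.mono_neutral_cong_right)
    also have "\<dots> = (\<Sum>k<n. w k * ((\<Sum>x\<in>F. cnj (u x) * cnj (f k x)) * (\<Sum>y\<in>F. e k y * v y)))"
    proof -
      let ?t = "\<lambda>x y k. w k * (cnj (u x) * cnj (f k x) * (e k y * v y))"
      have "(\<Sum>x\<in>F. \<Sum>y\<in>F. cnj (u x) * (\<Sum>k<n. w k * cnj (f k x) * e k y) * v y)
          = (\<Sum>x\<in>F. \<Sum>y\<in>F. \<Sum>k<n. ?t x y k)"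
        unfolding sum_distrib_left sum_distrib_right by (simp add: mult_ac)
      also have "\<dots> = (\<Sum>x\<in>F. \<Sum>k<n. \<Sum>y\<in>F. ?t x y k)"
        by (intro sum.cong refl sum.swap)
      also have "\<dots> = (\<Sum>k<n. \<Sum>x\<in>F. \<Sum>y\<in>F. ?t x y k)" by (rule sum.swap)
      finally show ?thesis by (simp only: sum_product sum_distrib_left[symmetric])
    qed
    also have "cmod \<dots> \<le> (\<Sum>k<n. ((cmod (\<Sum>x\<in>F. cnj (f k x) * cnj (u x)))\<^sup>2 + (cmod (\<Sum>y\<in>F. e k y * v y))\<^sup>2) / 2)"
    proof (rule sum_norm_le)
      fix k
      have "cmod (w k * ((\<Sum>x\<in>F. cnj (u x) * cnj (f k x)) * (\<Sum>y\<in>F. e k y * v y)))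
          \<le> 1 * (cmod (\<Sum>x\<in>F. cnj (f k x) * cnj (u x)) * cmod (\<Sum>y\<in>F. e k y * v y))"
        unfolding norm_mult by (intro mult_mono w) (auto simp: mult.commute)
      also have "\<dots> \<le> ((cmod (\<Sum>x\<in>F. cnj (f k x) * cnj (u x)))\<^sup>2 + (cmod (\<Sum>y\<in>F. e k y * v y))\<^sup>2) / 2"
        using sum_squares_bound[of "cmod (\<Sum>x\<in>F. cnj (f k x) * cnj (u x))" "cmod (\<Sum>y\<in>F. e k y * v y)"]
        by simp
      finally show "cmod (w k * ((\<Sum>x\<in>F. cnj (u x) * cnj (f k x)) * (\<Sum>y\<in>F. e k y * v y)))
          \<le> ((cmod (\<Sum>x\<in>F. cnj (f k x) * cnj (u x)))\<^sup>2 + (cmod (\<Sum>y\<in>F. e k y * v y))\<^sup>2) / 2" .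
    qed
    also have "\<dots> = ((\<Sum>k<n. (cmod (\<Sum>x\<in>F. cnj (f k x) * cnj (u x)))\<^sup>2)
        + (\<Sum>k<n. (cmod (\<Sum>y\<in>F. cnj (e k y) * cnj (v y)))\<^sup>2)) / 2"
    proof -
      have "cmod (\<Sum>y\<in>F. cnj (e k y) * cnj (v y)) = cmod (\<Sum>y\<in>F. e k y * v y)" for k
        using complex_mod_cnj[of "\<Sum>y\<in>F. e k y * v y"] by (simp add: cnj_sum)
      then show ?thesis by (simp add: sum.distrib sum_divide_distrib[symmetric])
    qed
    also have "\<dots> \<le> (sqnorm_on F (\<lambda>x. cnj (u x)) + sqnorm_on F (\<lambda>x. cnj (v x))) / 2"
      by (intro divide_right_mono add_mono bessel_inequality F e f) simp
    also have "\<dots> \<le> (sqnorm_on {..<K} u + sqnorm_on {..<K} v) / 2"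
      unfolding sqnorm_on_def using K by (intro divide_right_mono add_mono) (auto intro!: sum_mono2)
    finally show "cmod (form {..<K} C u v) \<le> 1 * (sqnorm_on {..<K} u + sqnorm_on {..<K} v) / 2" by simp
  qed
  then have "cmod (\<Sum>i<K. \<Sum>j<K. A i j * C i j) \<le> M" by (rule assms(1))
  also have "(\<Sum>i<K. \<Sum>j<K. A i j * C i j) = (\<Sum>i\<in>F. \<Sum>j\<in>F. A i j * (\<Sum>k<n. w k * cnj (f k i) * e k j))"
    using K by (intro sum.mono_neutral_cong_right ballI) (auto simp: C_def intro!: sum.mono_neutral_cong_right)
  also have "\<dots> = (\<Sum>k<n. w k * ?z k)"
  proof -
    let ?t = "\<lambda>x y k. w k * (cnj (f k x) * A x y * e k y)"
    have "(\<Sum>i\<in>F. \<Sum>j\<in>F. A i j * (\<Sum>k<n. w k * cnj (f k i) * e k j))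
        = (\<Sum>x\<in>F. \<Sum>y\<in>F. \<Sum>k<n. ?t x y k)"
      unfolding sum_distrib_left by (simp add: mult_ac)
    also have "\<dots> = (\<Sum>x\<in>F. \<Sum>k<n. \<Sum>y\<in>F. ?t x y k)"
      by (intro sum.cong refl sum.swap)
    also have "\<dots> = (\<Sum>k<n. \<Sum>x\<in>F. \<Sum>y\<in>F. ?t x y k)" by (rule sum.swap)
    finally show ?thesis unfolding sum_distrib_left .
  qed
  also have "\<dots> = of_real t" unfolding t w(2) by simp
  finally show ?thesis by simp
qed

section \<open>Uniform boundedness of Schur multipliers\<close>

lemma form_add_scaled:
  "form F (\<lambda>x y. A x y + c * B x y) u v = form F A u v + c * form F B u v"
  by (simp add: form_def sum_distrib_left sum.distrib algebra_simps)

lemma form_schur_add_scaled: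
  "form F (\<lambda>x y. \<psi> x y * (A x y + c * B x y)) u v
     = form F (\<lambda>x y. \<psi> x y * A x y) u v + c * form F (\<lambda>x y. \<psi> x y * B x y) u v"
  using form_add_scaled[of F "\<lambda>x y. \<psi> x y * A x y" c "\<lambda>x y. \<psi> x y * B x y"]
  by (simp add: algebra_simps)

definition contraction :: "('i \<Rightarrow> 'i \<Rightarrow> complex) \<Rightarrow> bool" where
  "contraction A \<longleftrightarrow> (\<forall>F. finite F \<longrightarrow> form_bounded F A 1)"

lemma contraction_zero: "contraction (\<lambda>x y. 0)"
  by (simp add: contraction_def form_bounded_def form_def)

lemma contraction_entry_le:
  assumes "contraction A"
  shows "cmod (A x y) \<le> 1"
proof -
  define \<delta> :: "'a \<Rightarrow> 'a \<Rightarrow> complex" where "\<delta> z w = (if w = z then 1 else 0)" for z w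
  have *: "(\<Sum>w\<in>{x,y}. f w * \<delta> z w) = f z" if "z \<in> {x,y}" for z f
    using that by (cases "x = y") (auto simp: \<delta>_def)
  have "sqnorm_on {x,y} (\<delta> z) = 1" if "z \<in> {x,y}" for z
    unfolding sqnorm_on_def using that by (cases "x = y") (auto simp: \<delta>_def)
  moreover have "form {x,y} A (\<delta> x) (\<delta> y) = A x y"
  proof -
    have "form {x,y} A (\<delta> x) (\<delta> y) = (\<Sum>w\<in>{x,y}. A w y * \<delta> x w)"
      unfolding form_def by (subst *) (auto simp: \<delta>_def intro!: sum.cong)
    also have "\<dots> = A x y" by (rule *) simp
    finally show ?thesis .
  qed
  moreover have "cmod (form {x,y} A (\<delta> x) (\<delta> y)) \<le> 1 * (sqnorm_on {x,y} (\<delta> x) + sqnorm_on {x,y} (\<delta> y)) / 2"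
    using assms unfolding contraction_def form_bounded_def by (meson finite.intros)
  ultimately show ?thesis by simp
qed

text \<open>Entries of a contraction are at most 1 in modulus. The bound depends on
  \<open>F\<close>, \<open>u\<close> and \<open>v\<close>, but makes the supremum over all
  contractions finite for each fixed choice of them.\<close>

lemma form_schur_entry_bound:
  assumes "contraction A"
  shows "cmod (form F (\<lambda>x y. \<psi> x y * A x y) u v) \<le> (\<Sum>x\<in>F. \<Sum>y\<in>F. cmod (u x) * cmod (\<psi> x y) * cmod (v y))"
  unfolding form_def
proof (intro sum_norm_le)
  fix x y
  have "cmod (u x) * (cmod (\<psi> x y) * cmod (A x y)) * cmod (v y) \<le> cmod (u x) * (cmod (\<psi> x y) * 1) * cmod (v y)"
    by (intro mult_mono contraction_entry_le[OF assms]) auto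
  then show "cmod (cnj (u x) * (\<psi> x y * A x y) * v y) \<le> cmod (u x) * cmod (\<psi> x y) * cmod (v y)"
    by (simp add: norm_mult)
qed

text \<open>Sokal's elementary argument: among \<open>X + Y\<close> and \<open>X - Y\<close> one has a
  functional at least as large as at \<open>Y\<close>, so signs can be chosen successively in
  a geometrically weighted series of contractions.\<close>

lemma signed_series_unbounded:
  fixes A :: "nat \<Rightarrow> 'i \<Rightarrow> 'i \<Rightarrow> complex" and F :: "nat \<Rightarrow> 'i set"
  assumes A: "\<And>n. contraction (A n)" and F: "\<And>n. finite (F n)"
    and unit: "\<And>n. sqnorm_on (F n) (u n) \<le> 1" "\<And>n. sqnorm_on (F n) (v n) \<le> 1"
    and t: "\<And>n B. contraction B \<Longrightarrow> cmod (form (F n) (\<lambda>x y. \<psi> x y * B x y) (u n) (v n)) \<le> t n"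
    and large: "\<And>n. 4 ^ n < t n" "\<And>n. 3 / 4 * t n < cmod (form (F n) (\<lambda>x y. \<psi> x y * A n x y) (u n) (v n))"
  shows "\<not> schur_multiplier \<psi>"
proof
  assume schur: "schur_multiplier \<psi>"
  define T where "T n B = form (F n) (\<lambda>x y. \<psi> x y * B x y) (u n) (v n)" for n B
  have T_add: "T n (\<lambda>x y. B x y + c * D x y) = T n B + c * T n D" for n B c D
    unfolding T_def by (rule form_schur_add_scaled)
  \<comment> \<open>The sign at step \<open>n\<close> looks only at the functional
    \<open>T n\<close>: the better of the two signs keeps at least the size of the added term,
    whatever the earlier terms have accumulated.\<close>
  define sg :: "nat \<Rightarrow> ('i \<Rightarrow> 'i \<Rightarrow> complex) \<Rightarrow> complex" where
    "sg n Y = (if cmod (T n Y + (1/3)^n * T n (A n)) \<ge> cmod (T n Y - (1/3)^n * T n (A n)) then 1 else -1)" for n Y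
  define X where "X = rec_nat (\<lambda>x y. 0) (\<lambda>n Y. \<lambda>x y. Y x y + sg n Y * (1/3)^n * A n x y)"
  define s where "s n = sg n (X n)" for n
  have X_0: "X 0 = (\<lambda>x y. 0)" and X_Suc: "X (Suc n) = (\<lambda>x y. X n x y + (s n * (1/3)^n) * A n x y)" for n
    by (simp_all add: X_def s_def)
  have s: "cmod (s n) = 1" for n by (simp add: s_def sg_def)
  have T_X_Suc: "T m (X (Suc n)) = T m (X n) + (s n * (1/3)^n) * T m (A n)" for m n
    unfolding X_Suc by (rule T_add)
  have jump: "(1/3)^n * (3/4 * t n) \<le> cmod (T n (X (Suc n)))" for n
  proof -
    let ?a = "T n (X n)" and ?b = "(1/3)^n * T n (A n)"
    have "2 * cmod ?b = cmod ((?a + ?b) - (?a - ?b))" by (simp add: norm_mult)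
    also have "\<dots> \<le> cmod (?a + ?b) + cmod (?a - ?b)" by (rule norm_triangle_ineq4)
    also have "\<dots> \<le> 2 * cmod (T n (X (Suc n)))"
      unfolding T_X_Suc by (auto simp: s_def sg_def)
    finally have "cmod ?b \<le> cmod (T n (X (Suc n)))" by simp
    moreover have "(1/3)^n * (3/4 * t n) \<le> cmod ?b"
      using large(2)[of n] by (simp add: norm_mult norm_power norm_divide T_def)
    ultimately show ?thesis by linarith
  qed
  \<comment> \<open>The weights after step \<open>n\<close> add up to at most half of
    \<open>(1/3)^n\<close>. They cannot undo the gain of \<open>3/4 * t n * (1/3)^n\<close>: a
    quarter of \<open>t n * (1/3)^n\<close> survives, and it grows because \<open>4^n\<close>
    outweighs \<open>3^n\<close>.\<close>
  have tail: "cmod (T n (X (Suc n + j)) - T n (X (Suc n))) \<le> t n * (1/3)^n * ((1 - (1/3)^j) / 2)" for n j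
  proof (induction j)
    case (Suc j)
    have "cmod (T n (X (Suc n + Suc j)) - T n (X (Suc n)))
        = cmod ((T n (X (Suc n + j)) - T n (X (Suc n))) + (s (Suc n + j) * (1/3)^(Suc n + j)) * T n (A (Suc n + j)))"
      using T_X_Suc[of n "Suc n + j"] by (simp add: algebra_simps)
    also have "\<dots> \<le> cmod (T n (X (Suc n + j)) - T n (X (Suc n))) + (1/3)^(Suc n + j) * cmod (T n (A (Suc n + j)))"
      by (rule order_trans[OF norm_triangle_ineq]) (simp add: norm_mult norm_power norm_divide s)
    also have "\<dots> \<le> t n * (1/3)^n * ((1 - (1/3)^j) / 2) + (1/3)^(Suc n + j) * t n"
      using t[OF A, of n] by (intro add_mono Suc.IH mult_left_mono) (auto simp: T_def)
    also have "\<dots> = t n * (1/3)^n * ((1 - (1/3)^Suc j) / 2)"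
      by (simp add: power_add field_simps)
    finally show ?case .
  qed simp
  have t_pos: "0 < t n" for n using large(1)[of n] by (rule less_trans[rotated]) simp
  have low: "(4/3)^n / 4 \<le> cmod (T n (X (Suc n + j)))" for n j
  proof -
    have "(1/3)^n * (3/4 * t n) \<le> cmod (T n (X (Suc n + j))) + cmod (T n (X (Suc n + j)) - T n (X (Suc n)))"
      using jump[of n] norm_triangle_sub[of "T n (X (Suc n))" "T n (X (Suc n + j))"]
      by (simp add: norm_minus_commute)
    moreover have "t n * (1/3)^n * ((1 - (1/3)^j) / 2) \<le> t n * (1/3)^n * (1/2)"
      using t_pos[of n] by (intro mult_left_mono) auto
    ultimately have "(1/3)^n * t n / 4 \<le> cmod (T n (X (Suc n + j)))"
      using tail[of n j] by (simp add: algebra_simps)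
    moreover have "(4/3)^n / 4 \<le> (1/3)^n * t n / (4::real)"
      using mult_left_mono[OF less_imp_le[OF large(1)[of n]], of "(1/3)^n"] by (simp add: power_divide)
    ultimately show ?thesis by linarith
  qed
  have X_sum: "X n x y = (\<Sum>k<n. (s k * (1/3)^k) * A k x y)" for n x y
    by (induction n) (simp_all add: X_0 X_Suc)
  have "summable (\<lambda>k. (s k * (1/3)^k) * A k x y)" for x y
  proof (rule summable_comparison_test')
    show "summable (\<lambda>k. (1/3::real)^k)" by (rule summable_geometric) simp
    show "norm ((s k * (1/3)^k) * A k x y) \<le> (1/3)^k" if "k \<ge> 0" for k
      using mult_left_mono[OF contraction_entry_le[OF A[of k], of x y], of "(1/3)^k"]
      by (simp add: norm_mult norm_power norm_divide s)
  qed
  define L where "L x y = (\<Sum>k. (s k * (1/3)^k) * A k x y)" for x y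
  have lim: "(\<lambda>n. X n x y) \<longlonglongrightarrow> L x y" for x y
    unfolding X_sum L_def by (rule summable_LIMSEQ) fact
  \<comment> \<open>The constant 3/2 is the sum of the weights \<open>(1/3)^k\<close>.\<close>
  have X_bound: "cmod (form G (X n) a b) \<le> 3/2 * (1 - (1/3)^n) * ((sqnorm_on G a + sqnorm_on G b) / 2)"
    if G: "finite G" for G n a b
  proof (induction n)
    case (Suc n)
    let ?q = "(sqnorm_on G a + sqnorm_on G b) / 2"
    have "cmod (form G (X (Suc n)) a b) \<le> cmod (form G (X n) a b) + (1/3)^n * cmod (form G (A n) a b)"
      unfolding X_Suc form_add_scaled
      by (rule order_trans[OF norm_triangle_ineq]) (simp add: norm_mult norm_power norm_divide s)
    also have "cmod (form G (A n) a b) \<le> 1 * (sqnorm_on G a + sqnorm_on G b) / 2"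
      using A[of n] G by (simp only: contraction_def form_bounded_def)
    finally have "cmod (form G (X (Suc n)) a b) \<le> 3/2 * (1 - (1/3)^n) * ?q + (1/3)^n * ?q"
      using Suc.IH by (simp add: mult_left_mono)
    also have "\<dots> = 3/2 * (1 - (1/3)^Suc n) * ?q" by (simp add: field_simps)
    finally show ?case .
  qed (simp add: X_0 form_def)
  have "bounded_matrix L"
  proof (rule op_norm_le(1))
    fix G :: "'i set" assume G: "finite G"
    show "form_bounded G L (3/2)"
      unfolding form_bounded_def
    proof (intro allI)
      fix a b
      have "(\<lambda>n. form G (X n) a b) \<longlonglongrightarrow> form G L a b"
        unfolding form_def by (intro tendsto_intros lim)
      then have l: "(\<lambda>n. cmod (form G (X n) a b)) \<longlonglongrightarrow> cmod (form G L a b)" by (rule tendsto_norm)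
      show "cmod (form G L a b) \<le> 3/2 * (sqnorm_on G a + sqnorm_on G b) / 2"
      proof (rule tendsto_upperbound[OF l always_eventually])
        show "\<forall>n. cmod (form G (X n) a b) \<le> 3/2 * (sqnorm_on G a + sqnorm_on G b) / 2"
        proof
          fix n
          have "3/2 * (1 - (1/3)^n) * ((sqnorm_on G a + sqnorm_on G b) / 2)
              \<le> 3/2 * 1 * ((sqnorm_on G a + sqnorm_on G b) / 2)"
            by (intro mult_right_mono mult_left_mono) auto
          then show "cmod (form G (X n) a b) \<le> 3/2 * (sqnorm_on G a + sqnorm_on G b) / 2"
            using X_bound[OF G, of n a b] by simp
        qed
      qed simp
    qed
  qed simp
  then have bm: "bounded_matrix (\<lambda>x y. \<psi> x y * L x y)"
    using schur by (simp add: schur_multiplier_def)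
  define B where "B = op_norm (\<lambda>x y. \<psi> x y * L x y)"
  have le_B: "(4/3)^n / 4 \<le> B" for n
  proof -
    have "(\<lambda>N. T n (X N)) \<longlonglongrightarrow> T n L"
      unfolding T_def form_def by (intro tendsto_intros lim)
    then have "(\<lambda>j. T n (X (j + Suc n))) \<longlonglongrightarrow> T n L" by (rule LIMSEQ_ignore_initial_segment)
    then have l: "(\<lambda>j. cmod (T n (X (j + Suc n)))) \<longlonglongrightarrow> cmod (T n L)" by (rule tendsto_norm)
    have "(4/3)^n / 4 \<le> cmod (T n L)"
      by (rule tendsto_lowerbound[OF l always_eventually]) (use low[of n] in \<open>simp_all add: add.commute\<close>)
    also have "\<dots> \<le> B * (sqnorm_on (F n) (u n) + sqnorm_on (F n) (v n)) / 2"
      using form_bounded_op_norm[OF bm F[of n]] by (simp add: form_bounded_def T_def B_def)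
    also have "\<dots> \<le> B * 2 / 2"
      using unit[of n] op_norm_nonneg[OF bm]
      by (intro divide_right_mono mult_left_mono) (auto simp: B_def)
    finally show ?thesis by simp
  qed
  obtain n where "4 * B < (4/3)^n" using real_arch_pow[of "4/3" "4 * B"] by auto
  with le_B[of n] show False by simp
qed

text \<open>If no constant works, then for every \<open>n\<close> some finite form exceeds
  \<open>4^n\<close> on a contraction. Replacing that contraction by one within the factor 3/4 of
  the supremum \<open>t F u v\<close> supplies the data of
  \<open>signed_series_unbounded\<close>.\<close>

lemma schur_multiplier_uniformly_bounded:
  assumes "schur_multiplier \<psi>"
  shows "\<exists>M\<ge>0. \<forall>A F. contraction A \<longrightarrow> finite F \<longrightarrow> form_bounded F (\<lambda>x y. \<psi> x y * A x y) M"
proof (rule ccontr)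
  assume neg: "\<not> ?thesis"
  define S where "S F u v = (\<lambda>A. cmod (form F (\<lambda>x y. \<psi> x y * A x y) u v)) ` {A. contraction A}" for F u v
  have bdd: "bdd_above (S F u v)" for F u v
    unfolding S_def by (rule bdd_aboveI2) (auto intro: form_schur_entry_bound)
  define t where "t F u v = Sup (S F u v)" for F u v
  have t: "cmod (form F (\<lambda>x y. \<psi> x y * A x y) u v) \<le> t F u v" if "contraction A" for A F u v
    unfolding t_def by (rule cSup_upper[OF _ bdd]) (use that in \<open>auto simp: S_def\<close>)
  define Q where "Q n F u v A \<longleftrightarrow>
      finite F \<and> sqnorm_on F u \<le> 1 \<and> sqnorm_on F v \<le> 1 \<and> contraction A \<and> 4 ^ n < t F u v \<and>
      3 / 4 * t F u v < cmod (form F (\<lambda>x y. \<psi> x y * A x y) u v)" for n :: nat and F u v A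
  have "\<exists>F u v A. Q n F u v A" for n
  proof -
    obtain A F where AF: "contraction A" "finite F" "\<not> form_bounded F (\<lambda>x y. \<psi> x y * A x y) (4 ^ n)"
      using neg[simplified, rule_format, of "4 ^ n"] by auto
    then obtain u v where uv: "sqnorm_on F u \<le> 1" "sqnorm_on F v \<le> 1"
        "4 ^ n < cmod (form F (\<lambda>x y. \<psi> x y * A x y) u v)"
      using form_bounded_if_unit[OF AF(2), of "4 ^ n"] by (meson not_le zero_le_numeral zero_le_power)
    have big: "4 ^ n < t F u v" using uv(3) t[OF AF(1), of F u v] by linarith
    then have "0 < t F u v" by (rule less_trans[rotated]) simp
    then have "3 / 4 * t F u v < Sup (S F u v)" by (simp add: t_def)
    moreover have "S F u v \<noteq> {}" using contraction_zero by (auto simp: S_def)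
    ultimately obtain z where "z \<in> S F u v" "3 / 4 * t F u v < z"
      using less_cSup_iff[OF _ bdd] by metis
    then show ?thesis using AF(2) uv big unfolding S_def Q_def by blast
  qed
  then obtain F u v A where *: "\<And>n. Q n (F n) (u n) (v n) (A n)" by metis
  have "\<not> schur_multiplier \<psi>"
    by (rule signed_series_unbounded[of A F u v \<psi> "\<lambda>n. t (F n) (u n) (v n)"]) (use * t in \<open>auto simp: Q_def\<close>)
  then show False using assms by simp
qed

section \<open>Trees hanging from a boundary point\<close>

text \<open>Orienting the edges of a homogeneous tree towards a fixed boundary point gives every vertex
  one parent \<open>c x\<close> and \<open>q\<close> children; \<open>height\<close> is the Busemann function.\<close>

locale horocyclic_tree =
  fixes c :: "'v \<Rightarrow> 'v" and height :: "'v \<Rightarrow> int" and d :: "'v \<Rightarrow> 'v \<Rightarrow> nat" and q :: nat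
  assumes q_ge_2: "2 \<le> q"
    and height_c: "height (c x) = height x + 1"
    and card_children: "card {y. c y = x} = q"
    and confluent: "\<exists>m n. (c ^^ m) x = (c ^^ n) y"
    and dist_eq: "(c ^^ m) x = (c ^^ n) y \<Longrightarrow> m = 0 \<or> n = 0 \<or> (c ^^ (m - 1)) x \<noteq> (c ^^ (n - 1)) y \<Longrightarrow> d x y = m + n"

lemma is_walk_Cons2: "is_walk E (a # b # l) x y \<longleftrightarrow> a = x \<and> E a b \<and> is_walk E (b # l) b y"
  unfolding is_walk_def
  by (auto simp: nth_Cons split: nat.splits)

text \<open>Relational powers replace lists of vertices, so that walks are composed by
  \<open>relpowp_add\<close> and the distance becomes a least exponent.\<close>

lemma ex_walk_iff_relpowp: "(\<exists>xs. is_walk E xs x y \<and> length xs = Suc n) \<longleftrightarrow> (E ^^ n) x y"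
proof (induction n arbitrary: x)
  case 0
  show ?case
  proof
    assume "\<exists>xs. is_walk E xs x y \<and> length xs = Suc 0"
    then show "(E ^^ 0) x y" by (auto simp: is_walk_def length_Suc_conv)
  next
    assume "(E ^^ 0) x y"
    then show "\<exists>xs. is_walk E xs x y \<and> length xs = Suc 0"
      by (intro exI[of _ "[x]"]) (auto simp: is_walk_def)
  qed
next
  case (Suc n)
  show ?case
  proof
    assume "\<exists>xs. is_walk E xs x y \<and> length xs = Suc (Suc n)"
    then obtain a b l where "is_walk E (a # b # l) x y" "length (b # l) = Suc n"
      by (auto simp: length_Suc_conv)
    then show "(E ^^ Suc n) x y"
      unfolding is_walk_Cons2 using Suc.IH[of b] relpowp_Suc_I2[of E x b n y] by blast
  next
    assume "(E ^^ Suc n) x y"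
    then obtain b where b: "E x b" "(E ^^ n) b y" by (rule relpowp_Suc_E2)
    then obtain xs where xs: "is_walk E xs b y" "length xs = Suc n" using Suc.IH by blast
    then obtain l where "xs = b # l" by (cases xs) (auto simp: is_walk_def)
    then show "\<exists>xs. is_walk E xs x y \<and> length xs = Suc (Suc n)"
      using b xs by (intro exI[of _ "x # xs"]) (simp add: is_walk_Cons2)
  qed
qed

lemma gdist_altdef: "gdist E x y = (LEAST n. (E ^^ n) x y)"
  by (simp add: gdist_def ex_walk_iff_relpowp)

subsection \<open>The distance in terms of the parent map\<close>

text \<open>The rays of ancestors of \<open>x\<close> and \<open>y\<close> meet here and not one
  step earlier on both. If \<open>m\<close> or \<open>n\<close> is 0, one vertex lies on the ray of
  the other and there is no earlier pair, which also guards the truncated subtraction.\<close>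

definition first_meet :: "('v \<Rightarrow> 'v) \<Rightarrow> 'v \<Rightarrow> 'v \<Rightarrow> nat \<Rightarrow> nat \<Rightarrow> bool" where
  "first_meet c x y m n \<longleftrightarrow> (c ^^ m) x = (c ^^ n) y \<and> (m = 0 \<or> n = 0 \<or> (c ^^ (m - 1)) x \<noteq> (c ^^ (n - 1)) y)"

lemma height_funpow:
  fixes height :: "'v \<Rightarrow> int"
  assumes "\<And>x. height (c x) = height x + 1"
  shows "height ((c ^^ m) x) = height x + int m"
  by (induction m) (simp_all add: assms)

lemma first_meet_refl:
  fixes height :: "'v \<Rightarrow> int"
  assumes h: "\<And>x. height (c x) = height x + 1" and "first_meet c x x m n"
  shows "m = 0" "n = 0"
proof -
  have "height ((c ^^ m) x) = height ((c ^^ n) x)" using assms(2) by (simp add: first_meet_def)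
  then have "m = n" by (simp add: height_funpow[of height c, OF h])
  then show "m = 0" "n = 0" using assms(2) by (auto simp: first_meet_def)
qed

text \<open>Moving \<open>x\<close> along one edge changes \<open>m + n\<close> by one, so a walk of
  \<open>k\<close> edges to \<open>y\<close>, where the sum is 0, needs
  \<open>m + n \<le> k\<close>. The height excludes a nontrivial first meeting of a vertex with
  itself.\<close>

lemma first_meet_le_path_length:
  fixes height :: "'v \<Rightarrow> int"
  assumes h: "\<And>x. height (c x) = height x + 1" and E: "\<And>x y. E x y \<longleftrightarrow> c x = y \<or> c y = x"
  shows "(E ^^ k) x y \<Longrightarrow> first_meet c x y m n \<Longrightarrow> m + n \<le> k"
proof (induction k arbitrary: x m n)
  case 0
  then show ?case using first_meet_refl[of height c, OF h] by auto
next
  case (Suc k)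
  obtain x' where x': "E x x'" "(E ^^ k) x' y" using Suc.prems(1) by (rule relpowp_Suc_E2)
  note IH = Suc.IH[OF x'(2)]
  have fm: "(c ^^ m) x = (c ^^ n) y" "m = 0 \<or> n = 0 \<or> (c ^^ (m - 1)) x \<noteq> (c ^^ (n - 1)) y"
    using Suc.prems(2) by (auto simp: first_meet_def)
  have "c x = x' \<or> c x' = x" using x'(1) E by blast
  then show ?case
  proof
    assume cx: "c x = x'"
    show ?thesis
    proof (cases m)
      case 0
      then have "first_meet c x' y 0 (Suc n)" using fm cx by (simp add: first_meet_def)
      then show ?thesis using IH 0 by fastforce
    next
      case (Suc m')
      then have "first_meet c x' y m' n"
        using fm cx unfolding first_meet_def by (cases m') (auto simp: funpow_swap1)
      then show ?thesis using IH Suc by fastforce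
    qed
  next
    assume cx: "c x' = x"
    show ?thesis
    \<comment> \<open>The step down to a child \<open>x'\<close> approaches \<open>y\<close> exactly
      when \<open>x'\<close> lies on the ray of \<open>y\<close>; otherwise the new meeting is one
      step further from \<open>x'\<close>.\<close>
    proof (cases "m = 0 \<and> n \<noteq> 0 \<and> (c ^^ (n - 1)) y = x'")
      case True
      then have "first_meet c x' y 0 (n - 1)" by (simp add: first_meet_def)
      then show ?thesis using IH True by fastforce
    next
      case False
      have "first_meet c x' y (Suc m) n"
        using fm cx False unfolding first_meet_def by (cases m) (auto simp: funpow_swap1)
      then show ?thesis using IH by fastforce
    qed
  qed
qed

lemma funpow_path:
  assumes "\<And>x. E x (c x)" "\<And>x y. E x y \<Longrightarrow> E y x"
  shows "(E ^^ m) x ((c ^^ m) x)" "(E ^^ m) ((c ^^ m) x) x"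
proof (induction m)
  case (Suc m)
  { case 1
    show ?case using relpowp_Suc_I[OF Suc.IH(1) assms(1)] by (simp only: funpow.simps(2) o_apply)
  next
    case 2
    have "E ((c ^^ Suc m) x) ((c ^^ m) x)" using assms by simp
    then show ?case using Suc.IH(2) by (rule relpowp_Suc_I2) }
qed simp_all

text \<open>Climbing \<open>m\<close> edges and descending \<open>n\<close> is a walk of this
  length, and \<open>first_meet_le_path_length\<close> says that none is shorter.\<close>

lemma gdist_first_meet:
  fixes height :: "'v \<Rightarrow> int"
  assumes h: "\<And>x. height (c x) = height x + 1" and E: "\<And>x y. E x y \<longleftrightarrow> c x = y \<or> c y = x"
    and "first_meet c x y m n"
  shows "gdist E x y = m + n"
  unfolding gdist_altdef
proof (rule Least_equality)
  have "(E ^^ m) x ((c ^^ m) x)" by (rule funpow_path) (auto simp: E)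
  moreover have "(E ^^ n) ((c ^^ n) y) y" by (rule funpow_path) (auto simp: E)
  ultimately show "(E ^^ (m + n)) x y"
    using assms(3) by (auto simp: relpowp_add first_meet_def)
qed (use first_meet_le_path_length[of height c E, OF h E] assms(3) in blast)

subsection \<open>The parent map of a homogeneous tree\<close>

context
  fixes E :: "'v \<Rightarrow> 'v \<Rightarrow> bool" and x0 :: 'v and p :: "'v \<Rightarrow> 'v" and lev :: "'v \<Rightarrow> nat"
  assumes sym: "E x y \<Longrightarrow> E y x"
    and p_edge: "x \<noteq> x0 \<Longrightarrow> E x (p x)" and p_level: "x \<noteq> x0 \<Longrightarrow> Suc (lev (p x)) = lev x"
    and level_0: "lev x = 0 \<longleftrightarrow> x = x0"
begin

lemma level_funpow: "i \<le> lev x \<Longrightarrow> lev ((p ^^ i) x) = lev x - i"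
proof (induction i)
  case (Suc i)
  then have "(p ^^ i) x \<noteq> x0" using level_0[of "(p ^^ i) x"] by simp
  then show ?case using Suc p_level[of "(p ^^ i) x"] by simp
qed simp

lemma funpow_edge: "i < lev x \<Longrightarrow> E ((p ^^ i) x) ((p ^^ Suc i) x)"
  using level_funpow[of i x] level_0[of "(p ^^ i) x"] p_edge[of "(p ^^ i) x"] by simp

text \<open>The paths from \<open>a\<close> and \<open>b\<close> towards \<open>x0\<close> are cut
  at their first common vertex and glued. The result is a simple path that stays at or below the
  level of its ends, ready to be closed into a cycle by an edge \<open>a b\<close> or by a vertex of
  higher level.\<close>

lemma descending_paths_join:
  assumes "a \<noteq> b" "lev a = lev b"
  obtains f and k :: nat where "1 \<le> k" "inj_on f {0..<2*k+1}" "f 0 = a" "f (2*k) = b"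
    "\<And>i. i < 2*k \<Longrightarrow> E (f i) (f (Suc i))" "\<And>i. i \<le> 2*k \<Longrightarrow> lev (f i) \<le> lev a"
proof -
  let ?P = "\<lambda>k. (p ^^ k) a = (p ^^ k) b"
  have "?P (lev a)"
    using level_funpow[of "lev a" a] level_funpow[of "lev b" b] assms(2) by (simp add: level_0)
  define k where "k = (LEAST k. ?P k)"
  have k: "?P k" unfolding k_def by (rule LeastI) fact
  have k_le: "k \<le> lev a" unfolding k_def by (rule Least_le) fact
  have k_min: "\<not> ?P i" if "i < k" for i using that unfolding k_def by (rule not_less_Least)
  have k_pos: "1 \<le> k" using k assms(1) by (cases k) auto
  \<comment> \<open>Indices up to \<open>k\<close> descend from \<open>a\<close> to the meeting
    vertex, the remaining ones climb back to \<open>b\<close>.\<close>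
  define f where "f i = (if i < k then (p ^^ i) a else (p ^^ (2*k - i)) b)" for i
  have lf: "lev (f i) = lev a - (if i < k then i else 2*k - i)" if "i \<le> 2*k" for i
    using that k_le assms(2) level_funpow[of i a] level_funpow[of "2*k - i" b] by (auto simp: f_def)
  have inj: "inj_on f {0..<2*k+1}"
  proof (rule linorder_inj_onI)
    fix i j assume ij: "i < j" "i \<in> {0..<2*k+1}" "j \<in> {0..<2*k+1}"
    show "f i \<noteq> f j"
    proof
      assume eq: "f i = f j"
      then have "lev (f i) = lev (f j)" by simp
      \<comment> \<open>Levels are strictly monotone on each half, so equal vertices can occur only
        at mirrored indices \<open>i = 2*k - j\<close>, and there they would be a common vertex
        before step \<open>k\<close>.\<close>
      then have "(if i < k then i else 2*k - i) = (if j < k then j else 2*k - j)"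
        using lf[of i] lf[of j] ij k_le by (auto split: if_splits)
      then have *: "i < k" "\<not> j < k" "i = 2*k - j" using ij by (auto split: if_splits)
      then have "?P i" using eq by (simp add: f_def)
      then show False using k_min * by blast
    qed
  qed auto
  have edge: "E (f i) (f (Suc i))" if "i < 2*k" for i
  proof (cases "i < k")
    case True
    have "f (Suc i) = (p ^^ Suc i) a"
      using True k by (cases "Suc i < k") (auto simp: f_def not_less less_Suc_eq_le mult_2 le_Suc_eq)
    then show ?thesis using True k_le funpow_edge[of i a] by (simp add: f_def)
  next
    case False
    have "2*k - i = Suc (2*k - Suc i)" using that by simp
    then have "E (f (Suc i)) (f i)"
      using False that k_le assms(2) funpow_edge[of "2*k - Suc i" b] by (simp add: f_def)
    then show ?thesis by (rule sym)
  qed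
  show thesis
    by (rule that[of k f]) (use k_pos inj edge lf in \<open>auto simp: f_def\<close>)
qed

text \<open>Such an edge closes the path between \<open>a\<close> and \<open>b\<close> into a cycle
  of odd length \<open>2*k + 1\<close>.\<close>

lemma acyclic_no_horizontal_edge:
  assumes "\<nexists>xs. is_cycle E xs" "a \<noteq> b" "lev a = lev b"
  shows "\<not> E a b"
proof
  assume ab: "E a b"
  obtain f and k :: nat where f: "1 \<le> k" "inj_on f {0..<2*k+1}" "f 0 = a" "f (2*k) = b"
    "\<And>i. i < 2*k \<Longrightarrow> E (f i) (f (Suc i))" "\<And>i. i \<le> 2*k \<Longrightarrow> lev (f i) \<le> lev a"
    using descending_paths_join[OF assms(2,3)] by metis
  let ?xs = "map f [0..<2*k+1]"
  have "last ?xs = b" "hd ?xs = a" using f by (simp_all add: hd_map del: upt_Suc) (simp_all)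
  moreover have "\<forall>i < length ?xs - 1. E (?xs ! i) (?xs ! Suc i)"
    using f(5) by (auto simp del: upt_Suc)
  ultimately have "is_cycle E ?xs"
    using f(1,2) ab sym by (auto simp: is_cycle_def distinct_map simp del: upt_Suc)
  then show False using assms(1) by blast
qed

text \<open>Two lower neighbours would be joined by a path that avoids \<open>x\<close>, since its
  levels stay below that of \<open>x\<close>; with \<open>x\<close> it forms a cycle of length
  \<open>2*k + 2\<close>.\<close>

lemma acyclic_unique_lower_neighbour:
  assumes "\<nexists>xs. is_cycle E xs" "lev a = lev b" "Suc (lev a) = lev x" "E x a" "E x b"
  shows "a = b"
proof (rule ccontr)
  assume "a \<noteq> b"
  obtain f and k :: nat where f: "1 \<le> k" "inj_on f {0..<2*k+1}" "f 0 = a" "f (2*k) = b"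
    "\<And>i. i < 2*k \<Longrightarrow> E (f i) (f (Suc i))" "\<And>i. i \<le> 2*k \<Longrightarrow> lev (f i) \<le> lev a"
    using descending_paths_join[OF \<open>a \<noteq> b\<close> assms(2)] by metis
  let ?xs = "map f [0..<2*k+1]"
  have "last ?xs = b" "?xs ! 0 = a" using f by (simp_all add: nth_append)
  moreover have "\<forall>i < length ?xs - 1. E (?xs ! i) (?xs ! Suc i)"
    using f(5) by (auto simp del: upt_Suc)
  moreover have "x \<notin> set ?xs"
  proof
    assume "x \<in> set ?xs"
    then obtain i where "i \<le> 2*k" "x = f i" by (auto simp: less_Suc_eq_le simp del: upt_Suc)
    then show False using f(6)[of i] assms(3) by simp
  qed
  moreover have "\<forall>i < length (x # ?xs) - 1. E ((x # ?xs) ! i) ((x # ?xs) ! Suc i)"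
  proof (intro allI impI)
    fix i assume "i < length (x # ?xs) - 1"
    then show "E ((x # ?xs) ! i) ((x # ?xs) ! Suc i)"
      using calculation(2,3) assms(4) by (cases i) (auto simp del: upt_Suc)
  qed
  ultimately have "is_cycle E (x # ?xs)"
    using f(1,2) assms(5) sym unfolding is_cycle_def by (auto simp: distinct_map simp del: upt_Suc)
  then show False using assms(1) by blast
qed

end

section \<open>Levels and the choice of a boundary point\<close>

lemma relpowp_gdist:
  assumes "\<And>x y. \<exists>xs. is_walk E xs x y"
  shows "(E ^^ gdist E x y) x y"
proof -
  obtain xs where xs: "is_walk E xs x y" using assms by blast
  then have "length xs = Suc (length xs - 1)" by (cases xs) (auto simp: is_walk_def)
  then have "(E ^^ (length xs - 1)) x y" using xs ex_walk_iff_relpowp by metis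
  then show ?thesis unfolding gdist_altdef by (rule LeastI)
qed

lemma gdist_edge_le:
  assumes "\<And>x y. \<exists>xs. is_walk E xs x y" "E x y"
  shows "gdist E z y \<le> Suc (gdist E z x)"
proof -
  have "(E ^^ Suc (gdist E z x)) z y" using relpowp_gdist[OF assms(1)] assms(2) by (rule relpowp_Suc_I)
  then show ?thesis unfolding gdist_altdef[of E z y] by (rule Least_le)
qed

text \<open>The tree is rooted at an auxiliary vertex, and the resulting parent map \<open>p\<close>
  is reversed along one infinite ray. This moves the common target of all edges from the root to the
  end of the ray, and the root loses its surplus child.\<close>

lemma homogeneous_tree_horocyclic:
  fixes E :: "'v \<Rightarrow> 'v \<Rightarrow> bool"
  assumes tree: "homogeneous_tree E q" and q: "2 \<le> q"
  obtains c height where "horocyclic_tree c height (gdist E) q"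
proof -
  have sym: "E x y \<Longrightarrow> E y x" and irrefl: "\<not> E x x" and conn: "\<exists>xs. is_walk E xs x y"
    and acyclic: "\<nexists>xs. is_cycle E xs" and fin: "finite {y. E x y}" and card: "card {y. E x y} = q + 1" for x y
    using tree unfolding homogeneous_tree_def by blast+
  define x0 :: 'v where "x0 = undefined"
  define lev where "lev x = gdist E x0 x" for x
  have lev_path: "(E ^^ lev x) x0 x" for x
    unfolding lev_def using conn by (rule relpowp_gdist)
  have lev_le: "lev x \<le> k" if "(E ^^ k) x0 x" for x k
    unfolding lev_def gdist_altdef using that by (rule Least_le)
  have lev_0: "lev x = 0 \<longleftrightarrow> x = x0" for x
    using lev_path[of x] lev_le[of 0 x0] by auto
  have lev_edge: "lev y \<le> Suc (lev x)" if "E x y" for x y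
    unfolding lev_def using conn that by (rule gdist_edge_le)
  have ex_lower: "\<exists>y. E x y \<and> Suc (lev y) = lev x" if "x \<noteq> x0" for x
  proof -
    have "lev x \<noteq> 0" using \<open>x \<noteq> x0\<close> lev_0 by blast
    then obtain k where k: "lev x = Suc k" by (cases "lev x") auto
    then have "(E ^^ Suc k) x0 x" using lev_path[of x] by simp
    then obtain y where y: "(E ^^ k) x0 y" "E y x" by (rule relpowp_Suc_E)
    then show ?thesis using lev_le[OF y(1)] lev_edge[OF y(2)] k sym by (intro exI[of _ y]) auto
  qed
  define p where "p x = (SOME y. E x y \<and> Suc (lev y) = lev x)" for x
  have p: "E x (p x)" "Suc (lev (p x)) = lev x" if "x \<noteq> x0" for x
    using someI_ex[OF ex_lower[OF that]] unfolding p_def by auto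
  have no_horiz: "\<not> E a b" if "lev a = lev b" for a b
    using acyclic_no_horizontal_edge[of E x0 p lev a b] sym p lev_0 acyclic irrefl that by (cases "a = b") auto
  have lower_unique: "a = b" if "lev a = lev b" "Suc (lev a) = lev x" "E x a" "E x b" for a b x
    by (rule acyclic_unique_lower_neighbour[of E x0 p lev a b x, OF sym p(1) p(2) lev_0 acyclic that])
  have E_iff_p: "E x y \<longleftrightarrow> (x \<noteq> x0 \<and> p x = y) \<or> (y \<noteq> x0 \<and> p y = x)" for x y
  proof
    assume xy: "E x y"
    have "Suc (lev y) = lev x \<or> Suc (lev x) = lev y"
      using lev_edge[OF xy] lev_edge[OF sym[OF xy]] no_horiz[of x y] xy by linarith
    then show "(x \<noteq> x0 \<and> p x = y) \<or> (y \<noteq> x0 \<and> p y = x)"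
    proof
      assume l: "Suc (lev y) = lev x"
      then have "x \<noteq> x0" using lev_0[of x] by auto
      then show ?thesis using lower_unique[of "p x" y x] p[of x] l xy by auto
    next
      assume l: "Suc (lev x) = lev y"
      then have "y \<noteq> x0" using lev_0[of y] by auto
      then show ?thesis using lower_unique[of "p y" x y] p[of y] l sym[OF xy] by auto
    qed
  qed (use p sym in blast)
  define ch where "ch x = {y. y \<noteq> x0 \<and> p y = x}" for x
  have ch_lev: "lev y = Suc (lev x)" if "y \<in> ch x" for x y
    using that p(2)[of y] by (auto simp: ch_def)
  have nb: "{y. E x y} = ch x \<union> (if x = x0 then {} else {p x})" for x
    using E_iff_p[of x] by (auto simp: ch_def)
  have ch_fin: "finite (ch x)" for x using fin[of x] nb[of x] by simp
  have p_notin_ch: "p x \<notin> ch x" if "x \<noteq> x0" for x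
    using ch_lev[of "p x" x] p(2)[OF that] by auto
  have ch_card: "card (ch x) = (if x = x0 then q + 1 else q)" for x
    using card[of x] ch_fin[of x] p_notin_ch[of x] unfolding nb by (auto split: if_splits)
  have ch_ex: "\<exists>y. y \<in> ch x" for x
    using ch_card[of x] q by (metis card.empty ex_in_conv add_is_0 not_numeral_le_zero one_neq_zero)
  \<comment> \<open>A ray that always continues to some child; its end is the boundary
    point.\<close>
  define r where "r = rec_nat x0 (\<lambda>n y. SOME z. z \<in> ch y)"
  have r_0: "r 0 = x0" and r_Suc: "r (Suc n) \<in> ch (r n)" for n
    using someI_ex[OF ch_ex, of "r n"] by (simp_all add: r_def)
  have r_lev: "lev (r n) = n" for n
    by (induction n) (use lev_0 r_0 ch_lev[OF r_Suc] in auto)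
  have p_r: "p (r (Suc n)) = r n" "r (Suc n) \<noteq> x0" for n using r_Suc[of n] by (auto simp: ch_def)
  have x0_r: "x0 \<in> range r" using r_0 by (metis rangeI)
  \<comment> \<open>On the ray the level is the index, so \<open>r (Suc (lev x))\<close> is the next
    vertex of the ray.\<close>
  define c where "c x = (if x \<in> range r then r (Suc (lev x)) else p x)" for x
  have c_r: "c (r n) = r (Suc n)" for n by (simp add: c_def r_lev)
  have c_off: "c x = p x" "x \<noteq> x0" if "x \<notin> range r" for x using that x0_r by (auto simp: c_def)
  have E_iff_c: "E x y \<longleftrightarrow> c x = y \<or> c y = x" for x y
  proof -
    have 1: "c a = b \<or> c b = a" if a: "a \<noteq> x0" "p a = b" for a b
    proof (cases "a \<in> range r")
      case True
      then obtain n where "a = r (Suc n)" using a(1) r_0 by (metis imageE not0_implies_Suc)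
      then show ?thesis using a(2) p_r[of n] c_r by auto
    qed (use a c_off in auto)
    have 2: "(a \<noteq> x0 \<and> p a = b) \<or> (b \<noteq> x0 \<and> p b = a)" if "c a = b" for a b
    proof (cases "a \<in> range r")
      case True
      then obtain n where "a = r n" by blast
      then show ?thesis using that c_r[of n] p_r[of n] by auto
    qed (use that c_off in auto)
    show ?thesis using E_iff_p[of x y] 1[of x y] 1[of y x] 2[of x y] 2[of y x] by blast
  qed
  define k where "k x = (LEAST m. (p ^^ m) x \<in> range r)" for x
  \<comment> \<open>The Busemann function normalised to 0 at \<open>x0\<close>: the level at which
    the path from \<open>x\<close> enters the ray, minus the number of steps to get there.\<close>
  define height where "height x = int (lev ((p ^^ k x) x)) - int (k x)" for x
  have ex_k: "\<exists>m. (p ^^ m) x \<in> range r" for x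
  proof (induction "lev x" arbitrary: x)
    case 0
    then show ?case using x0_r lev_0 by (metis funpow_0)
  next
    case (Suc n)
    then have "x \<noteq> x0" using lev_0[of x] by auto
    then have "n = lev (p x)" using p(2)[of x] Suc.hyps(2) by simp
    then obtain m where "(p ^^ m) (p x) \<in> range r" using Suc.hyps(1) by blast
    then show ?case by (intro exI[of _ "Suc m"]) (simp add: funpow_swap1)
  qed
  have height_r: "height (r n) = int n" for n
    unfolding height_def k_def by (subst Least_eq_0) (auto simp: r_lev)+
  have height_c: "height (c x) = height x + 1" for x
  proof (cases "x \<in> range r")
    case True
    then show ?thesis using c_r height_r by auto
  next
    case False
    obtain m where m: "(p ^^ m) x \<in> range r" using ex_k by blast
    have "k x = Suc (LEAST m. (p ^^ Suc m) x \<in> range r)"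
      unfolding k_def using m by (rule Least_Suc) (use False in simp)
    then have "k x = Suc (k (p x))" unfolding k_def by (simp add: funpow_swap1)
    then show ?thesis using c_off[OF False] by (simp add: height_def funpow_swap1)
  qed
  have reach: "\<exists>m n. (c ^^ m) x = r n" for x
  proof (induction "lev x" arbitrary: x rule: less_induct)
    case less
    show ?case
    proof (cases "x \<in> range r")
      case True
      then show ?thesis by (metis funpow_0 imageE)
    next
      case False
      then have "lev (c x) < lev x" using c_off[OF False] p(2)[of x] by simp
      then obtain m n where "(c ^^ m) (c x) = r n" using less by blast
      then show ?thesis by (intro exI[of _ "Suc m"] exI[of _ n]) (simp add: funpow_swap1)
    qed
  qed
  have c_pow_r: "(c ^^ m) (r n) = r (m + n)" for m n by (induction m) (simp_all add: c_r)
  have children: "card {y. c y = x} = q" for x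
  proof (cases "x \<in> range r")
    case False
    have "{y. c y = x} = ch x"
    proof (intro set_eqI iffI)
      fix y assume "y \<in> {y. c y = x}"
      then have "y \<notin> range r" "c y = x" using False c_r by auto
      then show "y \<in> ch x" using c_off[of y] by (simp add: ch_def)
    next
      fix y assume y: "y \<in> ch x"
      have "y \<notin> range r"
      proof
        assume "y \<in> range r"
        then obtain n where "y = r (Suc n)" using y r_0 by (metis (mono_tags, lifting) ch_def imageE mem_Collect_eq not0_implies_Suc)
        then show False using y p_r[of n] False by (auto simp: ch_def)
      qed
      then show "y \<in> {y. c y = x}" using c_off[of y] y by (simp add: ch_def)
    qed
    then show ?thesis using ch_card[of x] False x0_r by auto
  next
    case True
    then obtain n where n: "x = r n" by blast
    let ?low = "if n = 0 then {} else {r (n - 1)}"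
    \<comment> \<open>Reversal exchanges the child \<open>r (Suc n)\<close> for the former parent
      \<open>r (n - 1)\<close>. At \<open>n = 0\<close> there is no former parent, and the q + 1
      children of the root become q.\<close>
    have eq: "{y. c y = x} = (ch x - {r (Suc n)}) \<union> ?low"
    proof (intro set_eqI iffI)
      fix y assume "y \<in> {y. c y = x}"
      then have y: "c y = x" by simp
      show "y \<in> (ch x - {r (Suc n)}) \<union> ?low"
      proof (cases "y \<in> range r")
        case True
        then obtain m where m: "y = r m" by blast
        then have "r (Suc m) = r n" using y n c_r by simp
        then have "Suc m = n" using r_lev by metis
        then show ?thesis using m by auto
      next
        case False
        then show ?thesis using c_off[of y] y by (auto simp: ch_def)
      qed
    next
      fix y assume y: "y \<in> (ch x - {r (Suc n)}) \<union> ?low"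
      show "y \<in> {y. c y = x}"
      proof (cases "y \<in> ch x - {r (Suc n)}")
        case True
        have "y \<notin> range r"
        proof
          assume "y \<in> range r"
          then obtain m where m: "y = r m" by blast
          then have "m = Suc n" using ch_lev[of y x] True n r_lev by simp
          then show False using m True by simp
        qed
        then show ?thesis using c_off[of y] True by (auto simp: ch_def)
      next
        case False
        then have "n \<noteq> 0" "y = r (n - 1)" using y by (auto split: if_splits)
        then show ?thesis using c_r[of "n - 1"] n by simp
      qed
    qed
    have "r (Suc n) \<in> ch x" using r_Suc n by simp
    then have card1: "card (ch x - {r (Suc n)}) = card (ch x) - 1" by simp
    show ?thesis
    proof (cases n)
      case 0
      then show ?thesis using eq card1 ch_card[of x] n r_0 by simp
    next
      case (Suc n')
      have "r n' \<notin> ch x" using ch_lev[of "r n'" x] n Suc r_lev by auto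
      then have "card {y. c y = x} = Suc (card (ch x) - 1)"
        using Suc card1 ch_fin[of x] unfolding eq by (simp add: card_insert_if)
      moreover have "x \<noteq> x0" using n Suc p_r by auto
      ultimately show ?thesis using ch_card[of x] q by simp
    qed
  qed
  have "horocyclic_tree c height (gdist E) q"
  proof
    show "\<exists>m n. (c ^^ m) x = (c ^^ n) y" for x y
    proof -
      obtain m a where m: "(c ^^ m) x = r a" using reach by blast
      obtain n b where n: "(c ^^ n) y = r b" using reach by blast
      have "(c ^^ (b + m)) x = (c ^^ (a + n)) y"
        by (simp add: funpow_add m n c_pow_r add.commute)
      then show ?thesis by blast
    qed
    show "gdist E x y = m + n" if "(c ^^ m) x = (c ^^ n) y"
        "m = 0 \<or> n = 0 \<or> (c ^^ (m - 1)) x \<noteq> (c ^^ (n - 1)) y" for m n x y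
      using gdist_first_meet[of height c E x y m n, OF height_c E_iff_c] that by (simp add: first_meet_def)
  qed (use q height_c children in auto)
  then show thesis by (rule that)
qed

section \<open>Finitely supported functions\<close>

definition fin_supp :: "('v \<Rightarrow> complex) \<Rightarrow> bool" where
  "fin_supp \<xi> \<longleftrightarrow> finite {x. \<xi> x \<noteq> 0}"

text \<open>Summing over the support of the first argument keeps the expression meaningful for an
  arbitrary second argument, so finiteness is asked for mainly on the conjugate-linear side.\<close>

definition ip :: "('v \<Rightarrow> complex) \<Rightarrow> ('v \<Rightarrow> complex) \<Rightarrow> complex" where
  "ip \<xi> \<eta> = (\<Sum>x | \<xi> x \<noteq> 0. cnj (\<xi> x) * \<eta> x)"

definition sqn :: "('v \<Rightarrow> complex) \<Rightarrow> real" where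
  "sqn \<xi> = Re (ip \<xi> \<xi>)"

lemma fin_suppI: "finite W \<Longrightarrow> (\<And>x. x \<notin> W \<Longrightarrow> \<xi> x = 0) \<Longrightarrow> fin_supp \<xi>"
  unfolding fin_supp_def by (rule finite_subset[of _ W]) auto

lemma ip_eq_sum:
  assumes "finite W" "\<And>x. x \<notin> W \<Longrightarrow> \<xi> x = 0"
  shows "ip \<xi> \<eta> = (\<Sum>x\<in>W. cnj (\<xi> x) * \<eta> x)"
  unfolding ip_def using assms by (intro sum.mono_neutral_left) auto

lemma sqn_eq_sum:
  assumes "finite W" "\<And>x. x \<notin> W \<Longrightarrow> \<xi> x = 0"
  shows "sqn \<xi> = (\<Sum>x\<in>W. (cmod (\<xi> x))\<^sup>2)"
proof -
  have "ip \<xi> \<xi> = (\<Sum>x\<in>W. cnj (\<xi> x) * \<xi> x)" using assms by (rule ip_eq_sum)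
  then show ?thesis unfolding sqn_def by (simp only: Re_sum Re_cnj_mult_self)
qed

lemma sqn_eq_sum_supp: "sqn \<xi> = (\<Sum>x | \<xi> x \<noteq> 0. (cmod (\<xi> x))\<^sup>2)"
  unfolding sqn_def ip_def by (simp only: Re_sum Re_cnj_mult_self)

lemma ip_self: "ip \<xi> \<xi> = of_real (sqn \<xi>)"
proof -
  have "Im (ip \<xi> \<xi>) = 0" by (simp add: ip_def)
  then show ?thesis by (simp add: complex_eq_iff sqn_def)
qed

lemma fin_supp_add: "fin_supp \<xi> \<Longrightarrow> fin_supp \<eta> \<Longrightarrow> fin_supp (\<lambda>x. \<xi> x + \<eta> x)"
  by (rule fin_suppI[of "{x. \<xi> x \<noteq> 0} \<union> {x. \<eta> x \<noteq> 0}"]) (auto simp: fin_supp_def)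

lemma fin_supp_diff: "fin_supp \<xi> \<Longrightarrow> fin_supp \<eta> \<Longrightarrow> fin_supp (\<lambda>x. \<xi> x - \<eta> x)"
  by (rule fin_suppI[of "{x. \<xi> x \<noteq> 0} \<union> {x. \<eta> x \<noteq> 0}"]) (auto simp: fin_supp_def)

lemma ip_add_right: "ip \<xi> (\<lambda>x. \<eta> x + \<zeta> x) = ip \<xi> \<eta> + ip \<xi> \<zeta>"
  by (simp add: ip_def algebra_simps sum.distrib)

lemma ip_diff_right: "ip \<xi> (\<lambda>x. \<eta> x - \<zeta> x) = ip \<xi> \<eta> - ip \<xi> \<zeta>"
  by (simp add: ip_def algebra_simps sum_subtractf)

lemma ip_scale_right: "ip \<xi> (\<lambda>x. a * \<eta> x) = a * ip \<xi> \<eta>"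
  by (simp add: ip_def sum_distrib_left mult_ac)

lemma ip_commute:
  assumes "fin_supp \<xi>" "fin_supp \<eta>"
  shows "ip \<xi> \<eta> = cnj (ip \<eta> \<xi>)"
proof -
  let ?W = "{x. \<xi> x \<noteq> 0} \<union> {x. \<eta> x \<noteq> 0}"
  have W: "finite ?W" using assms by (simp add: fin_supp_def)
  have "ip \<xi> \<eta> = (\<Sum>x\<in>?W. cnj (\<xi> x) * \<eta> x)" "ip \<eta> \<xi> = (\<Sum>x\<in>?W. cnj (\<eta> x) * \<xi> x)"
    using W by (intro ip_eq_sum; auto)+
  then show ?thesis by (simp add: mult.commute)
qed

lemma ip_add_left:
  assumes "fin_supp \<xi>" "fin_supp \<eta>"
  shows "ip (\<lambda>x. \<xi> x + \<eta> x) \<zeta> = ip \<xi> \<zeta> + ip \<eta> \<zeta>"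
proof -
  let ?W = "{x. \<xi> x \<noteq> 0} \<union> {x. \<eta> x \<noteq> 0}"
  have W: "finite ?W" using assms by (simp add: fin_supp_def)
  have "ip (\<lambda>x. \<xi> x + \<eta> x) \<zeta> = (\<Sum>x\<in>?W. cnj (\<xi> x + \<eta> x) * \<zeta> x)"
      "ip \<xi> \<zeta> = (\<Sum>x\<in>?W. cnj (\<xi> x) * \<zeta> x)" "ip \<eta> \<zeta> = (\<Sum>x\<in>?W. cnj (\<eta> x) * \<zeta> x)"
    using W by (intro ip_eq_sum; auto)+
  then show ?thesis by (simp add: algebra_simps sum.distrib)
qed

lemma ip_diff_left:
  assumes "fin_supp \<xi>" "fin_supp \<eta>"
  shows "ip (\<lambda>x. \<xi> x - \<eta> x) \<zeta> = ip \<xi> \<zeta> - ip \<eta> \<zeta>"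
proof -
  have "ip (\<lambda>x. (\<xi> x - \<eta> x) + \<eta> x) \<zeta> = ip (\<lambda>x. \<xi> x - \<eta> x) \<zeta> + ip \<eta> \<zeta>"
    using assms by (intro ip_add_left fin_supp_diff)
  then show ?thesis by simp
qed

lemma ip_bound: "fin_supp \<xi> \<Longrightarrow> fin_supp \<eta> \<Longrightarrow> cmod (ip \<xi> \<eta>) \<le> (sqn \<xi> + sqn \<eta>) / 2"
proof -
  assume fs: "fin_supp \<xi>" "fin_supp \<eta>"
  let ?W = "{x. \<xi> x \<noteq> 0} \<union> {x. \<eta> x \<noteq> 0}"
  have W: "finite ?W" using fs by (simp add: fin_supp_def)
  have "cmod (ip \<xi> \<eta>) = cmod (\<Sum>x\<in>?W. cnj (\<xi> x) * \<eta> x)"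
    by (subst ip_eq_sum[OF W]) auto
  also have "\<dots> \<le> (\<Sum>x\<in>?W. ((cmod (\<xi> x))\<^sup>2 + (cmod (\<eta> x))\<^sup>2) / 2)"
    by (intro sum_norm_le cmod_mult_le_mean)
  also have "\<dots> = (sqn \<xi> + sqn \<eta>) / 2"
  proof -
    have "sqn \<xi> = (\<Sum>x\<in>?W. (cmod (\<xi> x))\<^sup>2)" "sqn \<eta> = (\<Sum>x\<in>?W. (cmod (\<eta> x))\<^sup>2)"
      using W by (intro sqn_eq_sum; auto)+
    then show ?thesis by (simp add: sum.distrib sum_divide_distrib[symmetric])
  qed
  finally show ?thesis .
qed

text \<open>A contraction with scalar entries stays contractive on vectors with vector-valued
  coordinates: the form bound holds in every coordinate \<open>z\<close>, and the bounds by
  arithmetic means add up. It serves matrices indexed by vertices as well as matrices indexed by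
  generations.\<close>

lemma contraction_on_vectors:
  assumes A: "form_bounded F A 1" and F: "finite F"
    and X: "\<And>x. x \<in> F \<Longrightarrow> fin_supp (X x)" and Y: "\<And>x. x \<in> F \<Longrightarrow> fin_supp (Y x)"
  shows "cmod (\<Sum>x\<in>F. \<Sum>y\<in>F. A x y * ip (X x) (Y y)) \<le> ((\<Sum>x\<in>F. sqn (X x)) + (\<Sum>y\<in>F. sqn (Y y))) / 2"
proof -
  define W where "W = (\<Union>x\<in>F. {z. X x z \<noteq> 0} \<union> {z. Y x z \<noteq> 0})"
  have W: "finite W" using F X Y by (auto simp: W_def fin_supp_def)
  have ip: "ip (X x) (Y y) = (\<Sum>z\<in>W. cnj (X x z) * Y y z)" if "x \<in> F" for x y
    using W that by (intro ip_eq_sum) (auto simp: W_def)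
  have sX: "sqn (X x) = (\<Sum>z\<in>W. (cmod (X x z))\<^sup>2)" and sY: "sqn (Y x) = (\<Sum>z\<in>W. (cmod (Y x z))\<^sup>2)"
    if "x \<in> F" for x
    using W that by (intro sqn_eq_sum; auto simp: W_def)+
  have "(\<Sum>x\<in>F. \<Sum>y\<in>F. A x y * ip (X x) (Y y)) = (\<Sum>x\<in>F. \<Sum>y\<in>F. \<Sum>z\<in>W. cnj (X x z) * A x y * Y y z)"
    by (intro sum.cong refl) (simp add: ip sum_distrib_left mult_ac)
  also have "\<dots> = (\<Sum>x\<in>F. \<Sum>z\<in>W. \<Sum>y\<in>F. cnj (X x z) * A x y * Y y z)"
    by (intro sum.cong refl sum.swap)
  also have "\<dots> = (\<Sum>z\<in>W. form F A (\<lambda>x. X x z) (\<lambda>y. Y y z))"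
    unfolding form_def by (rule sum.swap)
  also have "cmod \<dots> \<le> (\<Sum>z\<in>W. 1 * (sqnorm_on F (\<lambda>x. X x z) + sqnorm_on F (\<lambda>y. Y y z)) / 2)"
    using A unfolding form_bounded_def by (intro sum_norm_le) blast
  also have "\<dots> = ((\<Sum>z\<in>W. sqnorm_on F (\<lambda>x. X x z)) + (\<Sum>z\<in>W. sqnorm_on F (\<lambda>x. Y x z))) / 2"
    by (simp add: sum.distrib sum_divide_distrib[symmetric])
  also have "(\<Sum>z\<in>W. sqnorm_on F (\<lambda>x. X x z)) = (\<Sum>x\<in>F. sqn (X x))"
    unfolding sqnorm_on_def by (subst sum.swap) (simp add: sX)
  also have "(\<Sum>z\<in>W. sqnorm_on F (\<lambda>x. Y x z)) = (\<Sum>x\<in>F. sqn (Y x))"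
    unfolding sqnorm_on_def by (subst sum.swap) (simp add: sY)
  finally show ?thesis .
qed

section \<open>The parent co-isometry\<close>

context horocyclic_tree
begin

lemma finite_children: "finite {y. c y = x}"
  using card_children[of x] q_ge_2 by (intro card_ge_0_finite) simp

definition rq :: complex where "rq = of_real (1 / sqrt (real q))"

lemma rq_mult_self: "rq * rq = 1 / of_nat q"
  unfolding rq_def of_real_mult[symmetric] by (simp add: real_sqrt_mult_self[of "real q"] flip: of_real_mult)

lemma cnj_rq [simp]: "cnj rq = rq" by (simp add: rq_def)

lemma q_pos [simp]: "0 < q" using q_ge_2 by simp

text \<open>This is the adjoint of \<open>pull\<close>, the isometry V of the overview.\<close>

definition push :: "('v \<Rightarrow> complex) \<Rightarrow> 'v \<Rightarrow> complex" where
  "push \<xi> v = rq * (\<Sum>x | c x = v. \<xi> x)"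

definition pull :: "('v \<Rightarrow> complex) \<Rightarrow> 'v \<Rightarrow> complex" where
  "pull \<eta> x = rq * \<eta> (c x)"

lemma push_eq_0: "(\<And>x. c x = v \<Longrightarrow> \<xi> x = 0) \<Longrightarrow> push \<xi> v = 0"
  by (simp add: push_def)

lemma fin_supp_push:
  assumes "fin_supp \<xi>" shows "fin_supp (push \<xi>)"
proof (rule fin_suppI[of "c ` {x. \<xi> x \<noteq> 0}"])
  show "finite (c ` {x. \<xi> x \<noteq> 0})" using assms by (simp add: fin_supp_def)
  show "push \<xi> v = 0" if "v \<notin> c ` {x. \<xi> x \<noteq> 0}" for v
    using that by (intro push_eq_0) auto
qed

lemma fin_supp_pull:
  assumes "fin_supp \<eta>" shows "fin_supp (pull \<eta>)"
proof (rule fin_suppI[of "\<Union>v\<in>{v. \<eta> v \<noteq> 0}. {x. c x = v}"])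
  show "finite (\<Union>v\<in>{v. \<eta> v \<noteq> 0}. {x. c x = v})"
    using assms finite_children by (auto simp: fin_supp_def)
qed (auto simp: pull_def)

lemma push_pull: "push (pull \<eta>) = \<eta>"
proof
  fix v
  have "push (pull \<eta>) v = rq * (\<Sum>x | c x = v. rq * \<eta> v)"
    by (simp add: push_def pull_def)
  also have "\<dots> = (rq * rq) * of_nat q * \<eta> v" by (simp add: card_children)
  finally show "push (pull \<eta>) v = \<eta> v" using q_ge_2 by (simp add: rq_mult_self)
qed

lemma ip_push:
  assumes "fin_supp \<xi>"
  shows "ip (push \<xi>) \<eta> = ip \<xi> (pull \<eta>)"
proof -
  let ?W = "{x. \<xi> x \<noteq> 0}"
  have W: "finite ?W" using assms by (simp add: fin_supp_def)
  have "ip (push \<xi>) \<eta> = (\<Sum>v\<in>c ` ?W. cnj (push \<xi> v) * \<eta> v)"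
    using W by (intro ip_eq_sum) (auto intro!: push_eq_0)
  also have "\<dots> = (\<Sum>v\<in>c ` ?W. \<Sum>x\<in>{x. x \<in> ?W \<and> c x = v}. cnj (\<xi> x) * pull \<eta> x)"
  proof (rule sum.cong[OF refl])
    fix v
    have "cnj (push \<xi> v) * \<eta> v = (\<Sum>x | c x = v. cnj (\<xi> x) * pull \<eta> x)"
      by (simp add: push_def pull_def sum_distrib_left sum_distrib_right mult_ac)
    also have "\<dots> = (\<Sum>x\<in>{x. x \<in> ?W \<and> c x = v}. cnj (\<xi> x) * pull \<eta> x)"
      by (rule sum.mono_neutral_right) (auto simp: finite_children)
    finally show "cnj (push \<xi> v) * \<eta> v = (\<Sum>x\<in>{x. x \<in> ?W \<and> c x = v}. cnj (\<xi> x) * pull \<eta> x)" .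
  qed
  also have "\<dots> = (\<Sum>x\<in>?W. cnj (\<xi> x) * pull \<eta> x)"
    by (rule sum.image_gen[OF W, symmetric])
  finally show ?thesis by (simp add: ip_def)
qed

lemma push_diff: "push (\<lambda>x. \<xi> x - \<eta> x) = (\<lambda>v. push \<xi> v - push \<eta> v)"
  by (simp add: push_def[abs_def] sum_subtractf algebra_simps)

definition defect :: "('v \<Rightarrow> complex) \<Rightarrow> 'v \<Rightarrow> complex" where
  "defect \<xi> x = \<xi> x - pull (push \<xi>) x"

lemma fin_supp_defect: "fin_supp \<xi> \<Longrightarrow> fin_supp (defect \<xi>)"
  unfolding defect_def[abs_def] by (intro fin_supp_diff fin_supp_pull fin_supp_push)

lemma push_defect: "push (defect \<xi>) = (\<lambda>v. 0)"
  unfolding defect_def[abs_def] push_diff push_pull by simp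

text \<open>\<open>defect\<close> is the orthogonal projection onto the kernel of
  \<open>push\<close>. A vector in the range of \<open>pull\<close> is orthogonal to it by
  adjointness, since \<open>push\<close> annihilates every defect.\<close>

lemma ip_defect:
  assumes "fin_supp \<xi>" "fin_supp \<eta>"
  shows "ip (defect \<xi>) (defect \<eta>) = ip \<xi> \<eta> - ip (push \<xi>) (push \<eta>)"
proof -
  have "ip (pull (push \<xi>)) (defect \<eta>) = cnj (ip (push (defect \<eta>)) (push \<xi>))"
    unfolding ip_push[OF fin_supp_defect[OF assms(2)]]
    using assms by (intro ip_commute fin_supp_pull fin_supp_push fin_supp_defect)
  also have "\<dots> = 0" unfolding push_defect by (simp add: ip_def)
  finally have *: "ip (pull (push \<xi>)) (defect \<eta>) = 0" .
  have "ip (defect \<xi>) (defect \<eta>) = ip \<xi> (defect \<eta>) - ip (pull (push \<xi>)) (defect \<eta>)"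
  proof -
    have "defect \<xi> = (\<lambda>x. \<xi> x - pull (push \<xi>) x)" by (rule ext) (rule defect_def)
    then show ?thesis using ip_diff_left[OF assms(1) fin_supp_pull[OF fin_supp_push[OF assms(1)]]] by simp
  qed
  also have "\<dots> = ip \<xi> \<eta> - ip \<xi> (pull (push \<eta>))"
  proof -
    have "defect \<eta> = (\<lambda>x. \<eta> x - pull (push \<eta>) x)" by (rule ext) (rule defect_def)
    then show ?thesis unfolding * by (simp add: ip_diff_right)
  qed
  also have "ip \<xi> (pull (push \<eta>)) = ip (push \<xi>) (push \<eta>)" using assms(1) by (simp add: ip_push)
  finally show ?thesis .
qed

lemma sqn_defect: "fin_supp \<xi> \<Longrightarrow> sqn (defect \<xi>) = sqn \<xi> - sqn (push \<xi>)"
  unfolding sqn_def by (simp add: ip_defect)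

end

section \<open>Resolvent and trace norm bounds\<close>

lemma tau_funpow: "(tau ^^ n) A i j = (if n \<le> i \<and> n \<le> j then A (i - n) (j - n) else 0)"
proof (induction n arbitrary: i j)
  case (Suc n)
  have "(tau ^^ Suc n) A i j = tau ((tau ^^ n) A) i j" by simp
  then show ?case by (auto simp: tau_def[of "(tau ^^ n) A"] Suc.IH)
qed simp

lemma tau_resolvent_eq_sum:
  "tau_resolvent q A i j = (\<Sum>n<Suc (min i j). (1 / of_nat q) ^ n * A (i - n) (j - n))"
proof -
  have "tau_resolvent q A i j = (\<Sum>n<Suc (min i j). (1 / of_nat q) ^ n * (tau ^^ n) A i j)"
    unfolding tau_resolvent_def by (rule suminf_finite) (auto simp: tau_funpow less_Suc_eq_le)
  also have "\<dots> = (\<Sum>n<Suc (min i j). (1 / of_nat q) ^ n * A (i - n) (j - n))"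
    by (intro sum.cong refl) (auto simp: tau_funpow)
  finally show ?thesis .
qed

lemma tau_resolvent_0: "i = 0 \<or> j = 0 \<Longrightarrow> tau_resolvent q A i j = A i j"
  by (auto simp: tau_resolvent_eq_sum)

text \<open>With \<open>tau_resolvent_0\<close> this is the equation h = A + \<tau>(h)/q for the
  resolvent h, read entrywise.\<close>

lemma tau_resolvent_Suc:
  "tau_resolvent q A (Suc i) (Suc j) = A (Suc i) (Suc j) + tau_resolvent q A i j / of_nat q"
  unfolding tau_resolvent_eq_sum min_Suc_Suc
  by (subst sum.lessThan_Suc_shift) (simp add: sum_divide_distrib add_divide_distrib)

text \<open>Standard basis vectors along a diagonal form admissible orthonormal systems, so all
  diagonals of a trace class matrix are absolutely summable. With \<open>J = 0\<close> the statement
  gives \<open>0 \<le> M\<close>.\<close>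

lemma trace_norm_diagonal_le:
  fixes A :: "nat \<Rightarrow> nat \<Rightarrow> complex"
  assumes "\<And>t. t \<in> trace_norm_set A \<Longrightarrow> t \<le> M"
  shows "(\<Sum>j<J. cmod (A (m + j) (n + j))) \<le> M"
proof -
  define \<delta> :: "nat \<Rightarrow> nat \<Rightarrow> complex" where "\<delta> k x = (if x = k then 1 else 0)" for k x
  let ?F = "{..<m + n + J}"
  have sum_\<delta>: "(\<Sum>x\<in>?F. \<delta> k x * g x) = g k" if "k < m + n + J" for k g
  proof -
    have "(\<Sum>x\<in>?F. \<delta> k x * g x) = (\<Sum>x\<in>?F. if x = k then g x else 0)"
      by (intro sum.cong) (auto simp: \<delta>_def)
    then show ?thesis using that by simp
  qed
  have cnj_\<delta>: "cnj (\<delta> k x) = \<delta> k x" for k x by (simp add: \<delta>_def)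
  have o: "orthonormal_on ?F J (\<lambda>j. \<delta> (l + j))" if "l \<le> m + n" for l
    unfolding orthonormal_on_def cnj_\<delta> using that by (auto simp: sum_\<delta>) (simp_all add: \<delta>_def)
  have "(\<Sum>j<J. cmod (A (m + j) (n + j)))
      = (\<Sum>j<J. cmod (\<Sum>x\<in>?F. \<Sum>y\<in>?F. cnj (\<delta> (m + j) x) * A x y * \<delta> (n + j) y))"
  proof (rule sum.cong[OF refl])
    fix j assume j: "j \<in> {..<J}"
    have "(\<Sum>x\<in>?F. \<Sum>y\<in>?F. cnj (\<delta> (m + j) x) * A x y * \<delta> (n + j) y)
        = (\<Sum>x\<in>?F. \<delta> (m + j) x * (\<Sum>y\<in>?F. \<delta> (n + j) y * A x y))"
      unfolding cnj_\<delta> sum_distrib_left by (simp add: mult_ac)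
    also have "\<dots> = A (m + j) (n + j)" using j by (simp add: sum_\<delta>)
    finally show "cmod (A (m + j) (n + j)) = cmod (\<Sum>x\<in>?F. \<Sum>y\<in>?F. cnj (\<delta> (m + j) x) * A x y * \<delta> (n + j) y)"
      by simp
  qed
  also have "\<dots> \<in> trace_norm_set A"
    unfolding trace_norm_set_def mem_Collect_eq
    by (rule exI[of _ J], rule exI[of _ ?F], rule exI[of _ "\<lambda>j. \<delta> (n + j)"], rule exI[of _ "\<lambda>j. \<delta> (m + j)"])
      (simp add: o)
  finally show ?thesis by (rule assms)
qed

lemma trace_norm_diagonal_tendsto_0:
  fixes A :: "nat \<Rightarrow> nat \<Rightarrow> complex"
  assumes "\<And>t. t \<in> trace_norm_set A \<Longrightarrow> t \<le> M"
  shows "(\<lambda>j. A (m + j) (n + j)) \<longlonglongrightarrow> 0" "summable (\<lambda>j. A (m + j) (n + j))"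
proof -
  have "summable (\<lambda>j. cmod (A (m + j) (n + j)))"
    by (rule summableI_nonneg_bounded[OF _ trace_norm_diagonal_le[OF assms]]) auto
  then show "summable (\<lambda>j. A (m + j) (n + j))" by (rule summable_norm_cancel)
  then show "(\<lambda>j. A (m + j) (n + j)) \<longlonglongrightarrow> 0" by (rule summable_LIMSEQ_zero)
qed

section \<open>The upper bound for the Schur norm\<close>

text \<open>The combination of point masses at the points \<open>g i\<close> with weights
  \<open>a i\<close>; weights at coinciding points add up.\<close>

definition mass :: "'i set \<Rightarrow> ('i \<Rightarrow> complex) \<Rightarrow> ('i \<Rightarrow> 'v) \<Rightarrow> 'v \<Rightarrow> complex" where
  "mass I a g z = (\<Sum>i\<in>I. if g i = z then a i else 0)"

lemma fin_supp_mass: "finite I \<Longrightarrow> fin_supp (mass I a g)"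
  by (rule fin_suppI[of "g ` I"]) (auto simp: mass_def intro!: sum.neutral)

lemma ip_mass:
  assumes "finite I"
  shows "ip (mass I a g) (mass J b h) = (\<Sum>i\<in>I. \<Sum>j\<in>J. if g i = h j then cnj (a i) * b j else 0)"
proof -
  let ?W = "g ` I"
  have "ip (mass I a g) (mass J b h) = (\<Sum>z\<in>?W. cnj (mass I a g z) * mass J b h z)"
    using assms by (intro ip_eq_sum) (auto simp: mass_def intro!: sum.neutral)
  also have "\<dots> = (\<Sum>z\<in>?W. \<Sum>i\<in>I. (if g i = z then cnj (a i) * mass J b h z else 0))"
    by (intro sum.cong refl)
      (simp add: mass_def[of I] sum_distrib_right if_distrib[of cnj] if_distrib[of "\<lambda>t. t * _"] cong: if_cong)
  also have "\<dots> = (\<Sum>i\<in>I. \<Sum>z\<in>?W. if g i = z then cnj (a i) * mass J b h z else 0)"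
    by (rule sum.swap)
  also have "\<dots> = (\<Sum>i\<in>I. cnj (a i) * mass J b h (g i))"
    using assms by (intro sum.cong refl) auto
  finally show ?thesis
    by (auto simp: mass_def sum_distrib_left intro!: sum.cong)
qed

lemma ip_scale_left: "ip (\<lambda>x. a * \<xi> x) \<eta> = cnj a * ip \<xi> \<eta>"
  by (cases "a = 0") (simp_all add: ip_def sum_distrib_left mult_ac)

context horocyclic_tree
begin

section \<open>Meeting of ancestral rays\<close>

lemma height_funpow_c: "height ((c ^^ m) x) = height x + int m"
  by (rule height_funpow) (rule height_c)

lemma ex_first_meet: "\<exists>m n. first_meet c x y m n"
proof -
  define m where "m = (LEAST m. \<exists>n. (c ^^ m) x = (c ^^ n) y)"
  have "\<exists>n. (c ^^ m) x = (c ^^ n) y"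
    unfolding m_def by (rule LeastI_ex) (rule confluent)
  then obtain n where n: "(c ^^ m) x = (c ^^ n) y" ..
  have "(c ^^ (m - 1)) x \<noteq> (c ^^ (n - 1)) y" if "m \<noteq> 0"
  proof
    assume "(c ^^ (m - 1)) x = (c ^^ (n - 1)) y"
    then have "m \<le> m - 1" unfolding m_def[symmetric] by (subst m_def) (auto intro: Least_le)
    then show False using that by simp
  qed
  then show ?thesis using n by (auto simp: first_meet_def)
qed

lemma dist_first_meet: "first_meet c x y m n \<Longrightarrow> d x y = m + n"
  unfolding first_meet_def using dist_eq by blast

definition parity :: "'v \<Rightarrow> complex" where
  "parity x = (if even (height x) then 1 else -1)"

text \<open>The meeting vertex has height \<open>height x + m\<close> and also
  \<open>height y + n\<close>, so \<open>m + n\<close> has the parity of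
  \<open>height x + height y\<close>.\<close>

lemma parity_dist: "(-1) ^ d x y = parity x * parity y"
proof -
  obtain m n where mn: "first_meet c x y m n" using ex_first_meet by blast
  then have "height ((c ^^ m) x) = height ((c ^^ n) y)" by (simp add: first_meet_def)
  then have "height x + int m = height y + int n" by (simp add: height_funpow_c)
  then have "even (m + n) \<longleftrightarrow> even (height x) = even (height y)"
    by (metis even_add even_of_nat)
  then show ?thesis unfolding dist_first_meet[OF mn] by (auto simp: parity_def minus_one_power_iff)
qed

text \<open>Heights force \<open>k\<close> and \<open>l\<close> to differ as \<open>m\<close> and
  \<open>n\<close> do. A coincidence before the first meeting would persist along both rays up to
  the pair \<open>m - 1\<close>, \<open>n - 1\<close>, which is excluded.\<close>

lemma first_meet_iff:
  assumes "first_meet c x y m n"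
  shows "(c ^^ k) x = (c ^^ l) y \<longleftrightarrow> (\<exists>j. k = m + j \<and> l = n + j)"
proof
  assume eq: "(c ^^ k) x = (c ^^ l) y"
  have meet: "(c ^^ m) x = (c ^^ n) y" using assms by (simp add: first_meet_def)
  have h: "int k + int n = int l + int m"
    using arg_cong[OF eq, of height] arg_cong[OF meet, of height] by (simp add: height_funpow_c)
  show "\<exists>j. k = m + j \<and> l = n + j"
  proof (cases "m \<le> k")
    case True
    then show ?thesis using h by (intro exI[of _ "k - m"]) auto
  next
    case False
    then obtain i where i: "m = Suc (i + k)" by (metis add.commute less_iff_Suc_add not_le)
    then have "n = Suc (i + l)" using h by simp
    moreover have "(c ^^ (i + k)) x = (c ^^ (i + l)) y" by (simp add: funpow_add eq)
    ultimately show ?thesis using assms i by (simp add: first_meet_def)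
  qed
next
  assume "\<exists>j. k = m + j \<and> l = n + j"
  then obtain j where "k = j + m" "l = j + n" by (auto simp: add.commute)
  then show "(c ^^ k) x = (c ^^ l) y" using assms by (simp add: funpow_add first_meet_def)
qed

lemma funpow_inj: "(c ^^ k) x = (c ^^ l) x \<longleftrightarrow> k = l"
proof
  assume "(c ^^ k) x = (c ^^ l) x"
  then have "height ((c ^^ k) x) = height ((c ^^ l) x)" by simp
  then show "k = l" by (simp add: height_funpow_c)
qed simp

text \<open>Only the pairs \<open>(m + j, n + j)\<close> contribute, and the cutoff \<open>K\<close>
  admits exactly \<open>J\<close> of them.\<close>

lemma sum_first_meet:
  fixes f :: "nat \<Rightarrow> nat \<Rightarrow> complex"
  assumes mn: "first_meet c x y m n" and K: "K = max m n + J"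
  shows "(\<Sum>k<K. \<Sum>l<K. if (c ^^ k) x = (c ^^ l) y then f k l else 0) = (\<Sum>j<J. f (m + j) (n + j))"
proof -
  let ?S = "(\<lambda>j. (m + j, n + j)) ` {..<J}"
  have "(\<Sum>k<K. \<Sum>l<K. if (c ^^ k) x = (c ^^ l) y then f k l else 0)
      = (\<Sum>p\<in>{..<K} \<times> {..<K}. if (c ^^ fst p) x = (c ^^ snd p) y then f (fst p) (snd p) else 0)"
    by (simp add: sum.cartesian_product case_prod_beta)
  also have "\<dots> = (\<Sum>p\<in>?S. f (fst p) (snd p))"
    by (intro sum.mono_neutral_cong_right) (auto simp: first_meet_iff[OF mn] K)
  also have "\<dots> = (\<Sum>j<J. f (m + j) (n + j))"
    by (subst sum.reindex) (auto simp: inj_on_def)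
  finally show ?thesis .
qed

subsection \<open>The Gram kernel\<close>

definition gram :: "'v \<Rightarrow> 'v \<Rightarrow> complex" where
  "gram v w = (if v = w then 1 else 0) - (if c v = c w then 1 / of_nat q else 0)"

abbreviation path_vec :: "(nat \<Rightarrow> complex) \<Rightarrow> nat \<Rightarrow> 'v \<Rightarrow> 'v \<Rightarrow> complex" where
  "path_vec a K x \<equiv> mass {..<K} a (\<lambda>k. (c ^^ k) x)"

lemma push_mass: "push (mass I a g) = (\<lambda>v. rq * mass I a (\<lambda>i. c (g i)) v)"
proof
  fix v
  have "(\<Sum>w | c w = v. mass I a g w) = (\<Sum>i\<in>I. \<Sum>w | c w = v. if g i = w then a i else 0)"
    unfolding mass_def by (rule sum.swap)
  also have "\<dots> = mass I a (\<lambda>i. c (g i)) v"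
    unfolding mass_def by (intro sum.cong refl) (simp add: finite_children)
  finally show "push (mass I a g) v = rq * mass I a (\<lambda>i. c (g i)) v" by (simp add: push_def)
qed

lemma ip_defect_path_vec:
  "ip (defect (path_vec a K x)) (defect (path_vec b L y))
     = (\<Sum>k<K. \<Sum>l<L. cnj (a k) * b l * gram ((c ^^ k) x) ((c ^^ l) y))"
proof -
  have "ip (push (path_vec a K x)) (push (path_vec b L y))
      = (rq * rq) * ip (mass {..<K} a (\<lambda>k. c ((c ^^ k) x))) (mass {..<L} b (\<lambda>l. c ((c ^^ l) y)))"
    by (simp add: push_mass ip_scale_left ip_scale_right)
  also have "\<dots> = (\<Sum>k<K. \<Sum>l<L. if c ((c ^^ k) x) = c ((c ^^ l) y) then cnj (a k) * b l / of_nat q else 0)"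
    unfolding rq_mult_self ip_mass[OF finite_lessThan] sum_distrib_left
    by (intro sum.cong refl) simp
  finally show ?thesis
    unfolding ip_defect[OF fin_supp_mass[OF finite_lessThan] fin_supp_mass[OF finite_lessThan]] ip_mass[OF finite_lessThan]
    by (simp only: sum_subtractf[symmetric], intro sum.cong refl) (auto simp: gram_def algebra_simps)
qed

text \<open>Distinct vertices of one ray have distinct heights, so they are neither equal nor
  siblings, and only the diagonal of the Gram kernel survives.\<close>

lemma sqn_defect_path_vec:
  "sqn (defect (path_vec a K x)) = (1 - 1 / real q) * sqnorm_on {..<K} a"
proof -
  have gram: "gram ((c ^^ k) x) ((c ^^ l) x) = (if k = l then of_real (1 - 1 / real q) else 0)" for k l
    using funpow_inj[of "Suc k" x "Suc l"] by (simp add: gram_def funpow_inj)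
  have "ip (defect (path_vec a K x)) (defect (path_vec a K x))
      = (\<Sum>k<K. \<Sum>l<K. if k = l then of_real (1 - 1 / real q) * (cnj (a k) * a k) else 0)"
    unfolding ip_defect_path_vec gram by (intro sum.cong refl) auto
  also have "\<dots> = of_real (1 - 1 / real q) * (\<Sum>k<K. cnj (a k) * a k)"
    by (simp add: sum_distrib_left)
  finally have "sqn (defect (path_vec a K x)) = (1 - 1 / real q) * (\<Sum>k<K. Re (cnj (a k) * a k))"
    unfolding sqn_def by (simp only: times_complex.simps Re_complex_of_real Im_complex_of_real Re_sum)
  then show ?thesis unfolding Re_cnj_mult_self sqnorm_on_def .
qed

text \<open>Written with defect vectors, the form in \<open>a\<close> and \<open>b\<close> is the
  contraction \<open>A\<close> applied to vectors indexed by the vertices in \<open>F\<close>. The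
  squared norms of these vectors factor into \<open>1 - 1 / q\<close>, the weight of
  \<open>u\<close> or \<open>v\<close>, and the norm of \<open>a\<close> or
  \<open>b\<close>.\<close>

lemma gram_form_bounded:
  assumes A: "form_bounded F A 1" and F: "finite F" and u: "sqnorm_on F u \<le> 1" and v: "sqnorm_on F v \<le> 1"
  shows "form_bounded {..<K} (\<lambda>k l. form F (\<lambda>x y. gram ((c ^^ k) x) ((c ^^ l) y) * A x y) u v) (1 - 1 / real q)"
  unfolding form_bounded_def
proof (intro allI)
  fix a b
  let ?r = "1 - 1 / real q"
  let ?X = "\<lambda>w a x. defect (path_vec (\<lambda>k. w x * a k) K x)"
  have r: "0 \<le> ?r" using q_ge_2 by simp
  let ?t = "\<lambda>x y k l. cnj (a k) * (cnj (u x) * (gram ((c ^^ k) x) ((c ^^ l) y) * A x y) * v y) * b l"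
  have "form {..<K} (\<lambda>k l. form F (\<lambda>x y. gram ((c ^^ k) x) ((c ^^ l) y) * A x y) u v) a b
      = (\<Sum>k<K. \<Sum>l<K. \<Sum>x\<in>F. \<Sum>y\<in>F. ?t x y k l)"
    unfolding form_def sum_distrib_left sum_distrib_right ..
  also have "\<dots> = (\<Sum>k<K. \<Sum>x\<in>F. \<Sum>l<K. \<Sum>y\<in>F. ?t x y k l)"
    by (intro sum.cong refl sum.swap)
  also have "\<dots> = (\<Sum>x\<in>F. \<Sum>k<K. \<Sum>y\<in>F. \<Sum>l<K. ?t x y k l)"
    by (subst sum.swap) (intro sum.cong refl sum.swap)
  also have "\<dots> = (\<Sum>x\<in>F. \<Sum>y\<in>F. \<Sum>k<K. \<Sum>l<K. ?t x y k l)"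
    by (intro sum.cong refl sum.swap)
  also have "\<dots> = (\<Sum>x\<in>F. \<Sum>y\<in>F. A x y * ip (?X u a x) (?X v b y))"
    unfolding ip_defect_path_vec sum_distrib_left by (simp add: mult_ac)
  finally have eq: "form {..<K} (\<lambda>k l. form F (\<lambda>x y. gram ((c ^^ k) x) ((c ^^ l) y) * A x y) u v) a b
      = (\<Sum>x\<in>F. \<Sum>y\<in>F. A x y * ip (?X u a x) (?X v b y))" .
  have "cmod (\<Sum>x\<in>F. \<Sum>y\<in>F. A x y * ip (?X u a x) (?X v b y)) \<le> ((\<Sum>x\<in>F. sqn (?X u a x)) + (\<Sum>y\<in>F. sqn (?X v b y))) / 2"
    by (intro contraction_on_vectors A F fin_supp_defect fin_supp_mass finite_lessThan)
  also have "\<dots> = ?r * (sqnorm_on F u * sqnorm_on {..<K} a + sqnorm_on F v * sqnorm_on {..<K} b) / 2"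
  proof -
    have *: "(\<Sum>x\<in>F. sqn (?X w e x)) = ?r * (sqnorm_on F w * sqnorm_on {..<K} e)" for w e
    proof -
      have "sqn (?X w e x) = ?r * ((cmod (w x))\<^sup>2 * sqnorm_on {..<K} e)" for x
        by (simp only: sqn_defect_path_vec sqnorm_on_scale)
      then have "(\<Sum>x\<in>F. sqn (?X w e x)) = (\<Sum>x\<in>F. ?r * ((cmod (w x))\<^sup>2 * sqnorm_on {..<K} e))"
        by (rule sum.cong[OF refl])
      also have "\<dots> = ?r * ((\<Sum>x\<in>F. (cmod (w x))\<^sup>2) * sqnorm_on {..<K} e)"
        by (simp only: sum_distrib_left[symmetric] sum_distrib_right[symmetric])
      finally show ?thesis by (simp only: sqnorm_on_def[of F w])
    qed
    show ?thesis unfolding * distrib_left ..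
  qed
  also have "\<dots> \<le> ?r * (1 * sqnorm_on {..<K} a + 1 * sqnorm_on {..<K} b) / 2"
  proof -
    have "sqnorm_on F u * sqnorm_on {..<K} a + sqnorm_on F v * sqnorm_on {..<K} b
        \<le> 1 * sqnorm_on {..<K} a + 1 * sqnorm_on {..<K} b"
      using u v by (intro add_mono mult_right_mono) simp_all
    from mult_left_mono[OF this r] show ?thesis by (rule divide_right_mono) simp
  qed
  finally show "cmod (form {..<K} (\<lambda>k l. form F (\<lambda>x y. gram ((c ^^ k) x) ((c ^^ l) y) * A x y) u v) a b)
      \<le> ?r * (sqnorm_on {..<K} a + sqnorm_on {..<K} b) / 2" unfolding eq by (simp only: mult_1_left)
qed

subsection \<open>Reproducing the multiplier\<close>

text \<open>The two terms of \<open>gram\<close> give the diagonal sum of \<open>h\<close> at the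
  meeting of \<open>x\<close> and \<open>y\<close>, minus 1/q times that of their parents. This
  difference undoes the resolvent and leaves the Hankel entries along a diagonal, which telescope;
  the last resolvent entry remains because of the cutoff.\<close>

lemma gram_pairing_telescopes:
  fixes \<phi> :: "nat \<Rightarrow> complex"
  assumes mn: "first_meet c x y m n" and K: "K = max m n + Suc J"
  defines "h \<equiv> tau_resolvent q (hankel \<phi>)"
  shows "(\<Sum>k<K. \<Sum>l<K. h k l * gram ((c ^^ k) x) ((c ^^ l) y))
    = \<phi> (m + n) - \<phi> (m + n + 2 * Suc J) - h (m + J) (n + J) / of_nat q"
proof -
  have hs: "h (Suc i) (Suc j) = \<phi> (Suc i + Suc j) - \<phi> (Suc i + Suc j + 2) + h i j / of_nat q" for i j
    unfolding h_def tau_resolvent_Suc by (simp add: hankel_def)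
  have step: "h (m + Suc J) (n + Suc J)
      = \<phi> (m + n + 2 * Suc J) - \<phi> (m + n + 2 * Suc (Suc J)) + h (m + J) (n + J) / of_nat q" for J
  proof -
    have "Suc (m + J) + Suc (n + J) = m + n + 2 * Suc J" "m + n + 2 * Suc J + 2 = m + n + 2 * Suc (Suc J)"
      by simp_all
    then have "h (Suc (m + J)) (Suc (n + J))
        = \<phi> (m + n + 2 * Suc J) - \<phi> (m + n + 2 * Suc (Suc J)) + h (m + J) (n + J) / of_nat q"
      using hs[of "m + J" "n + J"] by (simp only:)
    then show ?thesis unfolding add_Suc_right .
  qed
  have h0: "h i j = \<phi> (i + j) - \<phi> (i + j + 2)" if "i = 0 \<or> j = 0" for i j
    unfolding h_def tau_resolvent_0[OF that] by (simp add: hankel_def)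
  have "(\<Sum>k<K. \<Sum>l<K. h k l * gram ((c ^^ k) x) ((c ^^ l) y))
      = (\<Sum>k<K. \<Sum>l<K. if (c ^^ k) x = (c ^^ l) y then h k l else 0)
        - (\<Sum>k<K. \<Sum>l<K. if (c ^^ k) (c x) = (c ^^ l) (c y) then h k l / of_nat q else 0)"
    by (simp add: sum_subtractf[symmetric] gram_def funpow_swap1) (intro sum.cong refl, simp add: algebra_simps)
  also have "(\<Sum>k<K. \<Sum>l<K. if (c ^^ k) x = (c ^^ l) y then h k l else 0) = (\<Sum>j<Suc J. h (m + j) (n + j))"
    by (rule sum_first_meet[OF mn K])
  also have "(\<Sum>j<Suc J. h (m + j) (n + j))
      - (\<Sum>k<K. \<Sum>l<K. if (c ^^ k) (c x) = (c ^^ l) (c y) then h k l / of_nat q else 0)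
      = \<phi> (m + n) - \<phi> (m + n + 2 * Suc J) - h (m + J) (n + J) / of_nat q"
  proof (cases "m = 0 \<or> n = 0")
    case True
    have "first_meet c (c x) (c y) m n"
      using mn True by (auto simp: first_meet_def simp flip: funpow_swap1)
    from sum_first_meet[OF this K, of "\<lambda>k l. h k l / of_nat q"]
    have e: "(\<Sum>k<K. \<Sum>l<K. if (c ^^ k) (c x) = (c ^^ l) (c y) then h k l / of_nat q else 0)
        = (\<Sum>j<Suc J. h (m + j) (n + j) / of_nat q)" .
    show ?thesis unfolding e
    proof (induction J)
      case 0
      show ?case using h0[OF True] by simp
    next
      case (Suc J)
      show ?case
        unfolding sum.lessThan_Suc[of _ "Suc J"] add_diff_add Suc.IH unfolding step[of J] by simp
    qed
  next
    case False
    then obtain m' n' where m': "m = Suc m'" "n = Suc n'" using not0_implies_Suc[of m] not0_implies_Suc[of n] by blast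
    have "first_meet c (c x) (c y) m' n'"
      using mn unfolding first_meet_def m' by (cases m'; cases n') (auto simp: funpow_swap1)
    moreover have "K = max m' n' + Suc (Suc J)" using K m' by simp
    ultimately have e: "(\<Sum>k<K. \<Sum>l<K. if (c ^^ k) (c x) = (c ^^ l) (c y) then h k l / of_nat q else 0)
        = (\<Sum>j<Suc (Suc J). h (m' + j) (n' + j) / of_nat q)"
      by (rule sum_first_meet)
    have shift: "m' + Suc (Suc J) = m + Suc J" "n' + Suc (Suc J) = n + Suc J" for J
      using m' by simp_all
    show ?thesis unfolding e
    proof (induction J)
      case 0
      show ?case using hs[of m' n'] by (simp add: m')
    next
      case (Suc J)
      show ?case
        unfolding sum.lessThan_Suc[of "\<lambda>j. h (m + j) (n + j)" "Suc J"]
          sum.lessThan_Suc[of "\<lambda>j. h (m' + j) (n' + j) / of_nat q" "Suc (Suc J)"] add_diff_add Suc.IH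
          shift unfolding step[of J] by simp
    qed
  qed
  finally show ?thesis .
qed

text \<open>The arguments \<open>m + n\<close> and \<open>m + n + 2 * Suc J\<close> have equal
  parity, so both constants cancel in the telescoped value. The remaining tail of \<psi> and the
  resolvent entry on the diagonal tend to 0.\<close>

lemma gram_pairing_tendsto:
  fixes \<phi> :: "nat \<Rightarrow> complex"
  assumes dec: "pm_decomp \<phi> cp cm \<psi>"
    and M: "\<And>t. t \<in> trace_norm_set (tau_resolvent q (hankel \<phi>)) \<Longrightarrow> t \<le> M"
  shows "(\<lambda>K. \<Sum>k<K. \<Sum>l<K. tau_resolvent q (hankel \<phi>) k l * gram ((c ^^ k) x) ((c ^^ l) y)) \<longlonglongrightarrow> \<psi> (d x y)"
proof -
  let ?h = "tau_resolvent q (hankel \<phi>)"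
  let ?S = "\<lambda>K. \<Sum>k<K. \<Sum>l<K. ?h k l * gram ((c ^^ k) x) ((c ^^ l) y)"
  obtain m n where mn: "first_meet c x y m n" using ex_first_meet by blast
  have \<phi>: "\<phi> N = cp + cm * (-1) ^ N + \<psi> N" and \<psi>: "\<psi> \<longlonglongrightarrow> 0" for N
    using dec by (auto simp: pm_decomp_def)
  have sm: "strict_mono (\<lambda>J. m + n + 2 * Suc J)" by (rule strict_monoI) simp
  have "(\<lambda>J. \<psi> (m + n) - \<psi> (m + n + 2 * Suc J) - ?h (m + J) (n + J) / of_nat q) \<longlonglongrightarrow> \<psi> (m + n) - 0 - 0 / of_nat q"
    using LIMSEQ_subseq_LIMSEQ[OF \<psi> sm] trace_norm_diagonal_tendsto_0(1)[OF M]
    by (intro tendsto_intros) (auto simp: o_def q_ge_2)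
  moreover have "?S (J + Suc (max m n)) = \<psi> (m + n) - \<psi> (m + n + 2 * Suc J) - ?h (m + J) (n + J) / of_nat q" for J
    by (subst gram_pairing_telescopes[OF mn, of _ J]) (simp_all add: \<phi> power_add)
  ultimately have "(\<lambda>J. ?S (J + Suc (max m n))) \<longlonglongrightarrow> \<psi> (d x y)"
    by (simp add: dist_first_meet[OF mn])
  then show ?thesis by (rule LIMSEQ_offset)
qed

text \<open>By \<open>gram_form_bounded\<close> the matrix \<open>?C\<close> divided by
  \<open>1 - 1 / q\<close> is a contraction on every initial segment, so its pairing with the
  resolvent is at most \<open>M\<close>. As \<open>F\<close> is finite, entrywise convergence of the
  kernels suffices to let the cutoff grow.\<close>

lemma psi_form_le:
  fixes \<phi> :: "nat \<Rightarrow> complex"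
  assumes dec: "pm_decomp \<phi> cp cm \<psi>"
    and M: "\<And>t. t \<in> trace_norm_set (tau_resolvent q (hankel \<phi>)) \<Longrightarrow> t \<le> M"
    and A: "form_bounded F A 1" and F: "finite F" and u: "sqnorm_on F u \<le> 1" and v: "sqnorm_on F v \<le> 1"
  shows "cmod (form F (\<lambda>x y. \<psi> (d x y) * A x y) u v) \<le> (1 - 1 / real q) * M"
proof -
  let ?h = "tau_resolvent q (hankel \<phi>)"
  define r where "r = 1 - 1 / real q"
  have r: "0 < r" using q_ge_2 by (simp add: r_def)
  let ?C = "\<lambda>k l. form F (\<lambda>x y. gram ((c ^^ k) x) ((c ^^ l) y) * A x y) u v"
  have swap: "(\<Sum>k<K. \<Sum>l<K. ?h k l * ?C k l)
      = form F (\<lambda>x y. (\<Sum>k<K. \<Sum>l<K. ?h k l * gram ((c ^^ k) x) ((c ^^ l) y)) * A x y) u v" for K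
  proof -
    let ?t = "\<lambda>x y k l. cnj (u x) * (?h k l * gram ((c ^^ k) x) ((c ^^ l) y) * A x y) * v y"
    have "(\<Sum>k<K. \<Sum>l<K. ?h k l * ?C k l) = (\<Sum>k<K. \<Sum>l<K. \<Sum>x\<in>F. \<Sum>y\<in>F. ?t x y k l)"
      unfolding form_def sum_distrib_left by (simp add: mult_ac)
    also have "\<dots> = (\<Sum>k<K. \<Sum>x\<in>F. \<Sum>l<K. \<Sum>y\<in>F. ?t x y k l)"
      by (intro sum.cong refl sum.swap)
    also have "\<dots> = (\<Sum>x\<in>F. \<Sum>k<K. \<Sum>y\<in>F. \<Sum>l<K. ?t x y k l)"
      by (subst sum.swap) (intro sum.cong refl sum.swap)
    also have "\<dots> = (\<Sum>x\<in>F. \<Sum>y\<in>F. \<Sum>k<K. \<Sum>l<K. ?t x y k l)"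
      by (intro sum.cong refl sum.swap)
    finally show ?thesis unfolding form_def sum_distrib_left sum_distrib_right .
  qed
  have bound: "cmod (\<Sum>k<K. \<Sum>l<K. ?h k l * ?C k l) \<le> r * M" for K
  proof -
    have "form_bounded {..<K} (\<lambda>k l. ?C k l / of_real r) 1"
      unfolding form_bounded_def
    proof (intro allI)
      fix a b
      have "form {..<K} (\<lambda>k l. ?C k l / of_real r) a b = form {..<K} ?C a b / of_real r"
        unfolding form_def[of "{..<K}"] by (simp add: sum_divide_distrib)
      then have "cmod (form {..<K} (\<lambda>k l. ?C k l / of_real r) a b) = cmod (form {..<K} ?C a b) / r"
        using r by (simp only: norm_divide norm_of_real abs_of_pos)
      also have "\<dots> \<le> (r * (sqnorm_on {..<K} a + sqnorm_on {..<K} b) / 2) / r"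
        using gram_form_bounded[OF A F u v, of K, folded r_def] r unfolding form_bounded_def
        by (intro divide_right_mono) auto
      finally show "cmod (form {..<K} (\<lambda>k l. ?C k l / of_real r) a b) \<le> 1 * (sqnorm_on {..<K} a + sqnorm_on {..<K} b) / 2"
        using r by simp
    qed
    from trace_norm_pairing_le[OF M this]
    have "cmod ((\<Sum>k<K. \<Sum>l<K. ?h k l * ?C k l) / of_real r) \<le> M"
      by (simp add: sum_divide_distrib)
    then have "cmod (\<Sum>k<K. \<Sum>l<K. ?h k l * ?C k l) / r \<le> M"
      using r by (simp only: norm_divide norm_of_real abs_of_pos)
    then show ?thesis using r by (simp only: pos_divide_le_eq mult.commute)
  qed
  have "(\<lambda>K. form F (\<lambda>x y. (\<Sum>k<K. \<Sum>l<K. ?h k l * gram ((c ^^ k) x) ((c ^^ l) y)) * A x y) u v)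
      \<longlonglongrightarrow> form F (\<lambda>x y. \<psi> (d x y) * A x y) u v"
    unfolding form_def by (intro tendsto_intros gram_pairing_tendsto[OF dec M])
  then have "(\<lambda>K. cmod (\<Sum>k<K. \<Sum>l<K. ?h k l * ?C k l)) \<longlonglongrightarrow> cmod (form F (\<lambda>x y. \<psi> (d x y) * A x y) u v)"
    unfolding swap by (rule tendsto_norm)
  then show ?thesis unfolding r_def[symmetric] by (rule tendsto_upperbound) (auto simp: bound)
qed

text \<open>The alternating part is the form of \<open>A\<close> itself at vectors whose signs are
  changed by \<open>parity\<close>, which preserves their norms.\<close>

lemma schur_form_bounded:
  fixes \<phi> :: "nat \<Rightarrow> complex"
  assumes dec: "pm_decomp \<phi> cp cm \<psi>"
    and M: "\<And>t. t \<in> trace_norm_set (tau_resolvent q (hankel \<phi>)) \<Longrightarrow> t \<le> M" and M0: "0 \<le> M"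
    and A: "form_bounded F A 1" and F: "finite F"
  shows "form_bounded F (\<lambda>x y. \<phi> (d x y) * A x y) (cmod cp + cmod cm + (1 - 1 / real q) * M)"
proof (rule form_bounded_if_unit[OF F])
  have r: "0 \<le> 1 - 1 / real q" using q_ge_2 by simp
  show "0 \<le> cmod cp + cmod cm + (1 - 1 / real q) * M"
    by (intro add_nonneg_nonneg mult_nonneg_nonneg r M0) auto
  fix u v assume u: "sqnorm_on F u \<le> 1" and v: "sqnorm_on F v \<le> 1"
  have unit: "cmod (form F A a b) \<le> 1" if "sqnorm_on F a \<le> 1" "sqnorm_on F b \<le> 1" for a b
  proof -
    have "cmod (form F A a b) \<le> 1 * (sqnorm_on F a + sqnorm_on F b) / 2"
      using A by (simp only: form_bounded_def)
    then show ?thesis using that by simp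
  qed
  let ?e = "\<lambda>w x. parity x * w x"
  have par: "cnj (parity x) = parity x" "cmod (parity x * z) = cmod z" for x z
    by (simp_all add: parity_def)
  have e: "sqnorm_on F (?e w) = sqnorm_on F w" for w by (simp add: sqnorm_on_def par)
  have eq: "form F (\<lambda>x y. \<phi> (d x y) * A x y) u v
      = cp * form F A u v + cm * form F A (?e u) (?e v) + form F (\<lambda>x y. \<psi> (d x y) * A x y) u v"
  proof -
    have "\<phi> (d x y) = cp + cm * (parity x * parity y) + \<psi> (d x y)" for x y
      using dec by (simp add: pm_decomp_def parity_dist[symmetric])
    then have "cnj (u x) * (\<phi> (d x y) * A x y) * v y
        = cp * (cnj (u x) * A x y * v y) + cm * (cnj (?e u x) * A x y * ?e v y) + cnj (u x) * (\<psi> (d x y) * A x y) * v y" for x y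
      by (simp only: complex_cnj_mult par) (simp add: algebra_simps)
    then show ?thesis
      by (simp only: form_def sum_distrib_left sum.distrib)
  qed
  have "cmod (cp * form F A u v + cm * form F A (?e u) (?e v) + form F (\<lambda>x y. \<psi> (d x y) * A x y) u v)
      \<le> cmod cp * cmod (form F A u v) + cmod cm * cmod (form F A (?e u) (?e v))
      + cmod (form F (\<lambda>x y. \<psi> (d x y) * A x y) u v)"
    by (rule order_trans[OF norm_triangle_ineq], rule add_right_mono, rule order_trans[OF norm_triangle_ineq])
      (simp add: norm_mult)
  also have "\<dots> \<le> cmod cp * 1 + cmod cm * 1 + (1 - 1 / real q) * M"
  proof (intro add_mono)
    show "cmod cp * cmod (form F A u v) \<le> cmod cp * 1"
      by (rule mult_left_mono[OF unit[OF u v]]) simp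
    show "cmod cm * cmod (form F A (?e u) (?e v)) \<le> cmod cm * 1"
      by (rule mult_left_mono[OF unit]) (simp_all only: e u v norm_ge_zero)
    show "cmod (form F (\<lambda>x y. \<psi> (d x y) * A x y) u v) \<le> (1 - 1 / real q) * M"
      by (rule psi_form_le[OF dec M A F u v])
  qed
  finally show "cmod (form F (\<lambda>x y. \<phi> (d x y) * A x y) u v) \<le> cmod cp + cmod cm + (1 - 1 / real q) * M"
    unfolding eq by simp
qed

end

section \<open>The lower bound for the Schur norm\<close>

lemma form_add: "form F (\<lambda>x y. A x y + B x y) u v = form F A u v + form F B u v"
  using form_add_scaled[of F A 1 B u v] by simp

lemma form_cmult: "form F (\<lambda>x y. a * A x y) u v = a * form F A u v"
  by (simp add: form_def sum_distrib_left mult_ac)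

lemma form_diff: "form F (\<lambda>x y. A x y - B x y) u v = form F A u v - form F B u v"
  using form_add_scaled[of F A "-1" B u v] by simp

lemma form_sum: "finite I \<Longrightarrow> form F (\<lambda>x y. \<Sum>i\<in>I. A i x y) u v = (\<Sum>i\<in>I. form F (A i) u v)"
  by (induction I rule: finite_induct) (simp_all add: form_add, simp add: form_def)

lemma sum_telescope_lessThan: "(\<Sum>i<N. f i - f (Suc i)) = f 0 - (f N :: real)"
  by (induction N) simp_all

context horocyclic_tree
begin

text \<open>The matrix of \<open>pull\<^sup>m push\<^sup>n\<close>.\<close>

definition shift_kernel :: "nat \<Rightarrow> nat \<Rightarrow> 'v \<Rightarrow> 'v \<Rightarrow> complex" where
  "shift_kernel m n x y = (if (c ^^ m) x = (c ^^ n) y then rq ^ (m + n) else 0)"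

lemma push_scale: "push (\<lambda>x. a * \<xi> x) = (\<lambda>v. a * push \<xi> v)"
  by (simp add: push_def[abs_def] sum_distrib_left mult_ac)

lemma push_funpow_mass: "(push ^^ n) (mass I a g) = (\<lambda>v. rq ^ n * mass I a (\<lambda>i. (c ^^ n) (g i)) v)"
proof (induction n)
  case (Suc n)
  have "(push ^^ Suc n) (mass I a g) = push (\<lambda>v. rq ^ n * mass I a (\<lambda>i. (c ^^ n) (g i)) v)"
    by (simp add: Suc.IH)
  then show ?case unfolding push_scale push_mass by (simp add: mult_ac)
qed simp

lemma fin_supp_push_funpow: "fin_supp \<xi> \<Longrightarrow> fin_supp ((push ^^ n) \<xi>)"
  by (induction n) (simp_all add: fin_supp_push)

lemma form_shift_kernel:
  assumes "finite F"
  shows "form F (shift_kernel m n) u v = ip ((push ^^ m) (mass F u id)) ((push ^^ n) (mass F v id))"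
proof -
  have "cnj (rq ^ m) = rq ^ m" by simp
  then show ?thesis
    unfolding push_funpow_mass ip_scale_left ip_scale_right ip_mass[OF assms] form_def sum_distrib_left
    by (intro sum.cong refl) (simp add: shift_kernel_def power_add mult_ac)
qed

lemma sqn_mass_id: "finite F \<Longrightarrow> sqn (mass F u id) = sqnorm_on F u"
  by (subst sqn_eq_sum[of F]) (auto simp: mass_def sqnorm_on_def)

text \<open>The left-hand side comes from the operator \<open>a (I + X) / 2 + b (I - X) / 2\<close> with
  \<open>X = (push + pull) / 2\<close>, a combination of two positive operators of sum \<open>I\<close>.\<close>

lemma tail_bound:
  assumes "fin_supp \<xi>" "fin_supp \<eta>" and a: "cmod a \<le> 1" and b: "cmod b \<le> 1"
  shows "cmod ((a + b) / 2 * ip \<xi> \<eta> + (a - b) / 4 * (ip (push \<xi>) \<eta> + ip \<xi> (push \<eta>))) \<le> (sqn \<xi> + sqn \<eta>) / 2"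
proof -
  let ?p = "\<lambda>\<zeta> x. \<zeta> x + push \<zeta> x" and ?m = "\<lambda>\<zeta> x. \<zeta> x - push \<zeta> x"
  have fs: "fin_supp (push \<xi>)" "fin_supp (push \<eta>)" using assms by (simp_all add: fin_supp_push)
  have P: "ip (?p \<xi>) (?p \<eta>) = ip \<xi> \<eta> + ip \<xi> (push \<eta>) + ip (push \<xi>) \<eta> + ip (push \<xi>) (push \<eta>)"
    and Q: "ip (?m \<xi>) (?m \<eta>) = ip \<xi> \<eta> - ip \<xi> (push \<eta>) - ip (push \<xi>) \<eta> + ip (push \<xi>) (push \<eta>)"
    using assms fs by (simp_all add: ip_add_left ip_add_right ip_diff_left ip_diff_right)
  have sq: "sqn (?p \<zeta>) + sqn (?m \<zeta>) = 2 * sqn \<zeta> + 2 * sqn (push \<zeta>)" if "fin_supp \<zeta>" for \<zeta>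
    unfolding sqn_def using that fin_supp_push[OF that]
    by (simp add: ip_add_left ip_add_right ip_diff_left ip_diff_right)
  \<comment> \<open>In operators, I + X is half the sum of (I + V)(I + V') and I - V V', where V' is
    the adjoint of V; I - X has the same form with -V. All terms are squares, so
    \<open>ip_bound\<close> applies to each.\<close>
  have eq: "(a + b) / 2 * ip \<xi> \<eta> + (a - b) / 4 * (ip (push \<xi>) \<eta> + ip \<xi> (push \<eta>))
      = (a * (ip (?p \<xi>) (?p \<eta>) + ip (defect \<xi>) (defect \<eta>))
        + b * (ip (?m \<xi>) (?m \<eta>) + ip (defect \<xi>) (defect \<eta>))) / 4"
    unfolding P Q ip_defect[OF assms(1,2)] by (simp add: field_simps)
  have le: "cmod (e * z) \<le> cmod z" if "cmod e \<le> 1" for e z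
    using mult_right_mono[OF that, of "cmod z"] by (simp add: norm_mult)
  let ?D = "ip (defect \<xi>) (defect \<eta>)"
  have "cmod (a * (ip (?p \<xi>) (?p \<eta>) + ?D) + b * (ip (?m \<xi>) (?m \<eta>) + ?D))
      \<le> cmod (ip (?p \<xi>) (?p \<eta>) + ?D) + cmod (ip (?m \<xi>) (?m \<eta>) + ?D)"
    by (rule order_trans[OF norm_triangle_ineq add_mono[OF le[OF a] le[OF b]]])
  also have "\<dots> \<le> (cmod (ip (?p \<xi>) (?p \<eta>)) + cmod ?D) + (cmod (ip (?m \<xi>) (?m \<eta>)) + cmod ?D)"
    by (rule add_mono[OF norm_triangle_ineq norm_triangle_ineq])
  also have "\<dots> \<le> ((sqn (?p \<xi>) + sqn (?p \<eta>)) / 2 + (sqn (defect \<xi>) + sqn (defect \<eta>)) / 2)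
      + ((sqn (?m \<xi>) + sqn (?m \<eta>)) / 2 + (sqn (defect \<xi>) + sqn (defect \<eta>)) / 2)"
  proof -
    have "cmod (ip (?p \<xi>) (?p \<eta>)) \<le> (sqn (?p \<xi>) + sqn (?p \<eta>)) / 2"
      "cmod (ip (?m \<xi>) (?m \<eta>)) \<le> (sqn (?m \<xi>) + sqn (?m \<eta>)) / 2"
      "cmod ?D \<le> (sqn (defect \<xi>) + sqn (defect \<eta>)) / 2"
      using assms fs by (intro ip_bound fin_supp_add fin_supp_diff fin_supp_defect; simp)+
    then show ?thesis by linarith
  qed
  also have "\<dots> = 4 * ((sqn \<xi> + sqn \<eta>) / 2)"
    using sq[OF assms(1)] sq[OF assms(2)] by (simp add: sqn_defect assms(1,2) field_simps)
  finally show ?thesis unfolding eq norm_divide by simp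
qed

text \<open>The double sum lives on the first \<open>N\<close> Wold components. The remaining terms
  conjugate a (I + X)/2 + b (I - X)/2 by V^N, where X is half the sum of \<open>push\<close> and
  \<open>pull\<close>, and live on the range of V^N.\<close>

definition test_matrix :: "nat \<Rightarrow> (nat \<Rightarrow> nat \<Rightarrow> complex) \<Rightarrow> complex \<Rightarrow> complex \<Rightarrow> 'v \<Rightarrow> 'v \<Rightarrow> complex" where
  "test_matrix N B a b x y =
     (\<Sum>i<N. \<Sum>j<N. B i j * (shift_kernel i j x y - shift_kernel (Suc i) (Suc j) x y))
     + ((a + b) / 2 * shift_kernel N N x y
     + (a - b) / 4 * (shift_kernel (Suc N) N x y + shift_kernel N (Suc N) x y))"

text \<open>Kept for a general \<psi>: the constant 1 gives the test matrix itself for the proof of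
  contractivity, and the radial kernel gives its image under the multiplier.\<close>

lemma form_schur_test_matrix:
  "form F (\<lambda>x y. \<psi> x y * test_matrix N B a b x y) u v =
     (\<Sum>i<N. \<Sum>j<N. B i j * (form F (\<lambda>x y. \<psi> x y * shift_kernel i j x y) u v
        - form F (\<lambda>x y. \<psi> x y * shift_kernel (Suc i) (Suc j) x y) u v))
     + ((a + b) / 2 * form F (\<lambda>x y. \<psi> x y * shift_kernel N N x y) u v
     + (a - b) / 4 * (form F (\<lambda>x y. \<psi> x y * shift_kernel (Suc N) N x y) u v
        + form F (\<lambda>x y. \<psi> x y * shift_kernel N (Suc N) x y) u v))"
proof -
  have "\<psi> x y * test_matrix N B a b x y =
     (\<Sum>i<N. \<Sum>j<N. B i j * (\<psi> x y * shift_kernel i j x y - \<psi> x y * shift_kernel (Suc i) (Suc j) x y))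
     + ((a + b) / 2 * (\<psi> x y * shift_kernel N N x y)
     + (a - b) / 4 * (\<psi> x y * shift_kernel (Suc N) N x y + \<psi> x y * shift_kernel N (Suc N) x y))" for x y
    unfolding test_matrix_def distrib_left[of "\<psi> x y"] sum_distrib_left right_diff_distrib
    by (simp add: algebra_simps)
  then show ?thesis
    by (simp only: form_add form_cmult form_diff form_sum finite_lessThan)
qed

text \<open>By telescoping, the squared norm of a vector is the sum of its first \<open>N\<close>
  Wold components and of the remainder \<open>X N\<close>. The matrix \<open>B\<close> acts
  contractively between the components, \<open>tail_bound\<close> controls the remainder, and the
  two mean bounds add up to the full norms.\<close>

lemma test_matrix_contraction:
  assumes B: "form_bounded {..<N} B 1" and a: "cmod a \<le> 1" and b: "cmod b \<le> 1"
  shows "contraction (test_matrix N B a b)"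
  unfolding contraction_def form_bounded_def
proof (intro allI impI)
  fix F :: "'v set" and u v assume F: "finite F"
  define X where "X i = (push ^^ i) (mass F u id)" for i
  define Y where "Y i = (push ^^ i) (mass F v id)" for i
  have fs: "fin_supp (X i)" "fin_supp (Y i)" for i
    unfolding X_def Y_def by (intro fin_supp_push_funpow fin_supp_mass F)+
  have push: "X (Suc i) = push (X i)" "Y (Suc i) = push (Y i)" for i by (simp_all add: X_def Y_def)
  have K: "form F (\<lambda>x y. 1 * shift_kernel m n x y) u v = ip (X m) (Y n)" for m n
    using form_shift_kernel[OF F, of m n u v] by (simp add: X_def Y_def)
  let ?T = "(a + b) / 2 * ip (X N) (Y N) + (a - b) / 4 * (ip (push (X N)) (Y N) + ip (X N) (push (Y N)))"
  let ?S = "\<Sum>i<N. \<Sum>j<N. B i j * ip (defect (X i)) (defect (Y j))"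
  have eq: "form F (test_matrix N B a b) u v = ?S + ?T"
    using form_schur_test_matrix[of F "\<lambda>x y. 1" N B a b u v]
    unfolding K by (simp add: push ip_defect fs)
  have tel: "(\<Sum>i<N. sqn (defect (X i))) = sqn (X 0) - sqn (X N)"
      "(\<Sum>i<N. sqn (defect (Y i))) = sqn (Y 0) - sqn (Y N)"
    unfolding sqn_defect[OF fs(1)] sqn_defect[OF fs(2)] push[symmetric] by (rule sum_telescope_lessThan)+
  have "cmod ?S \<le> ((\<Sum>i<N. sqn (defect (X i))) + (\<Sum>i<N. sqn (defect (Y i)))) / 2"
    by (intro contraction_on_vectors B fin_supp_defect fs finite_lessThan)
  moreover have "cmod ?T \<le> (sqn (X N) + sqn (Y N)) / 2" by (rule tail_bound[OF fs a b])
  moreover have "cmod (?S + ?T) \<le> cmod ?S + cmod ?T" by (rule norm_triangle_ineq)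
  ultimately have "cmod (?S + ?T) \<le> (sqn (X 0) + sqn (Y 0)) / 2"
    unfolding tel by argo
  then show "cmod (form F (test_matrix N B a b) u v) \<le> 1 * (sqnorm_on F u + sqnorm_on F v) / 2"
    unfolding eq by (simp add: X_def Y_def sqn_mass_id[OF F])
qed

subsection \<open>Test vectors\<close>

text \<open>\<open>level l\<close> is the normalised indicator of the \<open>l\<close>-th generation below an arbitrarily chosen
  vertex \<open>root\<close>.\<close>

definition root :: 'v where "root = undefined"

definition level :: "nat \<Rightarrow> 'v \<Rightarrow> complex" where
  "level l = (pull ^^ l) (\<lambda>x. if x = root then 1 else 0)"

definition levels :: "nat set \<Rightarrow> 'v \<Rightarrow> complex" where
  "levels I x = (\<Sum>l\<in>I. level l x)"

lemma level_eq: "level l x = (if (c ^^ l) x = root then rq ^ l else 0)"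
  unfolding level_def by (induction l arbitrary: x) (auto simp: pull_def funpow_swap1[of c])

lemma push_level: "push (level (Suc l)) = level l"
  by (simp add: level_def push_pull)

lemma fin_supp_level: "fin_supp (level l)"
proof (induction l)
  case 0
  show ?case by (rule fin_suppI[of "{root}"]) (auto simp: level_def)
next
  case (Suc l)
  then show ?case by (simp add: level_def fin_supp_pull)
qed

lemma ip_level: "ip (level k) (level l) = (if k = l then 1 else 0)"
proof (cases "k = l")
  case True
  have "ip (level l) (level l) = 1"
  proof (induction l)
    case 0
    show ?case by (subst ip_eq_sum[of "{root}"]) (auto simp: level_eq)
  next
    case (Suc l)
    have "ip (level (Suc l)) (level (Suc l)) = ip (push (level (Suc l))) (level l)"
      by (simp add: ip_push fin_supp_level) (simp add: level_def)
    then show ?case by (simp add: push_level Suc.IH)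
  qed
  then show ?thesis using True by simp
next
  case False
  have "cnj (level k x) * level l x = 0" for x
  proof (rule ccontr)
    assume "cnj (level k x) * level l x \<noteq> 0"
    then have "(c ^^ k) x = (c ^^ l) x" by (auto simp: level_eq split: if_splits)
    then show False using False by (simp add: funpow_inj)
  qed
  then have "ip (level k) (level l) = 0" unfolding ip_def by (intro sum.neutral ballI)
  then show ?thesis using False by simp
qed

lemma fin_supp_levels: "finite I \<Longrightarrow> fin_supp (levels I)"
  by (rule fin_suppI[of "\<Union>l\<in>I. {x. level l x \<noteq> 0}"])
    (auto simp: levels_def fin_supp_level[unfolded fin_supp_def] intro!: sum.neutral)

lemma ip_sum_right: "ip \<xi> (\<lambda>x. \<Sum>i\<in>I. f i x) = (\<Sum>i\<in>I. ip \<xi> (f i))"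
  unfolding ip_def sum_distrib_left by (rule sum.swap)

lemma ip_levels:
  assumes "finite I" "finite J"
  shows "ip (levels I) (levels J) = of_nat (card (I \<inter> J))"
proof -
  have l: "ip (levels I) (level j) = (if j \<in> I then 1 else 0)" for j
  proof -
    have "ip (levels I) (level j) = cnj (ip (level j) (levels I))"
      using assms by (intro ip_commute fin_supp_levels fin_supp_level)
    also have "ip (level j) (levels I) = (\<Sum>i\<in>I. if j = i then 1 else 0)"
      unfolding levels_def[abs_def] ip_sum_right ip_level ..
    finally show ?thesis using assms by simp
  qed
  have "ip (levels I) (levels J) = (\<Sum>j\<in>J. if j \<in> I then 1 else 0)"
    unfolding levels_def[of J, abs_def] ip_sum_right l ..
  also have "\<dots> = of_nat (card (I \<inter> J))"
    using assms by (simp add: sum.If_cases Int_commute Int_def)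
  finally show ?thesis .
qed

lemma push_levels: "push (levels {Suc a..<Suc b}) = levels {a..<b}"
proof
  fix v
  have "push (levels {Suc a..<Suc b}) v = (\<Sum>l\<in>{Suc a..<Suc b}. push (level l) v)"
    unfolding push_def levels_def sum_distrib_left by (rule sum.swap)
  also have "\<dots> = levels {a..<b} v"
    unfolding sum.shift_bounds_Suc_ivl push_level levels_def ..
  finally show "push (levels {Suc a..<Suc b}) v = levels {a..<b} v" .
qed

lemma push_funpow_levels: "m \<le> a \<Longrightarrow> a \<le> b \<Longrightarrow> (push ^^ m) (levels {a..<b}) = levels {a - m..<b - m}"
proof (induction m)
  case (Suc m)
  then have "a - m = Suc (a - Suc m)" "b - m = Suc (b - Suc m)" by auto
  then show ?case using Suc push_levels[of "a - Suc m" "b - Suc m"] by simp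
qed simp

text \<open>A block of \<open>D\<close> consecutive generations is almost invariant under
  \<open>push\<close> when \<open>D\<close> is large. Starting at generation \<open>D\<close> keeps
  up to \<open>D\<close> applications of \<open>push\<close> from running past the root.\<close>

definition test_supp :: "nat \<Rightarrow> 'v set" where
  "test_supp D = {x. levels {D..<2*D} x \<noteq> 0}"

abbreviation test_vec :: "nat \<Rightarrow> 'v \<Rightarrow> complex" where
  "test_vec D \<equiv> levels {D..<2*D}"

lemma finite_test_supp: "finite (test_supp D)"
  using fin_supp_levels[of "{D..<2*D}"] by (simp add: test_supp_def fin_supp_def)

lemma mass_test_vec: "mass (test_supp D) (test_vec D) id = test_vec D"
  using finite_test_supp[of D] by (auto simp: mass_def test_supp_def fun_eq_iff)

lemma sqnorm_test_vec: "sqnorm_on (test_supp D) (test_vec D) = real D"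
proof -
  have "of_real (sqn (test_vec D)) = (of_real (real D) :: complex)"
    unfolding ip_self[symmetric] by (simp add: ip_levels)
  then have "sqn (test_vec D) = real D" by (simp only: of_real_eq_iff)
  then show ?thesis using sqn_mass_id[OF finite_test_supp, of D "test_vec D"] by (simp add: mass_test_vec)
qed

section \<open>Limits of the multiplier along the test vectors\<close>

definition test_val :: "(nat \<Rightarrow> complex) \<Rightarrow> nat \<Rightarrow> nat \<Rightarrow> nat \<Rightarrow> complex" where
  "test_val \<phi> m n D = form (test_supp D) (\<lambda>x y. \<phi> (d x y) * shift_kernel m n x y) (test_vec D) (test_vec D) / of_nat D"

definition test_overlap :: "nat \<Rightarrow> nat \<Rightarrow> nat \<Rightarrow> complex" where
  "test_overlap m n D = form (test_supp D) (shift_kernel m n) (test_vec D) (test_vec D) / of_nat D"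

text \<open>Shifting the block of \<open>D\<close> generations by \<open>m\<close> and by
  \<open>n\<close> leaves all but \<open>max m n - min m n\<close> of them in common.\<close>

lemma test_overlap_eq:
  assumes "max m n \<le> D" "0 < D"
  shows "test_overlap m n D = 1 + (of_nat (min m n) - of_nat (max m n)) / of_nat D"
proof -
  have "form (test_supp D) (shift_kernel m n) (test_vec D) (test_vec D)
      = ip (levels {D - m..<2*D - m}) (levels {D - n..<2*D - n})"
    unfolding form_shift_kernel[OF finite_test_supp] mass_test_vec using assms
    by (simp add: push_funpow_levels)
  also have "\<dots> = of_nat (card ({D - m..<2*D - m} \<inter> {D - n..<2*D - n}))"
    by (simp add: ip_levels)
  also have "{D - m..<2*D - m} \<inter> {D - n..<2*D - n} = {D - min m n..<2*D - max m n}"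
    by auto
  also have "(of_nat (card {D - min m n..<2*D - max m n}) :: complex) = of_nat D + (of_nat (min m n) - of_nat (max m n))"
  proof -
    have "card {D - min m n..<2*D - max m n} + max m n = D + min m n" using assms by auto
    then have "(of_nat (card {D - min m n..<2*D - max m n} + max m n) :: complex) = of_nat (D + min m n)" by simp
    then show ?thesis by (simp add: algebra_simps)
  qed
  finally show ?thesis using assms(2) by (simp add: test_overlap_def add_divide_distrib)
qed

lemma test_overlap_tendsto: "test_overlap m n \<longlonglongrightarrow> 1"
proof -
  have "(\<lambda>D. 1 + (of_nat (min m n) - of_nat (max m n)) * inverse (of_nat D) :: complex)
      \<longlonglongrightarrow> 1 + (of_nat (min m n) - of_nat (max m n)) * 0"
    by (intro tendsto_intros lim_inverse_n)
  moreover have "\<forall>\<^sub>F D in sequentially.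
      1 + (of_nat (min m n) - of_nat (max m n)) * inverse (of_nat D) = test_overlap m n D"
    using eventually_ge_at_top[of "Suc (max m n)"]
  proof (rule eventually_mono)
    fix D assume "Suc (max m n) \<le> D"
    then have "max m n \<le> D" "0 < D" by (rule Suc_leD) (use \<open>Suc (max m n) \<le> D\<close> in linarith)
    then show "1 + (of_nat (min m n) - of_nat (max m n)) * inverse (of_nat D) = test_overlap m n D"
      by (simp only: test_overlap_eq divide_inverse)
  qed
  ultimately have "test_overlap m n \<longlonglongrightarrow> 1 + (of_nat (min m n) - of_nat (max m n)) * 0"
    by (rule Lim_transform_eventually)
  then show ?thesis by simp
qed

text \<open>If \<open>m\<close> or \<open>n\<close> is 0, every pair in the support of the shift
  kernel has distance exactly \<open>m + n\<close>, so the multiplier acts as a scalar.\<close>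

lemma test_val_boundary:
  assumes "m = 0 \<or> n = 0"
  shows "test_val \<phi> m n D = \<phi> (m + n) * test_overlap m n D"
proof -
  have "\<phi> (d x y) * shift_kernel m n x y = \<phi> (m + n) * shift_kernel m n x y" for x y
    using dist_eq[of m x n y] assms by (auto simp: shift_kernel_def)
  then show ?thesis by (simp only: test_val_def test_overlap_def form_cmult times_divide_eq_right)
qed

text \<open>Pairs in the support of the new kernel either have not met at \<open>m\<close>,
  \<open>n\<close>, and then their distance is \<open>m + n + 2\<close>, or they have, and then the
  kernel is 1/q times the previous one.\<close>

lemma test_val_Suc:
  "test_val \<phi> (Suc m) (Suc n) D
     = \<phi> (m + n + 2) * (test_overlap (Suc m) (Suc n) D - test_overlap m n D / of_nat q) + test_val \<phi> m n D / of_nat q"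
proof -
  have rq2: "rq ^ (Suc m + Suc n) = (1 / of_nat q) * rq ^ (m + n)"
    by (simp add: rq_mult_self[symmetric] mult_ac)
  have "\<phi> (d x y) * shift_kernel (Suc m) (Suc n) x y
      = \<phi> (m + n + 2) * (shift_kernel (Suc m) (Suc n) x y - (1 / of_nat q) * shift_kernel m n x y)
        + (1 / of_nat q) * (\<phi> (d x y) * shift_kernel m n x y)" for x y
  proof (cases "(c ^^ m) x = (c ^^ n) y")
    case True
    then show ?thesis unfolding shift_kernel_def rq2 by simp
  next
    case False
    then show ?thesis using dist_eq[of "Suc m" x "Suc n" y] by (auto simp: shift_kernel_def)
  qed
  then have "form F (\<lambda>x y. \<phi> (d x y) * shift_kernel (Suc m) (Suc n) x y) u v
      = \<phi> (m + n + 2) * (form F (shift_kernel (Suc m) (Suc n)) u v - (1 / of_nat q) * form F (shift_kernel m n) u v)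
        + (1 / of_nat q) * form F (\<lambda>x y. \<phi> (d x y) * shift_kernel m n x y) u v" for F u v
    by (simp only: form_add form_cmult form_diff)
  then show ?thesis
    unfolding test_val_def test_overlap_def by (simp add: add_divide_distrib diff_divide_distrib right_diff_distrib mult_ac)
qed

text \<open>With overlaps tending to 1, \<open>test_val_Suc\<close> becomes the recursion of the
  resolvent after the shift by \<open>\<phi> (m + n + 2)\<close>. At the border the limit
  \<open>\<phi> (m + n)\<close> is this shift plus the Hankel entry.\<close>

lemma test_val_tendsto:
  "test_val \<phi> m n \<longlonglongrightarrow> \<phi> (m + n + 2) + tau_resolvent q (hankel \<phi>) m n"
proof (induction m arbitrary: n)
  case 0
  have "(\<lambda>D. \<phi> (0 + n) * test_overlap 0 n D) \<longlonglongrightarrow> \<phi> (0 + n) * 1"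
    by (intro tendsto_intros test_overlap_tendsto)
  moreover have "test_val \<phi> 0 n = (\<lambda>D. \<phi> (0 + n) * test_overlap 0 n D)"
    by (rule ext, rule test_val_boundary) simp
  ultimately show ?case by (simp add: tau_resolvent_0 hankel_def)
next
  case (Suc m)
  show ?case
  proof (cases n)
    case 0
    have "(\<lambda>D. \<phi> (Suc m + 0) * test_overlap (Suc m) 0 D) \<longlonglongrightarrow> \<phi> (Suc m + 0) * 1"
      by (intro tendsto_intros test_overlap_tendsto)
    moreover have "test_val \<phi> (Suc m) 0 = (\<lambda>D. \<phi> (Suc m + 0) * test_overlap (Suc m) 0 D)"
      by (rule ext, rule test_val_boundary) simp
    ultimately show ?thesis using 0 by (simp add: tau_resolvent_0 hankel_def)
  next
    case n: (Suc n')
    have "(\<lambda>D. \<phi> (m + n' + 2) * (test_overlap (Suc m) (Suc n') D - test_overlap m n' D / of_nat q)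
        + test_val \<phi> m n' D / of_nat q)
      \<longlonglongrightarrow> \<phi> (m + n' + 2) * (1 - 1 / of_nat q) + (\<phi> (m + n' + 2) + tau_resolvent q (hankel \<phi>) m n') / of_nat q"
      using q_ge_2 by (intro tendsto_intros test_overlap_tendsto Suc.IH) auto
    moreover have "\<phi> (m + n' + 2) * (1 - 1 / of_nat q) + (\<phi> (m + n' + 2) + tau_resolvent q (hankel \<phi>) m n') / of_nat q
        = \<phi> (Suc m + n + 2) + tau_resolvent q (hankel \<phi>) (Suc m) n"
      unfolding n tau_resolvent_Suc by (simp add: hankel_def algebra_simps add_divide_distrib)
    ultimately show ?thesis
      unfolding n test_val_Suc[abs_def] by simp
  qed
qed

lemma lower_bound:
  fixes \<phi> :: "nat \<Rightarrow> complex"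
  assumes M: "\<And>A F. contraction A \<Longrightarrow> finite F \<Longrightarrow> form_bounded F (\<lambda>x y. \<phi> (d x y) * A x y) M"
    and B: "form_bounded {..<N} B 1" and a: "cmod a \<le> 1" and b: "cmod b \<le> 1"
  defines "h \<equiv> tau_resolvent q (hankel \<phi>)"
  shows "cmod ((1 - 1 / of_nat q) * (\<Sum>i<N. \<Sum>j<N. h i j * B i j)
    + ((a + b) / 2 * (\<phi> (2*N + 2) + h N N) + (a - b) / 4 * (2 * \<phi> (2*N + 3) + h (Suc N) N + h N (Suc N)))) \<le> M"
proof -
  let ?V = "\<lambda>m n. \<phi> (m + n + 2) + h m n"
  define L where "L D = (\<Sum>i<N. \<Sum>j<N. B i j * (test_val \<phi> i j D - test_val \<phi> (Suc i) (Suc j) D))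
     + ((a + b) / 2 * test_val \<phi> N N D
     + (a - b) / 4 * (test_val \<phi> (Suc N) N D + test_val \<phi> N (Suc N) D))" for D
  have lim: "L \<longlonglongrightarrow> (\<Sum>i<N. \<Sum>j<N. B i j * (?V i j - ?V (Suc i) (Suc j)))
     + ((a + b) / 2 * ?V N N + (a - b) / 4 * (?V (Suc N) N + ?V N (Suc N)))"
    unfolding L_def[abs_def] h_def by (intro tendsto_intros test_val_tendsto)
  \<comment> \<open>The test matrix uses differences of consecutive shift kernels on a diagonal; in
    the limit they turn into resolvent entries, and the factor \<open>1 - 1 / q\<close> of the norm
    formula appears.\<close>
  have V_diff: "?V i j - ?V (Suc i) (Suc j) = (1 - 1 / of_nat q) * h i j" for i j
    unfolding h_def tau_resolvent_Suc by (simp add: hankel_def algebra_simps)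
  have e1: "(\<Sum>i<N. \<Sum>j<N. B i j * (?V i j - ?V (Suc i) (Suc j))) = (1 - 1 / of_nat q) * (\<Sum>i<N. \<Sum>j<N. h i j * B i j)"
    unfolding V_diff sum_distrib_left by (simp add: mult_ac)
  have e2: "?V N N = \<phi> (2*N + 2) + h N N" "?V (Suc N) N + ?V N (Suc N) = 2 * \<phi> (2*N + 3) + h (Suc N) N + h N (Suc N)"
  proof -
    have "N + N + 2 = 2*N + 2" "Suc N + N + 2 = 2*N + 3" "N + Suc N + 2 = 2*N + 3" by simp_all
    then show "?V N N = \<phi> (2*N + 2) + h N N" "?V (Suc N) N + ?V N (Suc N) = 2 * \<phi> (2*N + 3) + h (Suc N) N + h N (Suc N)"
      by (simp_all only: mult_2 add_ac)
  qed
  have bound: "cmod (L D) \<le> M" if "0 < D" for D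
  proof -
    let ?F = "test_supp D" and ?w = "test_vec D"
    let ?f = "form ?F (\<lambda>x y. \<phi> (d x y) * test_matrix N B a b x y) ?w ?w"
    have "L D = ?f / of_nat D"
      unfolding form_schur_test_matrix L_def test_val_def
      by (simp only: add_divide_distrib diff_divide_distrib sum_divide_distrib times_divide_eq_right[symmetric])
    moreover have "cmod ?f \<le> M * (sqnorm_on ?F ?w + sqnorm_on ?F ?w) / 2"
      using M[OF test_matrix_contraction[OF B a b] finite_test_supp] by (simp only: form_bounded_def)
    then have "cmod ?f \<le> M * real D" by (simp add: sqnorm_test_vec)
    ultimately show ?thesis using that by (simp add: norm_divide pos_divide_le_eq)
  qed
  have "\<forall>\<^sub>F D in sequentially. cmod (L D) \<le> M"
    using eventually_gt_at_top[of "0::nat"] by (rule eventually_mono) (rule bound)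
  from tendsto_upperbound[OF tendsto_norm[OF lim] this] show ?thesis
    unfolding e1 e2 by simp
qed

end

section \<open>Trace class Hankel matrices\<close>

lemma form_bounded_shift:
  assumes "form_bounded {..<Suc K} C M"
  shows "form_bounded {..<K} (\<lambda>i j. C (Suc i) (Suc j)) M"
  unfolding form_bounded_def
proof (intro allI)
  fix u v :: "nat \<Rightarrow> complex"
  let ?s = "\<lambda>(w :: nat \<Rightarrow> complex) i. if i = 0 then 0 else w (i - 1)"
  have "form {..<Suc K} C (?s u) (?s v) = form {..<K} (\<lambda>i j. C (Suc i) (Suc j)) u v"
    unfolding form_def sum.lessThan_Suc_shift by simp
  moreover have "sqnorm_on {..<Suc K} (?s w) = sqnorm_on {..<K} w" for w
    unfolding sqnorm_on_def sum.lessThan_Suc_shift by simp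
  ultimately show "cmod (form {..<K} (\<lambda>i j. C (Suc i) (Suc j)) u v) \<le> M * (sqnorm_on {..<K} u + sqnorm_on {..<K} v) / 2"
    using assms[unfolded form_bounded_def, rule_format, of "?s u" "?s v"] by (simp only:)
qed

text \<open>The resolvent equation in dual form: moving \<tau> onto the contraction removes its
  first row and column.\<close>

lemma resolvent_pairing_Suc:
  "(\<Sum>i<Suc K. \<Sum>j<Suc K. tau_resolvent q A i j * C i j)
     = (\<Sum>i<Suc K. \<Sum>j<Suc K. A i j * C i j)
       + (\<Sum>i<K. \<Sum>j<K. tau_resolvent q A i j * C (Suc i) (Suc j)) / of_nat q"
proof -
  have 0: "tau_resolvent q A 0 j = A 0 j" "tau_resolvent q A i 0 = A i 0" for i j
    by (simp_all add: tau_resolvent_0)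
  show ?thesis
    unfolding sum.lessThan_Suc_shift 0 tau_resolvent_Suc
    by (simp add: distrib_right sum.distrib sum_divide_distrib)
qed

text \<open>The geometric series in dual form, by induction on the size: the bound s = M / (1 - 1/q)
  is the solution of s = M + s/q.\<close>

lemma trace_norm_set_resolvent_le:
  assumes q: "2 \<le> q" and A: "\<And>t. t \<in> trace_norm_set A \<Longrightarrow> t \<le> M" and t: "t \<in> trace_norm_set (tau_resolvent q A)"
  shows "t \<le> M / (1 - 1 / real q)"
proof (rule trace_norm_set_le_of_pairing[OF _ t])
  fix K and C :: "nat \<Rightarrow> nat \<Rightarrow> complex"
  have r: "0 < 1 - 1 / real q" using q by simp
  have M0: "0 \<le> M" using trace_norm_diagonal_le[of A M 0 0 0, OF A] by simp
  show "form_bounded {..<K} C 1 \<Longrightarrow> cmod (\<Sum>i<K. \<Sum>j<K. tau_resolvent q A i j * C i j) \<le> M / (1 - 1 / real q)"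
  proof (induction K arbitrary: C)
    case 0
    then show ?case using M0 r by simp
  next
    case (Suc K)
    have "cmod (\<Sum>i<Suc K. \<Sum>j<Suc K. tau_resolvent q A i j * C i j)
        \<le> cmod (\<Sum>i<Suc K. \<Sum>j<Suc K. A i j * C i j)
          + cmod (\<Sum>i<K. \<Sum>j<K. tau_resolvent q A i j * C (Suc i) (Suc j)) / real q"
      unfolding resolvent_pairing_Suc by (rule order_trans[OF norm_triangle_ineq]) (simp add: norm_divide)
    also have "\<dots> \<le> M + (M / (1 - 1 / real q)) / real q"
      by (intro add_mono divide_right_mono trace_norm_pairing_le A Suc.IH form_bounded_shift Suc.prems) auto
    also have "\<dots> = M / (1 - 1 / real q)" using q by (simp add: field_simps)
    finally show ?case .
  qed
qed

text \<open>The original matrix is the resolvent minus its shift divided by q, which gives 1 + 1/q;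
  the cruder factor 2 suffices, as only finiteness is wanted.\<close>

lemma trace_norm_set_of_resolvent_le:
  assumes q: "2 \<le> q" and A: "\<And>t. t \<in> trace_norm_set (tau_resolvent q A) \<Longrightarrow> t \<le> M" and t: "t \<in> trace_norm_set A"
  shows "t \<le> 2 * M"
proof (rule trace_norm_set_le_of_pairing[OF _ t])
  fix K and C :: "nat \<Rightarrow> nat \<Rightarrow> complex" assume C: "form_bounded {..<K} C 1"
  have M0: "0 \<le> M" using trace_norm_diagonal_le[of "tau_resolvent q A" M 0 0 0, OF A] by simp
  show "cmod (\<Sum>i<K. \<Sum>j<K. A i j * C i j) \<le> 2 * M"
  proof (cases K)
    case 0
    then show ?thesis using M0 by simp
  next
    case (Suc K')
    let ?S = "\<Sum>i<K'. \<Sum>j<K'. tau_resolvent q A i j * C (Suc i) (Suc j)"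
    have "(\<Sum>i<K. \<Sum>j<K. A i j * C i j) = (\<Sum>i<K. \<Sum>j<K. tau_resolvent q A i j * C i j) - ?S / of_nat q"
      using resolvent_pairing_Suc[of q A C K'] Suc by simp
    then have "cmod (\<Sum>i<K. \<Sum>j<K. A i j * C i j)
        \<le> cmod (\<Sum>i<K. \<Sum>j<K. tau_resolvent q A i j * C i j) + cmod (?S / of_nat q)"
      by (simp only: norm_triangle_ineq4)
    note tri = this
    have "cmod ?S \<le> M"
      using C by (intro trace_norm_pairing_le[OF A] form_bounded_shift) (simp_all add: Suc)
    moreover have "cmod ?S / real q \<le> cmod ?S / 1" using q by (intro divide_left_mono) auto
    ultimately have "cmod (?S / of_nat q) \<le> M" by (simp add: norm_divide)
    moreover have "cmod (\<Sum>i<K. \<Sum>j<K. tau_resolvent q A i j * C i j) \<le> M"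
      by (rule trace_norm_pairing_le[OF A C])
    ultimately show ?thesis using tri by linarith
  qed
qed

section \<open>Even and odd limits of the symbol\<close>

lemma tendsto_even_odd:
  fixes f :: "nat \<Rightarrow> 'a::metric_space"
  assumes "(\<lambda>n. f (2 * n)) \<longlonglongrightarrow> L" "(\<lambda>n. f (2 * n + 1)) \<longlonglongrightarrow> L"
  shows "f \<longlonglongrightarrow> L"
proof (rule metric_LIMSEQ_I)
  fix e :: real assume "0 < e"
  obtain N1 where N1: "\<And>n. N1 \<le> n \<Longrightarrow> dist (f (2 * n)) L < e"
    using metric_LIMSEQ_D[OF assms(1) \<open>0 < e\<close>] by blast
  obtain N2 where N2: "\<And>n. N2 \<le> n \<Longrightarrow> dist (f (2 * n + 1)) L < e"
    using metric_LIMSEQ_D[OF assms(2) \<open>0 < e\<close>] by blast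
  have "dist (f n) L < e" if "2 * (N1 + N2) + 1 \<le> n" for n
  proof (cases "even n")
    case True
    then obtain k where "n = 2 * k" by blast
    then show ?thesis using N1[of k] that by simp
  next
    case False
    then obtain k where "n = 2 * k + 1" using oddE by blast
    then show ?thesis using N2[of k] that by simp
  qed
  then show "\<exists>no. \<forall>n\<ge>no. dist (f n) L < e" by blast
qed

text \<open>The offsets 2 and 3 are those at which the symbol occurs in the tail of
  \<open>lower_bound\<close>. The two limits determine the constants, which also yields
  uniqueness.\<close>

lemma pm_decomp_limits:
  assumes "pm_decomp \<phi> cp cm \<psi>"
  shows "(\<lambda>k. \<phi> (2 * k + 2)) \<longlonglongrightarrow> cp + cm" "(\<lambda>k. \<phi> (2 * k + 3)) \<longlonglongrightarrow> cp - cm"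
proof -
  have \<phi>: "\<phi> n = cp + cm * (-1) ^ n + \<psi> n" and \<psi>: "\<psi> \<longlonglongrightarrow> 0" for n
    using assms by (auto simp: pm_decomp_def)
  have sm: "strict_mono (\<lambda>k::nat. 2 * k + r)" for r by (rule strict_monoI) simp
  have \<psi>': "(\<lambda>k. \<psi> (2 * k + r)) \<longlonglongrightarrow> 0" for r
    using LIMSEQ_subseq_LIMSEQ[OF \<psi> sm] by (simp add: o_def)
  have "(\<lambda>k. cp + cm * 1 + \<psi> (2 * k + 2)) \<longlonglongrightarrow> cp + cm * 1 + 0"
    by (intro tendsto_intros \<psi>')
  then show "(\<lambda>k. \<phi> (2 * k + 2)) \<longlonglongrightarrow> cp + cm" by (simp add: \<phi>)
  have "(\<lambda>k. cp + cm * (-1) + \<psi> (2 * k + 3)) \<longlonglongrightarrow> cp + cm * (-1) + 0"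
    by (intro tendsto_intros \<psi>')
  moreover have "(-1::complex) ^ (2 * k + 3) = -1" for k by (simp add: power_add)
  ultimately show "(\<lambda>k. \<phi> (2 * k + 3)) \<longlonglongrightarrow> cp - cm" by (simp only: \<phi>) simp
qed

lemma pm_decomp_unique:
  assumes "pm_decomp \<phi> cp cm \<psi>" "pm_decomp \<phi> cp' cm' \<psi>'"
  shows "cp = cp'" "cm = cm'" "\<psi> = \<psi>'"
proof -
  have s: "cp + cm = cp' + cm'" and d: "cp - cm = cp' - cm'"
    using pm_decomp_limits[OF assms(1)] pm_decomp_limits[OF assms(2)] LIMSEQ_unique by blast+
  have "(cp + cm) + (cp - cm) = (cp' + cm') + (cp' - cm')" "(cp + cm) - (cp - cm) = (cp' + cm') - (cp' - cm')"
    by (simp_all only: s d)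
  then show c: "cp = cp'" "cm = cm'" by simp_all
  show "\<psi> = \<psi>'"
  proof
    fix n
    have "cp + cm * (-1) ^ n + \<psi> n = cp' + cm' * (-1) ^ n + \<psi>' n"
      using assms by (metis pm_decomp_def)
    then show "\<psi> n = \<psi>' n" using c by simp
  qed
qed

text \<open>The main diagonal and the one next to it consist of differences of the symbol at
  consecutive even and at consecutive odd arguments. They are summable, so both subsequences
  converge, and the constants are the half sum and half difference of the limits.\<close>

lemma trace_class_hankel_pm_decomp:
  assumes "trace_class (hankel \<phi>)"
  shows "\<exists>cp cm \<psi>. pm_decomp \<phi> cp cm \<psi>"
proof -
  obtain M where M: "\<And>t. t \<in> trace_norm_set (hankel \<phi>) \<Longrightarrow> t \<le> M"
    using assms by (auto simp: trace_class_def bdd_above_def)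
  have conv: "convergent (\<lambda>k. \<phi> (2 * k + r))" if "r \<le> 1" for r
  proof -
    have "summable (\<lambda>k. hankel \<phi> (0 + k) (r + k))"
      by (rule trace_norm_diagonal_tendsto_0(2)[OF M])
    moreover have "hankel \<phi> (0 + k) (r + k) = \<phi> (2 * k + r) - \<phi> (2 * Suc k + r)" for k
    proof -
      have "(0 + k) + (r + k) = 2 * k + r" "2 * k + r + 2 = 2 * Suc k + r" by simp_all
      then show ?thesis unfolding hankel_def by (simp only:)
    qed
    ultimately have "convergent (\<lambda>n. \<Sum>k<n. \<phi> (2 * k + r) - \<phi> (2 * Suc k + r))"
      by (simp only: summable_iff_convergent)
    moreover have "(\<Sum>k<n. \<phi> (2 * k + r) - \<phi> (2 * Suc k + r)) = \<phi> r - \<phi> (2 * n + r)" for n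
      by (induction n) simp_all
    ultimately have "convergent (\<lambda>n. \<phi> r - \<phi> (2 * n + r))" by (simp only:)
    from convergent_diff[OF convergent_const[of "\<phi> r"] this] show ?thesis by simp
  qed
  obtain \<alpha> where \<alpha>: "(\<lambda>k. \<phi> (2 * k)) \<longlonglongrightarrow> \<alpha>" using conv[of 0] by (auto simp: convergent_def)
  obtain \<beta> where \<beta>: "(\<lambda>k. \<phi> (2 * k + 1)) \<longlonglongrightarrow> \<beta>" using conv[of 1] by (auto simp: convergent_def)
  define \<psi> where "\<psi> n = \<phi> n - (\<alpha> + \<beta>) / 2 - (\<alpha> - \<beta>) / 2 * (-1) ^ n" for n
  have "(\<lambda>k. \<phi> (2 * k) - (\<alpha> + \<beta>) / 2 - (\<alpha> - \<beta>) / 2 * 1) \<longlonglongrightarrow> \<alpha> - (\<alpha> + \<beta>) / 2 - (\<alpha> - \<beta>) / 2 * 1"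
    by (intro tendsto_intros \<alpha>)
  moreover have "\<alpha> - (\<alpha> + \<beta>) / 2 - (\<alpha> - \<beta>) / 2 * 1 = 0" by (simp add: field_simps)
  moreover have "\<psi> (2 * k) = \<phi> (2 * k) - (\<alpha> + \<beta>) / 2 - (\<alpha> - \<beta>) / 2 * 1" for k by (simp add: \<psi>_def)
  ultimately have even: "(\<lambda>k. \<psi> (2 * k)) \<longlonglongrightarrow> 0" by (simp only:)
  have "(\<lambda>k. \<phi> (2 * k + 1) - (\<alpha> + \<beta>) / 2 - (\<alpha> - \<beta>) / 2 * (-1)) \<longlonglongrightarrow> \<beta> - (\<alpha> + \<beta>) / 2 - (\<alpha> - \<beta>) / 2 * (-1)"
    by (intro tendsto_intros \<beta>)
  moreover have "\<beta> - (\<alpha> + \<beta>) / 2 - (\<alpha> - \<beta>) / 2 * (-1) = 0" by (simp add: field_simps)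
  moreover have "\<psi> (2 * k + 1) = \<phi> (2 * k + 1) - (\<alpha> + \<beta>) / 2 - (\<alpha> - \<beta>) / 2 * (-1)" for k
    by (simp add: \<psi>_def)
  ultimately have odd: "(\<lambda>k. \<psi> (2 * k + 1)) \<longlonglongrightarrow> 0" by (simp only:)
  have "\<psi> \<longlonglongrightarrow> 0" by (rule tendsto_even_odd[OF even odd])
  then have "pm_decomp \<phi> ((\<alpha> + \<beta>) / 2) ((\<alpha> - \<beta>) / 2) \<psi>"
    by (simp add: pm_decomp_def \<psi>_def)
  then show ?thesis by blast
qed

section \<open>The Schur norm\<close>

context horocyclic_tree
begin

text \<open>The choice \<open>a = b = 0\<close> switches off the tail of the test matrix. No
  decomposition of the symbol is needed, so the bound is available for deriving the trace class
  property.\<close>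

lemma resolvent_trace_norm_bounded:
  fixes \<phi> :: "nat \<Rightarrow> complex"
  assumes M: "\<And>A F. contraction A \<Longrightarrow> finite F \<Longrightarrow> form_bounded F (\<lambda>x y. \<phi> (d x y) * A x y) M"
    and t: "t \<in> trace_norm_set (tau_resolvent q (hankel \<phi>))"
  shows "t \<le> M / (1 - 1 / real q)"
proof (rule trace_norm_set_le_of_pairing[OF _ t])
  fix K and C :: "nat \<Rightarrow> nat \<Rightarrow> complex" assume C: "form_bounded {..<K} C 1"
  define r where "r = 1 - 1 / real q"
  have r: "0 < r" using q_ge_2 by (simp add: r_def)
  have c: "1 - 1 / of_nat q = complex_of_real r" by (simp add: r_def)
  have "cmod ((1 - 1 / of_nat q) * (\<Sum>i<K. \<Sum>j<K. tau_resolvent q (hankel \<phi>) i j * C i j)) \<le> M"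
    using lower_bound[OF M C, of 0 0] by simp
  then have "r * cmod (\<Sum>i<K. \<Sum>j<K. tau_resolvent q (hankel \<phi>) i j * C i j) \<le> M"
    unfolding c norm_mult using r by simp
  then show "cmod (\<Sum>i<K. \<Sum>j<K. tau_resolvent q (hankel \<phi>) i j * C i j) \<le> M / (1 - 1 / real q)"
    unfolding r_def[symmetric] using r by (simp add: pos_le_divide_eq mult.commute)
qed

lemma phase_exists: "\<exists>w. cmod w \<le> 1 \<and> w * z = of_real (cmod z)" for z :: complex
proof (cases "z = 0")
  case False
  have "cnj z / of_real (cmod z) * z = of_real (cmod z)"
    using complex_norm_square[of z] False by (simp add: power2_eq_square field_simps)
  then show ?thesis using False by (intro exI[of _ "cnj z / of_real (cmod z)"]) (simp add: norm_divide)
qed (simp add: exI[of _ 0])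

lemma form_bounded_phase:
  assumes "form_bounded F B 1" "cmod w \<le> 1"
  shows "form_bounded F (\<lambda>i j. w * B i j) 1"
  unfolding form_bounded_def form_cmult
proof (intro allI)
  fix u v
  have "cmod (w * form F B u v) \<le> cmod (form F B u v)"
    using mult_right_mono[OF assms(2), of "cmod (form F B u v)"] by (simp add: norm_mult)
  also have "\<dots> \<le> 1 * (sqnorm_on F u + sqnorm_on F v) / 2"
    using assms(1) by (simp only: form_bounded_def)
  finally show "cmod (w * form F B u v) \<le> 1 * (sqnorm_on F u + sqnorm_on F v) / 2" .
qed

text \<open>\<open>B\<close> is padded by zeros so that \<open>N\<close> can grow with the pairing
  unchanged. Resolvent entries on and beside the diagonal vanish in the limit, and (a + b)/2 (c+ +
  c-) + (a - b)/2 (c+ - c-) = a c+ + b c-.\<close>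

lemma lower_bound_limit:
  fixes \<phi> :: "nat \<Rightarrow> complex"
  assumes M: "\<And>A F. contraction A \<Longrightarrow> finite F \<Longrightarrow> form_bounded F (\<lambda>x y. \<phi> (d x y) * A x y) M"
    and dec: "pm_decomp \<phi> cp cm \<psi>" and B: "form_bounded {..<K} B 1" and a: "cmod a \<le> 1" and b: "cmod b \<le> 1"
  shows "cmod ((1 - 1 / of_nat q) * (\<Sum>i<K. \<Sum>j<K. tau_resolvent q (hankel \<phi>) i j * B i j) + (a * cp + b * cm)) \<le> M"
proof -
  define h where "h = tau_resolvent q (hankel \<phi>)"
  define B' where "B' i j = (if i < K \<and> j < K then B i j else 0)" for i j
  have B': "form_bounded {..<N} B' 1" if "K \<le> N" for N
    unfolding form_bounded_def
  proof (intro allI)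
    fix u v
    have "form {..<N} B' u v = form {..<K} B u v"
      unfolding form_def using that
      by (intro sum.mono_neutral_cong_right ballI) (auto simp: B'_def intro!: sum.mono_neutral_cong_right)
    then have "cmod (form {..<N} B' u v) \<le> 1 * (sqnorm_on {..<K} u + sqnorm_on {..<K} v) / 2"
      using B by (simp only: form_bounded_def)
    also have "\<dots> \<le> 1 * (sqnorm_on {..<N} u + sqnorm_on {..<N} v) / 2"
      unfolding sqnorm_on_def using that
      by (intro divide_right_mono mult_left_mono add_mono sum_mono2) auto
    finally show "cmod (form {..<N} B' u v) \<le> 1 * (sqnorm_on {..<N} u + sqnorm_on {..<N} v) / 2" .
  qed
  let ?S = "(1 - 1 / of_nat q) * (\<Sum>i<K. \<Sum>j<K. h i j * B i j)"
  have sum_eq: "(\<Sum>i<N. \<Sum>j<N. h i j * B' i j) = (\<Sum>i<K. \<Sum>j<K. h i j * B i j)" if "K \<le> N" for N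
    using that by (intro sum.mono_neutral_cong_right ballI) (auto simp: B'_def intro!: sum.mono_neutral_cong_right)
  let ?L = "\<lambda>N. ?S + ((a + b) / 2 * (\<phi> (2*N + 2) + h N N) + (a - b) / 4 * (2 * \<phi> (2*N + 3) + h (Suc N) N + h N (Suc N)))"
  have le: "cmod (?L N) \<le> M" if "K \<le> N" for N
    using lower_bound[OF M B'[OF that] a b, folded h_def] unfolding sum_eq[OF that] by blast
  have hM: "t \<le> M / (1 - 1 / real q)" if "t \<in> trace_norm_set h" for t
    by (rule resolvent_trace_norm_bounded[OF M]) (use that in \<open>simp_all add: h_def\<close>)
  have h: "(\<lambda>N. h N N) \<longlonglongrightarrow> 0" "(\<lambda>N. h (Suc N) N) \<longlonglongrightarrow> 0" "(\<lambda>N. h N (Suc N)) \<longlonglongrightarrow> 0"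
    using trace_norm_diagonal_tendsto_0(1)[of h _ 0 0, OF hM] trace_norm_diagonal_tendsto_0(1)[of h _ 1 0, OF hM]
      trace_norm_diagonal_tendsto_0(1)[of h _ 0 1, OF hM] by simp_all
  have "?L \<longlonglongrightarrow> ?S + ((a + b) / 2 * ((cp + cm) + 0) + (a - b) / 4 * (2 * (cp - cm) + 0 + 0))"
    by (intro tendsto_intros pm_decomp_limits[OF dec] h)
  moreover have "?S + ((a + b) / 2 * ((cp + cm) + 0) + (a - b) / 4 * (2 * (cp - cm) + 0 + 0)) = ?S + (a * cp + b * cm)"
    by (simp add: field_simps)
  ultimately have "(\<lambda>N. cmod (?L N)) \<longlonglongrightarrow> cmod (?S + (a * cp + b * cm))"
    by (simp only: tendsto_norm)
  moreover have "\<forall>\<^sub>F N in sequentially. cmod (?L N) \<le> M"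
    using eventually_ge_at_top[of K] by (rule eventually_mono) (rule le)
  ultimately have "cmod (?S + (a * cp + b * cm)) \<le> M"
    by (rule tendsto_upperbound) simp
  then show ?thesis by (simp only: h_def)
qed

text \<open>The phases \<open>a\<close>, \<open>b\<close> and \<open>w\<close> are independent, so
  all three contributions can be made nonnegative at once and the triangle inequality of the upper
  bound becomes an equality.\<close>

lemma schur_lower_bound:
  fixes \<phi> :: "nat \<Rightarrow> complex"
  assumes M: "\<And>A F. contraction A \<Longrightarrow> finite F \<Longrightarrow> form_bounded F (\<lambda>x y. \<phi> (d x y) * A x y) M"
    and dec: "pm_decomp \<phi> cp cm \<psi>" and t: "t \<in> trace_norm_set (tau_resolvent q (hankel \<phi>))"
  shows "cmod cp + cmod cm + (1 - 1 / real q) * t \<le> M"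
proof -
  define h where "h = tau_resolvent q (hankel \<phi>)"
  define r where "r = 1 - 1 / real q"
  have r: "0 < r" using q_ge_2 by (simp add: r_def)
  have c: "1 - 1 / of_nat q = complex_of_real r" by (simp add: r_def)
  have "t \<le> (M - cmod cp - cmod cm) / r"
  proof (rule trace_norm_set_le_of_pairing[OF _ t])
    fix K and C :: "nat \<Rightarrow> nat \<Rightarrow> complex" assume C: "form_bounded {..<K} C 1"
    obtain a where a: "cmod a \<le> 1" "a * cp = of_real (cmod cp)" using phase_exists by blast
    obtain b where b: "cmod b \<le> 1" "b * cm = of_real (cmod cm)" using phase_exists by blast
    obtain w where w: "cmod w \<le> 1" "w * (\<Sum>i<K. \<Sum>j<K. h i j * C i j) = of_real (cmod (\<Sum>i<K. \<Sum>j<K. h i j * C i j))"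
      using phase_exists by blast
    have "(\<Sum>i<K. \<Sum>j<K. h i j * (w * C i j)) = of_real (cmod (\<Sum>i<K. \<Sum>j<K. h i j * C i j))"
      unfolding w(2)[symmetric] sum_distrib_left by (simp add: mult_ac)
    then have "cmod (of_real (r * cmod (\<Sum>i<K. \<Sum>j<K. h i j * C i j) + (cmod cp + cmod cm))) \<le> M"
      using lower_bound_limit[OF M dec form_bounded_phase[OF C w(1)] a(1) b(1)]
      unfolding h_def[symmetric] a(2) b(2) c by simp
    then have "r * cmod (\<Sum>i<K. \<Sum>j<K. h i j * C i j) + (cmod cp + cmod cm) \<le> M"
      unfolding norm_of_real by linarith
    then show "cmod (\<Sum>i<K. \<Sum>j<K. tau_resolvent q (hankel \<phi>) i j * C i j) \<le> (M - cmod cp - cmod cm) / r"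
      unfolding h_def[symmetric] using r by (simp add: pos_le_divide_eq mult.commute)
  qed
  then have "r * t \<le> M - cmod cp - cmod cm" using r by (simp add: pos_le_divide_eq mult.commute)
  then show ?thesis by (simp add: r_def)
qed

section \<open>From contractions to the Schur norm\<close>

lemma contraction_iff_op_norm: "contraction A \<longleftrightarrow> bounded_matrix A \<and> op_norm A \<le> 1"
  using op_norm_le[of 1 A] form_bounded_op_norm[of A] form_bounded_mono[of _ A "op_norm A" 1]
  by (auto simp: contraction_def)

lemma schur_multiplier_if_form_bounded:
  fixes \<psi> :: "'v \<Rightarrow> 'v \<Rightarrow> complex"
  assumes M: "\<And>A F. contraction A \<Longrightarrow> finite F \<Longrightarrow> form_bounded F (\<lambda>x y. \<psi> x y * A x y) M" and "0 \<le> M"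
  shows "schur_multiplier \<psi>"
  unfolding schur_multiplier_def
proof (intro allI impI)
  fix A :: "'v \<Rightarrow> 'v \<Rightarrow> complex" assume A: "bounded_matrix A"
  \<comment> \<open>Adding 1 allows division even when the operator norm is 0.\<close>
  define s where "s = op_norm A + 1"
  have s: "0 < s" using op_norm_nonneg[OF A] by (simp add: s_def)
  let ?A = "\<lambda>x y. of_real (1 / s) * A x y"
  have sc: "cmod (of_real (1 / s) * z) = cmod z / s" for z using s by (simp add: norm_mult norm_divide)
  have "contraction ?A"
    unfolding contraction_def form_bounded_def form_cmult sc
  proof (intro allI impI)
    fix F u v assume "finite (F :: 'v set)"
    then have "form_bounded F A s"
      by (intro form_bounded_mono[OF form_bounded_op_norm[OF A]]) (simp_all add: s_def)
    then have "cmod (form F A u v) / s \<le> (s * (sqnorm_on F u + sqnorm_on F v) / 2) / s"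
      using s unfolding form_bounded_def by (intro divide_right_mono) auto
    then show "cmod (form F A u v) / s \<le> 1 * (sqnorm_on F u + sqnorm_on F v) / 2" using s by simp
  qed
  note bound = M[OF this]
  show "bounded_matrix (\<lambda>x y. \<psi> x y * A x y)"
  proof (rule op_norm_le(1))
    show "0 \<le> s * M" using s assms(2) by simp
    fix F :: "'v set" assume F: "finite F"
    show "form_bounded F (\<lambda>x y. \<psi> x y * A x y) (s * M)"
      unfolding form_bounded_def
    proof (intro allI)
      fix u v
      have "(\<lambda>x y. \<psi> x y * ?A x y) = (\<lambda>x y. of_real (1 / s) * (\<psi> x y * A x y))"
        by (simp add: fun_eq_iff)
      then have "cmod (form F (\<lambda>x y. \<psi> x y * A x y) u v) / s \<le> M * (sqnorm_on F u + sqnorm_on F v) / 2"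
        using bound[OF F] unfolding form_bounded_def by (simp only: form_cmult sc)
      then show "cmod (form F (\<lambda>x y. \<psi> x y * A x y) u v) \<le> s * M * (sqnorm_on F u + sqnorm_on F v) / 2"
        using s by (simp add: pos_divide_le_eq mult_ac)
    qed
  qed
qed

lemma schur_multiplier_iff_trace_class:
  "schur_multiplier (\<lambda>x y. \<phi> (d x y)) \<longleftrightarrow> trace_class (hankel \<phi>)"
proof
  assume "schur_multiplier (\<lambda>x y. \<phi> (d x y))"
  from schur_multiplier_uniformly_bounded[OF this] obtain M
    where M: "\<And>A F. contraction A \<Longrightarrow> finite F \<Longrightarrow> form_bounded F (\<lambda>x y. \<phi> (d x y) * A x y) M" by blast
  have "t \<le> 2 * (M / (1 - 1 / real q))" if "t \<in> trace_norm_set (hankel \<phi>)" for t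
    by (rule trace_norm_set_of_resolvent_le[OF q_ge_2 _ that])
      (rule resolvent_trace_norm_bounded[OF M])
  then show "trace_class (hankel \<phi>)" by (auto simp: trace_class_def bdd_above_def)
next
  assume tc: "trace_class (hankel \<phi>)"
  then obtain M where M: "\<And>t. t \<in> trace_norm_set (hankel \<phi>) \<Longrightarrow> t \<le> M"
    by (auto simp: trace_class_def bdd_above_def)
  obtain cp cm \<psi> where dec: "pm_decomp \<phi> cp cm \<psi>" using trace_class_hankel_pm_decomp[OF tc] by blast
  let ?M = "M / (1 - 1 / real q)"
  have M': "t \<le> ?M" if "t \<in> trace_norm_set (tau_resolvent q (hankel \<phi>))" for t
    using trace_norm_set_resolvent_le[OF q_ge_2 M that] .
  have M0: "0 \<le> ?M" using trace_norm_diagonal_le[of _ ?M 0 0 0, OF M'] by simp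
  have r: "0 \<le> 1 - 1 / real q" using q_ge_2 by simp
  show "schur_multiplier (\<lambda>x y. \<phi> (d x y))"
  proof (rule schur_multiplier_if_form_bounded)
    show "form_bounded F (\<lambda>x y. \<phi> (d x y) * A x y) (cmod cp + cmod cm + (1 - 1 / real q) * ?M)"
      if "contraction A" "finite F" for A F
      using that by (intro schur_form_bounded[OF dec M' M0]) (simp_all add: contraction_def)
    show "0 \<le> cmod cp + cmod cm + (1 - 1 / real q) * ?M"
      by (intro add_nonneg_nonneg mult_nonneg_nonneg r M0) auto
  qed
qed

text \<open>The supremum in the definition of the Schur norm is itself a uniform bound over
  contractions, so it is an admissible \<open>M\<close> in \<open>schur_lower_bound\<close>; the set
  is bounded above by the estimate from \<open>schur_form_bounded\<close>.\<close>

lemma schur_norm_eq: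
  assumes tc: "trace_class (hankel \<phi>)" and dec: "pm_decomp \<phi> cp cm \<psi>"
  shows "schur_norm (\<lambda>x y. \<phi> (d x y))
    = cmod cp + cmod cm + (1 - 1 / real q) * trace_norm (tau_resolvent q (hankel \<phi>))"
proof -
  define h where "h = tau_resolvent q (hankel \<phi>)"
  define r where "r = 1 - 1 / real q"
  have r: "0 < r" using q_ge_2 by (simp add: r_def)
  obtain M where M: "\<And>t. t \<in> trace_norm_set (hankel \<phi>) \<Longrightarrow> t \<le> M"
    using tc by (auto simp: trace_class_def bdd_above_def)
  have bdd: "bdd_above (trace_norm_set h)"
    using trace_norm_set_resolvent_le[OF q_ge_2 M] by (auto simp: h_def bdd_above_def)
  have h_le: "t \<le> trace_norm h" if "t \<in> trace_norm_set h" for t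
    unfolding trace_norm_def by (rule cSup_upper[OF that bdd])
  have "0 \<in> trace_norm_set h"
    unfolding trace_norm_set_def mem_Collect_eq
    by (rule exI[of _ "0::nat"], rule exI[of _ "{}"]) (simp add: orthonormal_on_def)
  then have h_ne: "trace_norm_set h \<noteq> {}" by blast
  have h_0: "0 \<le> trace_norm h" using trace_norm_diagonal_le[of h _ 0 0 0, OF h_le] by simp
  let ?V = "cmod cp + cmod cm + r * trace_norm h"
  let ?S = "{op_norm (\<lambda>x y. \<phi> (d x y) * A x y) | A. bounded_matrix A \<and> op_norm A \<le> 1}"
  have V0: "0 \<le> ?V" using r h_0 by simp
  have up: "form_bounded F (\<lambda>x y. \<phi> (d x y) * A x y) ?V" if "contraction A" "finite F" for A F
    using schur_form_bounded[OF dec h_le[unfolded h_def] h_0[unfolded h_def]] that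
    by (simp add: contraction_def h_def r_def)
  have S_le: "x \<le> ?V" if "x \<in> ?S" for x
    using that op_norm_le(2)[OF V0 up] by (auto simp: contraction_iff_op_norm)
  have S_ne: "?S \<noteq> {}" using contraction_zero contraction_iff_op_norm by blast
  have S_bdd: "bdd_above ?S" using S_le by (auto simp: bdd_above_def)
  have "Sup ?S \<le> ?V" by (rule cSup_least[OF S_ne S_le])
  moreover have "?V \<le> Sup ?S"
  proof -
    have low: "form_bounded F (\<lambda>x y. \<phi> (d x y) * A x y) (Sup ?S)" if "contraction A" "finite F" for A F
    proof (rule form_bounded_mono)
      show "form_bounded F (\<lambda>x y. \<phi> (d x y) * A x y) (op_norm (\<lambda>x y. \<phi> (d x y) * A x y))"
        by (rule form_bounded_op_norm[OF op_norm_le(1)[OF V0 up] \<open>finite F\<close>]) (rule \<open>contraction A\<close>)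
      show "op_norm (\<lambda>x y. \<phi> (d x y) * A x y) \<le> Sup ?S"
        using that by (intro cSup_upper S_bdd) (auto simp: contraction_iff_op_norm)
    qed
    have "t \<le> (Sup ?S - cmod cp - cmod cm) / r" if "t \<in> trace_norm_set h" for t
      using schur_lower_bound[OF low dec that[unfolded h_def]] r
      unfolding r_def[symmetric] by (simp add: pos_le_divide_eq mult.commute)
    then have "trace_norm h \<le> (Sup ?S - cmod cp - cmod cm) / r"
      unfolding trace_norm_def by (rule cSup_least[OF h_ne])
    then show ?thesis using r by (simp add: pos_le_divide_eq mult.commute)
  qed
  ultimately show ?thesis unfolding schur_norm_def h_def r_def by (rule antisym)
qed

end

theorem theorem1p3:
  fixes E :: "'v \<Rightarrow> 'v \<Rightarrow> bool" and q :: nat and x0 :: 'v and \<phi> :: "nat \<Rightarrow> complex"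
  assumes "homogeneous_tree E q" and "2 \<le> q"
  shows "(schur_multiplier (\<lambda>x y. \<phi> (gdist E x y)) \<longleftrightarrow> trace_class (hankel \<phi>)) \<and>
    (trace_class (hankel \<phi>) \<longrightarrow>
       (\<exists>!(cp, cm, \<psi>). pm_decomp \<phi> cp cm \<psi>) \<and>
       (\<forall>cp cm \<psi>. pm_decomp \<phi> cp cm \<psi> \<longrightarrow>
          schur_norm (\<lambda>x y. \<phi> (gdist E x y)) =
            cmod cp + cmod cm + (1 - 1 / real q) * trace_norm (tau_resolvent q (hankel \<phi>))))"
proof -
  obtain c height where "horocyclic_tree c height (gdist E) q"
    using homogeneous_tree_horocyclic[OF assms] .
  then interpret horocyclic_tree c height "gdist E" q .
  have "\<exists>!(cp, cm, \<psi>). pm_decomp \<phi> cp cm \<psi>" if tc: "trace_class (hankel \<phi>)"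
  proof -
    obtain cp cm \<psi> where dec: "pm_decomp \<phi> cp cm \<psi>" using trace_class_hankel_pm_decomp[OF tc] by blast
    show ?thesis
    proof (rule ex1I[of _ "(cp, cm, \<psi>)"])
      show "case (cp, cm, \<psi>) of (cp, cm, \<psi>) \<Rightarrow> pm_decomp \<phi> cp cm \<psi>" using dec by simp
      fix p assume "case p of (cp, cm, \<psi>) \<Rightarrow> pm_decomp \<phi> cp cm \<psi>"
      then show "p = (cp, cm, \<psi>)" using pm_decomp_unique[OF _ dec] by (cases p) auto
    qed
  qed
  then show ?thesis
    using schur_multiplier_iff_trace_class[of \<phi>] schur_norm_eq[of \<phi>] by blast
qed

end
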